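(* Let $\beta\in\mathbb{Z}_+$. Given $n\in\mathbb{Z}_+$ and $m\in\mathbb{N}$, if the parameters $\epsilon_j$ are chosen as $$\epsilon_j=\frac13\,\frac{2m-2j+1}{2m+1},\qquad j=1,\ldots,m,$$ then, for all $k\ge k_0$ and $\mathbf{d}=(d,\ldots,d)\in\mathbb{N}^{4m}$ with $d\ge n-1$, $$\|\eta-\hat\eta_\beta\|_{L^2(\partial K)}\le C\,\frac{C_k}{c_k}\,k^{-\frac{\beta}{3}}\,m\,\frac{1+\delta_{n,1}\sqrt{\log k}+H[n-2]\,\big(k^{\frac{1}{6m+3}}\big)^{n-1}}{d^n}$$ for the $\beta$-asymptotic frequency-adapted Galerkin approximation $\hat\eta_\beta\in\sigma_\beta+\mathcal{G}_{\mathbf d}$ to $\eta$, where $C>0$ is independent of the wavenumber $k$ and of $d$ (it may depend on the given $n$, $m$, $\beta$ and on the other fixed data). Here $\delta$ is the Kronecker delta and $H$ is the Heaviside function, $H[x]=1$ for $x\ge0$ and $H[x]=0$ for $x<0$.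
   Context: Notation: $\mathbb{Z}_+=\{0,1,2,\ldots\}$, $\mathbb{N}=\{1,2,\ldots\}$, $-\mathbb{N}=\{-1,-2,\ldots\}$, $t_-=\min\{t,0\}$; an empty sum is zero. Scattering problem. $K\subset\mathbb{R}^2$ is a compact, strictly convex obstacle with smooth boundary of length $2P$ and exterior unit normal $\nu$; $u^{\rm inc}(x)=e^{ik\alpha\cdot x}$ with $|\alpha|=1$, $k>0$; $u$ is the solution of $(\Delta+k^2)u=0$ in $\mathbb{R}^2\setminus K$, $\partial_\nu u=-\partial_\nu u^{\rm inc}$ on $\partial K$, $\lim_{r=|x|\to\infty}\sqrt r(\partial_r u-iku)=0$. The total field on $\partial K$ is $\eta=u+u^{\rm inc}$. $\gamma$ is the $2P$-periodic counterclockwise arc length parametrization of $\partial K$ for which $\alpha\cdot\nu(\gamma(s))$ vanishes on $[0,2P]$ exactly at $s=t_1,t_2$, with $0<t_1<t_2<2P$, $t_1+t_2=2P$, is negative on $(t_1,t_2)$ (illuminated region) and positive on $[0,t_1)\cup(t_2,2P]$ (shadow region). Functions on $\partial K$ are identified via $\gamma$ with $2P$-periodic functions of $s$; $\eta^{\rm slow}(s,k)=e^{-ik\alpha\cdot\gamma(s)}\eta(s,k)$. Hörmander class: a $C^\infty$ function $a(s,k)$ on $[0,2P]\times(0,\infty)$ belongs to $S^{\mu}_{\varrho,\delta}$ if for all $n,m\in\mathbb{Z}_+$ and every $\kappa>0$ there is $C$ with $|D_s^nD_k^m a(s,k)|\le C k^{\mu+\delta n-\varrho m}$ for $s\in[0,2P]$,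 $k\ge\kappa$. Asymptotic expansion (a known fact). $\eta^{\rm slow}\in S^0_{\frac23,\frac13}$ and $\eta^{\rm slow}\sim\sum_{p,q,r\in\mathbb{Z}_+,\,\ell\in-\mathbb{N}}a_{p,q,r,\ell}$ with $$a_{p,q,r,\ell}(s,k)=k^{-\frac{1+2p+3q+r+\ell}{3}+(\ell+1)_-}\,b_{p,q,r,\ell}(s)\,(\Psi^{r,\ell})^{(p)}(k^{\frac13}Z(s)),$$ where $b_{p,q,r,\ell}$ are $2P$-periodic complex-valued $C^\infty$ functions; $Z$ is a $2P$-periodic real-valued $C^\infty$ function, positive on the illuminated region, negative on the shadow region, vanishing precisely to first order at $t_1,t_2$; $\Psi^{r,\ell}$ are complex-valued $C^\infty$ functions on $\mathbb{R}$ with $\Psi^{r,\ell}(\tau)\sim\sum_{j\in\mathbb{Z}_+}a_{r,\ell,j}\tau^{1+\ell-2r-3j}$ as $\tau\to+\infty$ (in the sense of symbols) and rapidly decreasing with all derivatives as $\tau\to-\infty$. The relation $\sim$ means: for every $M>0$ there is a finite index set $F_M$ such that $\eta^{\rm slow}-\sum_{F}a_{p,q,r,\ell}\in S^{-M}_{\frac23,\frac13}$ for every finite $F\supseteq F_M$. Definition of $\sigma_\beta$. $$\vartheta(p,q,r,\ell)=-\frac{1+2p+3q+r+\ell}{3}+(\ell+1)_-+\begin{cases}0, & 1+\ell-2r-p<0,\\ \frac{1+\ell-2r-p}{3}, & 1+\ell-2r-p\ge 0,\end{cases}$$ $\mathcal{F}_\beta=\{(p,q,r,\ell)\in\mathbb{Z}_+^3\times(-\mathbb{N}):\vartheta(p,q,r,\ell)>-\beta/3\}$,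 $\sigma_\beta^{\rm slow}=\sum_{\mathcal{F}_\beta}a_{p,q,r,\ell}$, $\sigma_\beta=e^{ik\alpha\cdot\gamma}\sigma_\beta^{\rm slow}$, $\rho_\beta=\eta-\sigma_\beta$. Integral equation. For some $k_0>1$ and all $k\ge k_0$, $\eta$ solves an integral equation $\mathcal{R}_k\eta=f$ on $L^2(\partial K)$ where the linear operator $\mathcal{R}_k$ is continuous and coercive with constants $C_k,c_k>0$: $|\langle\mu,\mathcal{R}_k\phi\rangle|\le C_k\|\mu\|\|\phi\|$ and $|\langle\mu,\mathcal{R}_k\mu\rangle|\ge c_k\|\mu\|^2$ for all $\mu,\phi\in L^2(\partial K)$. Put $f_\beta=f-\mathcal{R}_k\sigma_\beta$, so that $\mathcal{R}_k\rho_\beta=f_\beta$. Regions. Given reals $0<\epsilon_m<\epsilon_{m-1}<\cdots<\epsilon_1<\frac13$ and fixed positive reals $\xi_1,\xi_2,\zeta_1,\zeta_2$ with $t_1+\xi_1<t_2-\xi_2$ and $t_2+\zeta_2<2P+t_1-\zeta_1$. For $j=1,\ldots,m-1$ let (intervals in the parameter domain, modulo $2P$) $R_j=[t_1+\xi_1k^{-\frac13+\epsilon_{j+1}},\,t_1+\xi_1k^{-\frac13+\epsilon_j}]$, $R_{m+j}=[t_2-\xi_2k^{-\frac13+\epsilon_j},\,t_2-\xi_2k^{-\frac13+\epsilon_{j+1}}]$, $R_{2m+j}=[t_1-\zeta_1k^{-\frac13+\epsilon_j},\,t_1-\zeta_1k^{-\frac13+\epsilon_{j+1}}]$, $R_{3m+j}=[t_2+\zeta_2k^{-\frac13+\epsilon_{j+1}},\,t_2+\zeta_2k^{-\frac13+\epsilon_j}]$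 (absent if $m=1$), and $R_m=[t_1+\xi_1k^{-\frac13+\epsilon_1},\,t_2-\xi_2k^{-\frac13+\epsilon_1}]$, $R_{2m}=[t_2+\zeta_2k^{-\frac13+\epsilon_1},\,2P+t_1-\zeta_1k^{-\frac13+\epsilon_1}]$, $R_{3m}=[t_1-\zeta_1k^{-\frac13+\epsilon_m},\,t_1+\xi_1k^{-\frac13+\epsilon_m}]$, $R_{4m}=[t_2-\xi_2k^{-\frac13+\epsilon_m},\,t_2+\zeta_2k^{-\frac13+\epsilon_m}]$. Galerkin method. $\mathbb{P}_d$ is the space of polynomials of degree at most $d$, $\mathbf{1}_R$ the characteristic function of $R$, and for $\mathbf d=(d_1,\ldots,d_{4m})$, $\mathcal{G}_{\mathbf d}=e^{ik\alpha\cdot\gamma}\bigoplus_{j=1}^{4m}\mathbf{1}_{R_j}\mathbb{P}_{d_j}\subset L^2(\partial K)$. The $\beta$-asymptotic frequency-adapted Galerkin approximation is $\hat\eta_\beta=\sigma_\beta+\hat\rho_\beta$, where $\hat\rho_\beta\in\mathcal{G}_{\mathbf d}$ is the unique solution of $\langle\hat\mu,\mathcal{R}_k\hat\rho_\beta\rangle=\langle\hat\mu,f_\beta\rangle$ for all $\hat\mu\in\mathcal{G}_{\mathbf d}$. *)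

theory Defs
  imports
    "HOL-Analysis.Analysis"
    "HOL-Library.Landau_Symbols"
    "HOL-Computational_Algebra.Polynomial"
begin

section \<open>Smoothness\<close>

abbreviation dir_deriv ::
    "'a::real_normed_vector \<Rightarrow> ('a \<Rightarrow> 'b::real_normed_vector) \<Rightarrow> 'a \<Rightarrow> 'b" where
  "dir_deriv v f \<equiv> (\<lambda>x. frechet_derivative f (at x) v)"

text \<open>Meant for open \<open>S\<close>.\<close>

primrec C_on :: "nat \<Rightarrow> 'a::real_normed_vector set \<Rightarrow> ('a \<Rightarrow> 'b::real_normed_vector) \<Rightarrow> bool" where
  "C_on 0 S f \<longleftrightarrow> continuous_on S f"
| "C_on (Suc n) S f \<longleftrightarrow> (\<forall>x\<in>S. f differentiable (at x)) \<and> (\<forall>v. C_on n S (dir_deriv v f))"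

definition C_infinity_on :: "'a::real_normed_vector set \<Rightarrow> ('a \<Rightarrow> 'b::real_normed_vector) \<Rightarrow> bool" where
  "C_infinity_on S f \<longleftrightarrow> (\<forall>n. C_on n S f)"

definition nth_vderiv :: "nat \<Rightarrow> (real \<Rightarrow> 'b::real_normed_vector) \<Rightarrow> real \<Rightarrow> 'b" where
  "nth_vderiv n f = ((\<lambda>g t. vector_derivative g (at t)) ^^ n) f"

definition periodic_smooth :: "real \<Rightarrow> (real \<Rightarrow> 'b::real_normed_vector) \<Rightarrow> bool" where
  "periodic_smooth T f \<longleftrightarrow> C_infinity_on UNIV f \<and> (\<forall>s. f (s + T) = f s)"


section \<open>The scattering problem\<close>

definition strictly_convex :: "'a::euclidean_space set \<Rightarrow> bool" where
  "strictly_convex K \<longleftrightarrow> (\<forall>x\<in>K. \<forall>y\<in>K. x \<noteq> y \<longrightarrow> open_segment x y \<subseteq> interior K)"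

text \<open>The unit tangent of a unit speed curve in the plane, rotated clockwise by a right angle.\<close>

definition right_normal :: "(real \<Rightarrow> real^2) \<Rightarrow> real \<Rightarrow> real^2" where
  "right_normal \<gamma> s =
     vector [vector_derivative \<gamma> (at s) $ 2, - (vector_derivative \<gamma> (at s) $ 1)]"

text \<open>
  The last conjunct says that the right normal points out of the convex set \<open>K\<close>, that is,
  it is the exterior unit normal \<open>\<nu> (\<gamma> s)\<close>, which is the case precisely if \<open>\<gamma>\<close> runs
  counterclockwise.
\<close>

definition convex_obstacle :: "(real^2) set \<Rightarrow> real \<Rightarrow> (real \<Rightarrow> real^2) \<Rightarrow> bool" where
  "convex_obstacle K P \<gamma> \<longleftrightarrow>
     compact K \<and> strictly_convex K \<and> P > 0 \<and>
     periodic_smooth (2 * P) \<gamma> \<and>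
     (\<forall>s. norm (vector_derivative \<gamma> (at s)) = 1) \<and>
     inj_on \<gamma> {0..<2 * P} \<and> \<gamma> ` {0..2 * P} = frontier K \<and>
     (\<forall>s. \<forall>y\<in>K. right_normal \<gamma> s \<bullet> (y - \<gamma> s) \<le> 0)"

definition shadow_boundary :: "real \<Rightarrow> (real \<Rightarrow> real^2) \<Rightarrow> real^2 \<Rightarrow> real \<Rightarrow> real \<Rightarrow> bool" where
  "shadow_boundary P \<gamma> \<alpha> t1 t2 \<longleftrightarrow>
     0 < t1 \<and> t1 < t2 \<and> t2 < 2 * P \<and> t1 + t2 = 2 * P \<and>
     (\<forall>s\<in>{t1, t2}. \<alpha> \<bullet> right_normal \<gamma> s = 0) \<and>
     (\<forall>s\<in>{t1<..<t2}. \<alpha> \<bullet> right_normal \<gamma> s < 0) \<and>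
     (\<forall>s\<in>{0..<t1} \<union> {t2<..2 * P}. \<alpha> \<bullet> right_normal \<gamma> s > 0)"

definition plane_wave :: "real^2 \<Rightarrow> real \<Rightarrow> real^2 \<Rightarrow> complex" where
  "plane_wave \<alpha> k x = exp (\<i> * of_real (k * (\<alpha> \<bullet> x)))"

definition laplacian :: "('a::euclidean_space \<Rightarrow> 'b::real_normed_vector) \<Rightarrow> 'a \<Rightarrow> 'b" where
  "laplacian f x = (\<Sum>e\<in>Basis. dir_deriv e (dir_deriv e f) x)"

text \<open>
  Classical solutions of the exterior Neumann problem: twice continuously differentiable
  in the exterior and once continuously differentiable up to the boundary.  The map \<open>Du\<close>
  is the continuous extension of the derivative to the closed exterior.
\<close>

definition scattered_field ::
    "(real^2) set \<Rightarrow> (real \<Rightarrow> real^2) \<Rightarrow> real^2 \<Rightarrow> real \<Rightarrow> (real^2 \<Rightarrow> complex) \<Rightarrow> bool" where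
  "scattered_field K \<gamma> \<alpha> k u \<longleftrightarrow>
     C_on 2 (- K) u \<and> continuous_on (closure (- K)) u \<and>
     (\<forall>x\<in>- K. laplacian u x + of_real (k\<^sup>2) * u x = 0) \<and>
     (\<exists>Du :: real^2 \<Rightarrow> ((real^2) \<Rightarrow>\<^sub>L complex).
        continuous_on (closure (- K)) Du \<and>
        (\<forall>x\<in>- K. (u has_derivative blinfun_apply (Du x)) (at x)) \<and>
        (\<forall>s. blinfun_apply (Du (\<gamma> s)) (right_normal \<gamma> s) =
               - dir_deriv (right_normal \<gamma> s) (plane_wave \<alpha> k) (\<gamma> s))) \<and>
     ((\<lambda>x. sqrt (norm x) *\<^sub>R (dir_deriv (x /\<^sub>R norm x) u x - \<i> * of_real k * u x))
        \<longlongrightarrow> 0) at_infinity"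

definition total_field ::
    "(real \<Rightarrow> real^2) \<Rightarrow> real^2 \<Rightarrow> (real \<Rightarrow> real^2 \<Rightarrow> complex) \<Rightarrow> real \<Rightarrow> real \<Rightarrow> complex" where
  "total_field \<gamma> \<alpha> u k s = u k (\<gamma> s) + plane_wave \<alpha> k (\<gamma> s)"

definition slow_field ::
    "(real \<Rightarrow> real^2) \<Rightarrow> real^2 \<Rightarrow> (real \<Rightarrow> real^2 \<Rightarrow> complex) \<Rightarrow> real \<times> real \<Rightarrow> complex" where
  "slow_field \<gamma> \<alpha> u = (\<lambda>(s, k). exp (- \<i> * of_real (k * (\<alpha> \<bullet> \<gamma> s))) * total_field \<gamma> \<alpha> u k s)"


section \<open>Symbols and the asymptotic expansion\<close>

text \<open>
  Functions on the boundary curve are identified with \<open>2P\<close>-periodic functions of arc length,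
  so a symbol on the curve is a periodic smooth function on \<open>UNIV \<times> {0<..}\<close>; the estimates
  are needed over one period only.
\<close>

definition hoermander_class :: "real \<Rightarrow> real \<Rightarrow> real \<Rightarrow> real \<Rightarrow> (real \<times> real \<Rightarrow> complex) set" where
  "hoermander_class P \<mu> \<rho> \<delta> =
     {a. C_infinity_on (UNIV \<times> {0<..}) a \<and>
         (\<forall>s. \<forall>k>0. a (s + 2 * P, k) = a (s, k)) \<and>
         (\<forall>n m. \<forall>\<kappa>>0. \<exists>C. \<forall>s\<in>{0..2 * P}. \<forall>k\<ge>\<kappa>.
            norm ((dir_deriv (1, 0) ^^ n) ((dir_deriv (0, 1) ^^ m) a) (s, k))
              \<le> C * k powr (\<mu> + \<delta> * real n - \<rho> * real m))}"

text \<open>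
  \<open>\<Psi> \<tau> \<sim> \<Sum>j. c j * \<tau> powi (e j)\<close> as \<open>\<tau> \<rightarrow> \<infinity>\<close> in the sense of symbols:
  the expansion may be differentiated term by term.
\<close>

definition symbol_expansion_at_top ::
    "(real \<Rightarrow> complex) \<Rightarrow> (nat \<Rightarrow> complex) \<Rightarrow> (nat \<Rightarrow> int) \<Rightarrow> bool" where
  "symbol_expansion_at_top \<Psi> c e \<longleftrightarrow>
     (\<forall>N n. (\<lambda>\<tau>. norm (nth_vderiv n (\<lambda>t. \<Psi> t - (\<Sum>j<N. c j * of_real (t powi e j))) \<tau>))
              \<in> O[at_top](\<lambda>\<tau>. \<tau> powi (e N - int n)))"

definition rapidly_decreasing_at_bot :: "(real \<Rightarrow> complex) \<Rightarrow> bool" where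
  "rapidly_decreasing_at_bot \<Psi> \<longleftrightarrow>
     (\<forall>N n. ((\<lambda>\<tau>. \<tau> ^ N *\<^sub>R nth_vderiv n \<Psi> \<tau>) \<longlongrightarrow> 0) at_bot)"

text \<open>Indices \<open>(p, q, r, l)\<close> with \<open>l\<close> a negative integer.\<close>

type_synonym index = "nat \<times> nat \<times> nat \<times> int"

definition indices :: "index set" where
  "indices = {(p, q, r, l). l \<le> -1}"

definition base_exponent :: "index \<Rightarrow> real" where
  "base_exponent = (\<lambda>(p, q, r, l).
     - (1 + 2 * real p + 3 * real q + real r + of_int l) / 3 + min (of_int l + 1) 0)"

definition expansion_term ::
    "(index \<Rightarrow> real \<Rightarrow> complex) \<Rightarrow> (real \<Rightarrow> real) \<Rightarrow> (nat \<Rightarrow> int \<Rightarrow> real \<Rightarrow> complex)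
      \<Rightarrow> index \<Rightarrow> real \<times> real \<Rightarrow> complex" where
  "expansion_term b Z \<Psi> = (\<lambda>(p, q, r, l) (s, k).
     of_real (k powr base_exponent (p, q, r, l)) * b (p, q, r, l) s
       * nth_vderiv p (\<Psi> r l) (k powr (1/3) * Z s))"

definition asymptotic_expansion ::
    "real \<Rightarrow> real \<Rightarrow> real \<Rightarrow> (real \<times> real \<Rightarrow> complex) \<Rightarrow> (index \<Rightarrow> real \<Rightarrow> complex)
      \<Rightarrow> (real \<Rightarrow> real) \<Rightarrow> (nat \<Rightarrow> int \<Rightarrow> real \<Rightarrow> complex) \<Rightarrow> (nat \<Rightarrow> int \<Rightarrow> nat \<Rightarrow> complex) \<Rightarrow> bool" where
  "asymptotic_expansion P t1 t2 a b Z \<Psi> c \<longleftrightarrow>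
     (\<forall>i\<in>indices. periodic_smooth (2 * P) (b i)) \<and>
     periodic_smooth (2 * P) Z \<and>
     (\<forall>s\<in>{t1<..<t2}. Z s > 0) \<and>
     (\<forall>s\<in>{0..<t1} \<union> {t2<..2 * P}. Z s < 0) \<and>
     (\<forall>s\<in>{t1, t2}. Z s = 0 \<and> vector_derivative Z (at s) \<noteq> 0) \<and>
     (\<forall>r. \<forall>l\<le>-1. C_infinity_on UNIV (\<Psi> r l) \<and>
        symbol_expansion_at_top (\<Psi> r l) (c r l) (\<lambda>j. 1 + l - 2 * int r - 3 * int j) \<and>
        rapidly_decreasing_at_bot (\<Psi> r l)) \<and>
     a \<in> hoermander_class P 0 (2/3) (1/3) \<and>
     (\<forall>M>0. \<exists>F\<^sub>M. finite F\<^sub>M \<and> F\<^sub>M \<subseteq> indices \<and>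
        (\<forall>F. finite F \<and> F\<^sub>M \<subseteq> F \<and> F \<subseteq> indices \<longrightarrow>
           (\<lambda>x. a x - (\<Sum>i\<in>F. expansion_term b Z \<Psi> i x)) \<in> hoermander_class P (- M) (2/3) (1/3)))"

definition \<theta> :: "index \<Rightarrow> real" where
  "\<theta> = (\<lambda>(p, q, r, l).
     let e = 1 + l - 2 * int r - int p
     in base_exponent (p, q, r, l) + (if e < 0 then 0 else of_int e / 3))"

definition leading_indices :: "nat \<Rightarrow> index set" where
  "leading_indices \<beta> = {i \<in> indices. \<theta> i > - real \<beta> / 3}"

lemma finite_leading_indices: "finite (leading_indices \<beta>)"
proof (rule finite_subset)
  show "leading_indices \<beta> \<subseteq> {..\<beta>} \<times> {..\<beta>} \<times> {..\<beta>} \<times> {- int \<beta> - 1..-1}"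
  proof (clarify, goal_cases)
    case (1 p q r l)
    then have l: "l \<le> -1" and "\<theta> (p, q, r, l) > - real \<beta> / 3"
      by (auto simp: leading_indices_def indices_def)
    moreover from l have "real_of_int l \<le> -1"
      by simp
    ultimately have less:
      "real_of_int (2 * int p + 3 * int q + int r) < real_of_int (int \<beta> + 2 + 2 * l)"
      by (simp add: \<theta>_def base_exponent_def Let_def field_simps split: if_splits)
    from less have "2 * int p + 3 * int q + int r < int \<beta> + 2 + 2 * l"
      by (simp only: of_int_less_iff)
    with l show ?case by auto
  qed
qed auto

definition asymptotic_part ::
    "(real \<Rightarrow> real^2) \<Rightarrow> real^2 \<Rightarrow> (index \<Rightarrow> real \<Rightarrow> complex) \<Rightarrow> (real \<Rightarrow> real)
      \<Rightarrow> (nat \<Rightarrow> int \<Rightarrow> real \<Rightarrow> complex) \<Rightarrow> nat \<Rightarrow> real \<Rightarrow> real \<Rightarrow> complex" where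
  "asymptotic_part \<gamma> \<alpha> b Z \<Psi> \<beta> k s =
     plane_wave \<alpha> k (\<gamma> s) * (\<Sum>i\<in>leading_indices \<beta>. expansion_term b Z \<Psi> i (s, k))"


section \<open>The space \<open>L\<^sup>2\<close> of the boundary and the Galerkin method\<close>

text \<open>
  Elements of \<open>L\<^sup>2\<close> are represented by functions on \<open>[0, 2P]\<close>; operators act on
  representatives and their properties are only required almost everywhere.
\<close>

definition L2 :: "real \<Rightarrow> (real \<Rightarrow> complex) set" where
  "L2 P = {\<phi> \<in> borel_measurable (lebesgue_on {0..2 * P}).
             integrable (lebesgue_on {0..2 * P}) (\<lambda>s. (norm (\<phi> s))\<^sup>2)}"

definition L2_inner :: "real \<Rightarrow> (real \<Rightarrow> complex) \<Rightarrow> (real \<Rightarrow> complex) \<Rightarrow> complex" where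
  "L2_inner P \<mu> \<phi> = (\<integral>s. \<mu> s * cnj (\<phi> s) \<partial>lebesgue_on {0..2 * P})"

definition L2_norm :: "real \<Rightarrow> (real \<Rightarrow> complex) \<Rightarrow> real" where
  "L2_norm P \<phi> = sqrt (\<integral>s. (norm (\<phi> s))\<^sup>2 \<partial>lebesgue_on {0..2 * P})"

definition coercive_operator ::
    "real \<Rightarrow> ((real \<Rightarrow> complex) \<Rightarrow> real \<Rightarrow> complex) \<Rightarrow> real \<Rightarrow> real \<Rightarrow> bool" where
  "coercive_operator P A C c \<longleftrightarrow>
     C > 0 \<and> c > 0 \<and>
     (\<forall>\<phi>\<in>L2 P. A \<phi> \<in> L2 P) \<and>
     (\<forall>\<phi>\<in>L2 P. \<forall>\<psi>\<in>L2 P. \<forall>x y. AE s in lebesgue_on {0..2 * P}.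
        A (\<lambda>t. x * \<phi> t + y * \<psi> t) s = x * A \<phi> s + y * A \<psi> s) \<and>
     (\<forall>\<mu>\<in>L2 P. \<forall>\<phi>\<in>L2 P. norm (L2_inner P \<mu> (A \<phi>)) \<le> C * L2_norm P \<mu> * L2_norm P \<phi>) \<and>
     (\<forall>\<mu>\<in>L2 P. norm (L2_inner P \<mu> (A \<mu>)) \<ge> c * (L2_norm P \<mu>)\<^sup>2)"

text \<open>
  Region number \<open>i \<in> {1..4m}\<close>, as an interval in the parameter line.  It may leave \<open>[0, 2P]\<close>
  and is understood modulo \<open>2P\<close> (see \<open>periodize\<close>).
\<close>

definition region ::
    "real \<Rightarrow> real \<Rightarrow> real \<Rightarrow> real \<Rightarrow> real \<Rightarrow> real \<Rightarrow> real \<Rightarrow> nat \<Rightarrow> (nat \<Rightarrow> real) \<Rightarrow> real \<Rightarrow> nat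
      \<Rightarrow> real set" where
  "region P t1 t2 \<xi>1 \<xi>2 \<zeta>1 \<zeta>2 m \<epsilon> k i =
     (let h = (\<lambda>j. k powr (- 1/3 + \<epsilon> j)) in
      if i = m then {t1 + \<xi>1 * h 1 .. t2 - \<xi>2 * h 1}
      else if i = 2 * m then {t2 + \<zeta>2 * h 1 .. 2 * P + t1 - \<zeta>1 * h 1}
      else if i = 3 * m then {t1 - \<zeta>1 * h m .. t1 + \<xi>1 * h m}
      else if i = 4 * m then {t2 - \<xi>2 * h m .. t2 + \<zeta>2 * h m}
      else if i < m then {t1 + \<xi>1 * h (i + 1) .. t1 + \<xi>1 * h i}
      else if i < 2 * m then let j = i - m in {t2 - \<xi>2 * h j .. t2 - \<xi>2 * h (j + 1)}
      else if i < 3 * m then let j = i - 2 * m in {t1 - \<zeta>1 * h j .. t1 - \<zeta>1 * h (j + 1)}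
      else let j = i - 3 * m in {t2 + \<zeta>2 * h (j + 1) .. t2 + \<zeta>2 * h j})"

text \<open>The \<open>T\<close>-periodic extension of \<open>g\<close> restricted to \<open>S\<close>, for \<open>S\<close> an interval shorter than \<open>T\<close>.\<close>

definition periodize :: "real \<Rightarrow> real set \<Rightarrow> (real \<Rightarrow> complex) \<Rightarrow> real \<Rightarrow> complex" where
  "periodize T S g s = (\<Sum>l\<in>{l::int. s + of_int l * T \<in> S}. g (s + of_int l * T))"

definition galerkin_space ::
    "real \<Rightarrow> (real \<Rightarrow> real^2) \<Rightarrow> real^2 \<Rightarrow> real \<Rightarrow> nat \<Rightarrow> (nat \<Rightarrow> real set) \<Rightarrow> (nat \<Rightarrow> nat)
      \<Rightarrow> (real \<Rightarrow> complex) set" where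
  "galerkin_space P \<gamma> \<alpha> k N S d =
     {\<lambda>s. plane_wave \<alpha> k (\<gamma> s) *
            (\<Sum>j=1..N. periodize (2 * P) (S j) (\<lambda>t. poly (p j) (of_real t)) s)
      | p :: nat \<Rightarrow> complex poly. \<forall>j\<in>{1..N}. degree (p j) \<le> d j}"

definition galerkin_solution ::
    "real \<Rightarrow> (real \<Rightarrow> complex) set \<Rightarrow> ((real \<Rightarrow> complex) \<Rightarrow> real \<Rightarrow> complex) \<Rightarrow> (real \<Rightarrow> complex)
      \<Rightarrow> (real \<Rightarrow> complex) \<Rightarrow> bool" where
  "galerkin_solution P V A g w \<longleftrightarrow>
     w \<in> V \<and> (\<forall>v\<in>V. L2_inner P v (A w) = L2_inner P v g)"

text \<open>
  The members of \<open>\<sigma>\<^sub>\<beta> + \<G>\<close> whose second summand is a Galerkin solution of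
  \<open>A \<rho> = f - A \<sigma>\<^sub>\<beta>\<close>.  By coercivity that summand is unique almost everywhere.
\<close>

definition galerkin_approximation ::
    "real \<Rightarrow> (real \<Rightarrow> complex) set \<Rightarrow> ((real \<Rightarrow> complex) \<Rightarrow> real \<Rightarrow> complex) \<Rightarrow> (real \<Rightarrow> complex)
      \<Rightarrow> (real \<Rightarrow> complex) \<Rightarrow> (real \<Rightarrow> complex) \<Rightarrow> bool" where
  "galerkin_approximation P V A f \<sigma> \<eta>' \<longleftrightarrow>
     (\<exists>\<rho>. galerkin_solution P V A (\<lambda>s. f s - A \<sigma> s) \<rho> \<and> \<eta>' = (\<lambda>s. \<sigma> s + \<rho> s))"

end

theory Submission
  imports Defs
begin

text \<open>
By the lemma of Cea, the Galerkin error is at most \<open>C\<^sub>k / c\<^sub>k\<close> times the distance in \<open>L\<^sup>2\<close>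
  from \<open>\<rho> = \<eta> - \<sigma>\<close> to the Galerkin space.  Both \<open>\<rho>\<close> and the members of that space carry the
  plane wave as a unimodular factor, so the question becomes how well the slow remainder, which
  is \<open>\<rho>\<close> without that factor, is approximated by polynomials of degree at most \<open>d\<close> on each
  region.  Three facts decide this.

  \<^item> Size of the derivatives (\<open>weighted_symbol_remainder\<close>).  Since \<open>l \<le> -1\<close>, the exponent
    \<open>1 + l - 2 * r - p\<close> is never positive, so the power of \<open>k\<close> in a term that is left out of \<open>\<sigma>\<close>
    is at most \<open>- \<beta> / 3\<close>.  The \<open>j\<close>-th derivative of a profile is \<open>O(1 / (1 + \<bar>\<tau>\<bar>) ^ j)\<close>; hence
    each derivative in \<open>s\<close> of \<open>\<Psi> (k powr (1/3) * Z s)\<close> costs a factor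
    \<open>W = k powr (1/3) / (1 + k powr (1/3) * \<bar>Z s\<bar>)\<close>, and the \<open>n\<close>-th derivative of the
    remainder is at most a constant times \<open>k powr (- \<beta> / 3) * W ^ n\<close>.  As \<open>Z\<close> has simple zeros
    at \<open>t1\<close> and \<open>t2\<close> and no others in a period, \<open>W\<close> is bounded by \<open>k powr (1/3)\<close> and by a multiple
    of the inverse distance to the shadow boundary.

  \<^item> Weighted approximation (\<open>weighted_approx\<close>).  On \<open>[a, b]\<close> the squared error in \<open>L\<^sup>2\<close> is at
    most a constant times \<open>1 / d ^ (2 * n)\<close> times the integral of
    \<open>\<bar>f\<^sub>n\<bar>\<^sup>2 * ((s - a) * (b - s)) ^ n\<close>, where \<open>f\<^sub>n\<close> is the \<open>n\<close>-th derivative.  The weight is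
    essential: if a shadow boundary point \<open>T\<close> lies outside \<open>[a, b]\<close> at distances between \<open>\<delta>\<close>
    and \<open>q * \<delta>\<close>, it cancels half of the singularity \<open>1 / \<bar>s - T\<bar> ^ (2 * n)\<close>, and what remains
    is bounded, of order \<open>ln q\<close>, or of order \<open>q ^ (n - 1)\<close>, for \<open>n = 0\<close>, \<open>n = 1\<close> and \<open>n \<ge> 2\<close>
    respectively.  Without the weight one would find \<open>q ^ (2 * n - 1)\<close> for \<open>n \<ge> 1\<close>.

  \<^item> Geometry of the regions (\<open>piece_position\<close>).  The chosen \<open>\<epsilon> j\<close> make the widths
    \<open>k powr (- 1/3 + \<epsilon> j)\<close> equal to \<open>1 / \<kappa> ^ j\<close> with \<open>\<kappa> = k powr (2 / (6 * m + 3))\<close>, so the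
    ratio of the distances is at most a constant times \<open>\<kappa>\<close> on every region away from the shadow
    boundary.  On the two regions around \<open>t1\<close> and \<open>t2\<close>, of length \<open>O(1 / \<kappa> ^ m)\<close>, the bound
    \<open>W \<le> k powr (1/3)\<close>, with \<open>k powr (2/3) = \<kappa> ^ (2 * m + 1)\<close>, gives \<open>\<kappa> ^ n / \<kappa> ^ m\<close>, which
    is no larger.

  Square roots turn \<open>ln \<kappa>\<close> and \<open>\<kappa> ^ (n - 1)\<close> into the two terms of the theorem.
\<close>

section \<open>Weighted polynomial approximation on an interval\<close>

text \<open>
  A degree bound that makes sense for \<open>D = 0\<close>, where only the zero polynomial is left; the
  orthogonality relations below lower \<open>D\<close> by one with each derivative and end there.
\<close>

definition poly_below :: "nat \<Rightarrow> real poly set" where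
  "poly_below D = {q. \<forall>i\<ge>D. coeff q i = 0}"

lemma poly_below_simps [simp]: "0 \<in> poly_below D"
  "p \<in> poly_below D \<Longrightarrow> q \<in> poly_below D \<Longrightarrow> p + q \<in> poly_below D"
  "p \<in> poly_below D \<Longrightarrow> q \<in> poly_below D \<Longrightarrow> p - q \<in> poly_below D"
  "p \<in> poly_below D \<Longrightarrow> smult c p \<in> poly_below D"
  by (auto simp: poly_below_def)

lemma poly_below_0: "p \<in> poly_below 0 \<longleftrightarrow> p = 0"
  by (auto simp: poly_below_def poly_eq_iff)

lemma poly_below_mono: "p \<in> poly_below D \<Longrightarrow> D \<le> E \<Longrightarrow> p \<in> poly_below E"
  by (auto simp: poly_below_def)

lemma poly_below_Suc_degree: "p \<in> poly_below (Suc (degree p))"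
  by (auto simp: poly_below_def coeff_eq_0)

lemma degree_poly_below: "p \<in> poly_below (Suc d) \<Longrightarrow> degree p \<le> d"
  by (auto simp: poly_below_def intro: degree_le)

lemma poly_below_pderiv: "p \<in> poly_below D \<Longrightarrow> pderiv p \<in> poly_below (D - 1)"
  by (auto simp: poly_below_def coeff_pderiv)

lemma poly_below_Suc_decomp:
  assumes "q \<in> poly_below (Suc D)" "\<phi> \<in> poly_below (Suc D)" "coeff \<phi> D = 1"
  shows "q - smult (coeff q D) \<phi> \<in> poly_below D"
  unfolding poly_below_def
proof (clarify)
  fix i assume "D \<le> i"
  then show "coeff (q - smult (coeff q D) \<phi>) i = 0"
    using assms by (cases "i = D") (auto simp: poly_below_def)
qed

lemma pderiv_surjective_below:
  assumes q: "q \<in> poly_below D"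
  shows "\<exists>Q\<in>poly_below (Suc D). pderiv Q = q"
proof -
  define Q where "Q = (\<Sum>j<D. monom (coeff q j / real (Suc j)) (Suc j))"
  have c: "coeff Q (Suc n) = (if n < D then coeff q n / real (Suc n) else 0)" for n
    by (simp add: Q_def coeff_sum)
  have "pderiv Q = q"
    using q by (auto simp: poly_eq_iff coeff_pderiv c poly_below_def)
  moreover have "Q \<in> poly_below (Suc D)"
    unfolding poly_below_def
  proof clarify
    fix n assume "Suc D \<le> n"
    then show "coeff Q n = 0" using c[of "n - 1"] by (cases n) auto
  qed
  ultimately show ?thesis by blast
qed

definition edge_weight :: "real \<Rightarrow> real \<Rightarrow> real poly" where
  "edge_weight a b = [:-(a * b), a + b, -1:]"

lemma poly_edge_weight: "poly (edge_weight a b) x = (x - a) * (b - x)"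
  by (simp add: edge_weight_def algebra_simps)

text \<open>
  The powers of the edge weight are the Gegenbauer weights of the interval \<open>[a, b]\<close>.
\<close>

definition poly_ip :: "real \<Rightarrow> real \<Rightarrow> nat \<Rightarrow> real poly \<Rightarrow> real poly \<Rightarrow> real" where
  "poly_ip a b i p q = integral {a..b} (\<lambda>x. poly p x * poly q x * ((x - a) * (b - x)) ^ i)"

text \<open>
  This is \<open>- (w ^ (i + 1) * q')' / w ^ i\<close> for the edge weight \<open>w\<close>, written without the
  quotient: the operator whose eigenfunctions are the Gegenbauer polynomials.
\<close>

definition sturm_liouville :: "real \<Rightarrow> real \<Rightarrow> nat \<Rightarrow> real poly \<Rightarrow> real poly" where
  "sturm_liouville a b i q =
     - (edge_weight a b * pderiv (pderiv q)
        + smult (real (Suc i)) (pderiv (edge_weight a b) * pderiv q))"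

text \<open>
  The operator is upper triangular in the monomials, and its diagonal entries
  \<open>n * (n + 2 * i + 1)\<close> are the eigenvalues.
\<close>

lemma coeff_sturm_liouville:
  "coeff (sturm_liouville a b i q) n =
     real n * (real n + 2 * real i + 1) * coeff q n
     - (a + b) * real (n + 1) * real (n + i + 1) * coeff q (n + 1)
     + a * b * real (n + 2) * real (n + 1) * coeff q (n + 2)"
proof -
  consider "n = 0" | "n = 1" | j where "n = Suc (Suc j)"
    by (metis One_nat_def not0_implies_Suc)
  then show ?thesis
    by cases (simp_all add: sturm_liouville_def edge_weight_def pderiv_pCons coeff_pderiv algebra_simps
                   coeff_pCons numeral_2_eq_2)
qed

lemma sturm_liouville_below: "q \<in> poly_below D \<Longrightarrow> sturm_liouville a b i q \<in> poly_below D"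
  by (simp add: poly_below_def coeff_sturm_liouville)

lemma poly_ip_integrable:
  "(\<lambda>x. poly p x * poly q x * ((x - a) * (b - x)) ^ i) integrable_on {a..b::real}"
  by (intro integrable_continuous_interval continuous_intros)

context
  fixes a b :: real
  assumes ab: "a < b"
begin

abbreviation "ip \<equiv> poly_ip a b"

lemma ip_add_left: "ip i (p + p') q = ip i p q + ip i p' q"
  unfolding poly_ip_def
  by (subst integral_add[symmetric]) (auto simp: poly_ip_integrable distrib_right)

lemma ip_smult_left: "ip i (smult c p) q = c * ip i p q"
  unfolding poly_ip_def
  by (subst integral_mult_right[symmetric]) (simp add: mult.assoc)

lemma ip_commute: "ip i p q = ip i q p"
  by (simp add: poly_ip_def mult.commute)

lemma ip_add_right: "ip i q (p + p') = ip i q p + ip i q p'"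
  by (metis ip_add_left ip_commute)

lemma ip_smult_right: "ip i q (smult c p) = c * ip i q p"
  by (metis ip_smult_left ip_commute)

lemma ip_diff_left: "ip i (p - p') q = ip i p q - ip i p' q"
  using ip_add_left[of i "p - p'" p' q] by simp

lemma ip_diff_right: "ip i q (p - p') = ip i q p - ip i q p'"
  using ip_add_right[of i q "p - p'" p'] by simp

lemma ip_0 [simp]: "ip i 0 q = 0" "ip i q 0 = 0"
  by (simp_all add: poly_ip_def)

lemma ip_nonneg: "0 \<le> ip i p p"
  unfolding poly_ip_def
  by (intro integral_nonneg poly_ip_integrable) auto

lemma ip_eq_0: assumes "ip i p p = 0" shows "p = 0"
proof -
  let ?f = "\<lambda>x. poly p x * poly p x * ((x - a) * (b - x)) ^ i"
  have "continuous_on {a..b} ?f" by (intro continuous_intros)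
  moreover have "?f x \<ge> 0" if "x \<in> {a..b}" for x using that by auto
  ultimately have z: "\<forall>x\<in>{a..b}. ?f x = 0"
    using assms ab integral_eq_0_iff[of a b ?f] by (simp add: poly_ip_def)
  let ?f = "poly (p * p * edge_weight a b ^ i)"
  have "\<forall>x\<in>{a..b}. ?f x = 0" using z by (simp add: poly_edge_weight)
  then have "{a..b} \<subseteq> {x. ?f x = 0}" by blast
  then have "infinite {x. ?f x = 0}"
    using ab by (meson infinite_Icc infinite_super)
  then have "p * p * edge_weight a b ^ i = 0"
    using poly_roots_finite by blast
  then show ?thesis by (auto simp: edge_weight_def)
qed

text \<open>
  Integration by parts: the boundary terms vanish because the derivatives are weighted with
  one more power of the edge weight.
\<close>

lemma ip_pderiv: "ip (Suc i) (pderiv p) (pderiv q) = ip i p (sturm_liouville a b i q)"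
proof -
  let ?w = "edge_weight a b"
  define r where "r = p * pderiv q * ?w ^ Suc i"
  have r: "pderiv r = pderiv p * pderiv q * ?w ^ Suc i - p * sturm_liouville a b i q * ?w ^ i"
    unfolding r_def sturm_liouville_def
    by (simp add: pderiv_mult pderiv_power_Suc algebra_simps smult_add_left smult_add_right del: power_Suc)
       (simp add: algebra_simps)
  have "(poly (pderiv r) has_integral (poly r b - poly r a)) {a..b}"
    using ab by (intro fundamental_theorem_of_calculus)
      (auto intro!: DERIV_subset[OF poly_DERIV] simp flip: has_real_derivative_iff_has_vector_derivative)
  moreover have "poly r b = 0" "poly r a = 0"
    by (simp_all add: r_def poly_edge_weight)
  ultimately have "integral {a..b} (poly (pderiv r)) = 0"
    by (simp add: integral_unique)
  moreover have "integral {a..b} (poly (pderiv r)) =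
      ip (Suc i) (pderiv p) (pderiv q) - ip i p (sturm_liouville a b i q)"
    unfolding r poly_ip_def
    by (subst integral_diff[symmetric]) (auto simp: poly_edge_weight algebra_simps intro!: integral_cong integrable_continuous_interval continuous_intros)
  ultimately show ?thesis by simp
qed

definition orth :: "nat \<Rightarrow> nat \<Rightarrow> real poly \<Rightarrow> bool" where
  "orth i D g \<longleftrightarrow> (\<forall>q\<in>poly_below D. ip i g q = 0)"

text \<open>
  Gram-Schmidt: the residual \<open>\<phi>\<close> of the monomial of degree \<open>D\<close> is orthogonal to the smaller
  space and spans the larger one together with it.
\<close>

lemma projection_exists: "\<exists>p\<in>poly_below D. orth i D (h - p)"
proof (induction D arbitrary: h)
  case 0
  show ?case by (auto simp: orth_def poly_below_0)
next
  case (Suc D)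
  obtain r where r: "r \<in> poly_below D" "orth i D (monom 1 D - r)" using Suc by blast
  define \<phi> where "\<phi> = monom 1 D - r"
  have \<phi>: "\<phi> \<in> poly_below (Suc D)" "coeff \<phi> D = 1" "orth i D \<phi>"
    using r by (auto simp: \<phi>_def poly_below_def)
  then have "ip i \<phi> \<phi> \<noteq> 0" using ip_eq_0[of i \<phi>] by auto
  obtain p0 where p0: "p0 \<in> poly_below D" "orth i D (h - p0)" using Suc by blast
  define c where "c = ip i (h - p0) \<phi> / ip i \<phi> \<phi>"
  have "ip i (h - (p0 + smult c \<phi>)) q = 0" if q: "q \<in> poly_below (Suc D)" for q
  proof -
    define q' where "q' = q - smult (coeff q D) \<phi>"
    have q': "q' \<in> poly_below D" "q = smult (coeff q D) \<phi> + q'"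
      using poly_below_Suc_decomp[OF q \<phi>(1,2)] by (auto simp: q'_def)
    have 1: "ip i (h - p0) q' = 0" "ip i \<phi> q' = 0"
      using q'(1) p0(2) \<phi>(3) by (auto simp: orth_def)
    have "ip i (h - (p0 + smult c \<phi>)) \<phi> = 0"
      using \<open>ip i \<phi> \<phi> \<noteq> 0\<close>
      by (simp add: c_def ip_diff_left ip_smult_left ip_add_left diff_diff_eq[symmetric] del: diff_diff_eq)
    moreover have "ip i (h - (p0 + smult c \<phi>)) q' = 0"
      using 1 by (simp add: ip_diff_left ip_smult_left ip_add_left)
    ultimately show ?thesis
      by (subst q'(2)) (simp add: ip_add_right ip_smult_right)
  qed
  moreover have "p0 + smult c \<phi> \<in> poly_below (Suc D)"
    using p0(1) \<phi>(1) poly_below_mono[of p0 D "Suc D"] by auto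
  ultimately show ?case by (auto simp: orth_def)
qed

text \<open>
  The smallest eigenvalue on the orthogonal complement of the polynomials of degree below
  \<open>D\<close> is \<open>D * (D + 2 * i + 1)\<close>. The induction splits off one orthogonal polynomial \<open>\<phi>\<close> of
  degree \<open>N\<close> at a time; its derivative is orthogonal to the derivatives of lower degree as
  well, because the operator maps each space \<open>poly_below N\<close> to itself.
\<close>

lemma poincare_poly:
  assumes "h \<in> poly_below N" "orth i D h"
  shows "real D * (real D + 2 * real i + 1) * ip i h h \<le> ip (Suc i) (pderiv h) (pderiv h)"
  using assms
proof (induction N arbitrary: h)
  case 0
  then show ?case by (simp add: poly_below_0)
next
  case (Suc N)
  show ?case
  proof (cases "N < D")
    case True
    then have "h \<in> poly_below D" using Suc.prems(1) poly_below_mono by simp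
    then have "ip i h h = 0" using Suc.prems(2) by (simp add: orth_def)
    then show ?thesis using ip_nonneg by simp
  next
    case False
    obtain r where r: "r \<in> poly_below N" "orth i N (monom 1 N - r)"
      using projection_exists by blast
    define \<phi> where "\<phi> = monom 1 N - r"
    have \<phi>: "\<phi> \<in> poly_below (Suc N)" "coeff \<phi> N = 1" "orth i N \<phi>"
      using r by (auto simp: \<phi>_def poly_below_def)
    define c where "c = coeff h N"
    define h1 where "h1 = h - smult c \<phi>"
    have h1: "h1 \<in> poly_below N" "h = smult c \<phi> + h1"
      using poly_below_Suc_decomp[OF Suc.prems(1) \<phi>(1,2)] by (auto simp: h1_def c_def)
    have "orth i D \<phi>"
      using \<phi>(3) False poly_below_mono[of _ D N] by (auto simp: orth_def)
    then have "orth i D h1"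
      using Suc.prems(2) by (auto simp: orth_def h1_def ip_diff_left ip_smult_left)
    note IH = Suc.IH[OF h1(1) this]
    let ?ev = "\<lambda>N. real N * (real N + 2 * real i + 1)"
    have SL: "ip i \<phi> (sturm_liouville a b i h1) = 0"
      using \<phi>(3) h1(1) sturm_liouville_below by (auto simp: orth_def)
    have "sturm_liouville a b i \<phi> - smult (?ev N) \<phi> \<in> poly_below N"
      using poly_below_Suc_decomp[OF sturm_liouville_below[OF \<phi>(1)] \<phi>(1,2)]
        \<phi>(1,2) by (simp add: coeff_sturm_liouville poly_below_def)
    then have "ip i \<phi> (sturm_liouville a b i \<phi> - smult (?ev N) \<phi>) = 0"
      using \<phi>(3) by (auto simp: orth_def)
    then have SL2: "ip i \<phi> (sturm_liouville a b i \<phi>) = ?ev N * ip i \<phi> \<phi>"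
      by (simp add: ip_diff_right ip_smult_right)
    have phh: "ip i \<phi> h1 = 0" "ip i h1 \<phi> = 0"
      using \<phi>(3) h1(1) ip_commute by (auto simp: orth_def)
    have 1: "ip (Suc i) (pderiv h) (pderiv h) =
        c\<^sup>2 * (?ev N * ip i \<phi> \<phi>) + ip (Suc i) (pderiv h1) (pderiv h1)"
      using SL SL2 ip_commute[of "Suc i" "pderiv h1" "pderiv \<phi>"]
      by (subst (1 2) h1(2))
        (simp add: pderiv_add pderiv_smult ip_add_left ip_add_right ip_smult_left ip_smult_right
          ip_pderiv[of i \<phi>] power2_eq_square)
    have 2: "ip i h h = c\<^sup>2 * ip i \<phi> \<phi> + ip i h1 h1"
      using phh by (subst (1 2) h1(2))
        (simp add: ip_add_left ip_add_right ip_smult_left ip_smult_right power2_eq_square)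
    have "?ev D * (c\<^sup>2 * ip i \<phi> \<phi>) \<le> ?ev N * (c\<^sup>2 * ip i \<phi> \<phi>)"
      using False ip_nonneg by (intro mult_right_mono mult_mono) auto
    with IH show ?thesis unfolding 1 2 by (simp add: algebra_simps)
  qed
qed

text \<open>
  The test polynomial has a primitive of degree one higher, so integration by parts applies.
\<close>

lemma orth_pderiv:
  assumes "orth i D g"
  shows "orth (Suc i) (D - 1) (pderiv g)"
  unfolding orth_def
proof
  fix q assume q: "q \<in> poly_below (D - 1)"
  obtain Q where Q: "pderiv Q = q" "Q \<in> poly_below (Suc (D - 1))"
    using pderiv_surjective_below[OF q] by blast
  show "ip (Suc i) (pderiv g) q = 0"
  proof (cases "D = 0")
    case True
    then have "q = 0" using q by (simp add: poly_below_0)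
    then show ?thesis by simp
  next
    case False
    then have "Q \<in> poly_below D" using Q by simp
    then have "ip i g (sturm_liouville a b i Q) = 0"
      using assms sturm_liouville_below by (auto simp: orth_def)
    then show ?thesis using Q(1) ip_pderiv[of i g Q] by simp
  qed
qed

lemma orth_pderiv_iterate:
  assumes "orth i D g" "n \<le> D"
  shows "orth (i + n) (D - n) ((pderiv ^^ n) g)"
  using assms(2)
proof (induction n)
  case 0
  then show ?case using assms(1) by simp
next
  case (Suc n)
  then show ?case using orth_pderiv[of "i + n" "D - n" "(pderiv ^^ n) g"] by simp
qed

text \<open>
  Each derivative raises the power of the weight and lowers the degree of orthogonality by
  one, so the inequality can be applied \<open>n\<close> times.
\<close>

lemma poincare_iterate:
  assumes "orth 0 D g" "n \<le> D"
  shows "(\<Prod>j<n. real (D - j) * (real D + real j + 1)) * ip 0 g g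
      \<le> ip n ((pderiv ^^ n) g) ((pderiv ^^ n) g)"
  using assms(2)
proof (induction n)
  case 0
  show ?case by simp
next
  case (Suc n)
  let ?g = "(pderiv ^^ n) g"
  have "orth n (D - n) ?g" using orth_pderiv_iterate[OF assms(1), of n] Suc.prems by simp
  from poincare_poly[OF poly_below_Suc_degree this]
  have P: "real (D - n) * (real D + real n + 1) * ip n ?g ?g \<le> ip (Suc n) (pderiv ?g) (pderiv ?g)"
    using Suc.prems by (simp add: of_nat_diff algebra_simps)
  have "(\<Prod>j<Suc n. real (D - j) * (real D + real j + 1)) * ip 0 g g
      = real (D - n) * (real D + real n + 1) * ((\<Prod>j<n. real (D - j) * (real D + real j + 1)) * ip 0 g g)"
    by (simp add: algebra_simps)
  also have "\<dots> \<le> real (D - n) * (real D + real n + 1) * ip n ?g ?g"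
    using Suc by (intro mult_left_mono) auto
  finally show ?case using P by simp
qed

text \<open>
  The error of the best approximation is orthogonal to all polynomials of degree at most
  \<open>d\<close>, and its \<open>n\<close>-th derivative is an orthogonal projection of that of \<open>h\<close>, hence not
  longer.
\<close>

lemma poly_approx:
  assumes d: "1 \<le> d" "n \<le> Suc d"
  shows "\<exists>p. degree p \<le> d \<and> real d ^ (2 * n) * ip 0 (h - p) (h - p)
      \<le> real n ^ n * ip n ((pderiv ^^ n) h) ((pderiv ^^ n) h)"
proof -
  let ?D = "Suc d"
  obtain p where p: "p \<in> poly_below ?D" "orth 0 ?D (h - p)" using projection_exists by blast
  define g where "g = h - p"
  let ?D' = "\<lambda>r. (pderiv ^^ n) r"
  have dadd: "?D' (r + s) = ?D' r + ?D' s" for r s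
    by (induction n) (auto simp: pderiv_add)
  have pb: "?D' p \<in> poly_below (?D - n)"
    using p(1) by (induction n) (auto dest: poly_below_pderiv)
  have og: "orth n (?D - n) (?D' g)"
    using orth_pderiv_iterate[of 0 ?D g n] p(2) d by (simp add: g_def)
  have "?D' h = ?D' g + ?D' p" by (subst dadd[symmetric]) (simp add: g_def)
  then have "ip n (?D' h) (?D' h) = ip n (?D' g) (?D' g) + ip n (?D' p) (?D' p)"
    using og pb ip_commute[of n "?D' p" "?D' g"]
    by (simp add: ip_add_left ip_add_right orth_def)
  then have le: "ip n (?D' g) (?D' g) \<le> ip n (?D' h) (?D' h)" using ip_nonneg[of n "?D' p"] by simp
  \<comment> \<open>Each eigenvalue in the product is at least \<open>d\<^sup>2 / n\<close>; this is where \<open>n \<le> d + 1\<close> enters.\<close>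
  have factor: "(real d)\<^sup>2 \<le> real n * (real (?D - j) * (real ?D + real j + 1))" if "j < n" for j
  proof -
    have "real d \<le> real n * real (?D - j)"
    proof -
      have "0 \<le> (int n - 1) * (int d + 1 - int n)" using d that by (intro mult_nonneg_nonneg) auto
      then have "int d \<le> int n * (int d + 2 - int n)" by (simp add: algebra_simps)
      also have "\<dots> \<le> int n * int (?D - j)" using d that by (intro mult_left_mono) auto
      finally show ?thesis by (metis of_int_le_iff of_int_mult of_int_of_nat_eq)
    qed
    then have "real d * real d \<le> real n * real (?D - j) * (real ?D + real j + 1)"
      by (intro mult_mono) auto
    then show ?thesis by (simp add: power2_eq_square mult.assoc)
  qed
  have "real d ^ (2 * n) = (\<Prod>j<n. (real d)\<^sup>2)" by (simp add: power_mult)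
  also have "\<dots> \<le> (\<Prod>j<n. real n * (real (?D - j) * (real ?D + real j + 1)))"
    using factor by (intro prod_mono) auto
  also have "\<dots> = real n ^ n * (\<Prod>j<n. real (?D - j) * (real ?D + real j + 1))"
    by (simp add: prod.distrib)
  finally have "real d ^ (2 * n) * ip 0 g g
      \<le> real n ^ n * (\<Prod>j<n. real (?D - j) * (real ?D + real j + 1)) * ip 0 g g"
    using ip_nonneg by (intro mult_right_mono)
  also have "\<dots> \<le> real n ^ n * ip n (?D' g) (?D' g)"
    using poincare_iterate[of ?D g n] p(2) d by (simp add: g_def mult.assoc mult_left_mono)
  also have "\<dots> \<le> real n ^ n * ip n (?D' h) (?D' h)" using le by (intro mult_left_mono) auto
  finally show ?thesis using p(1) degree_poly_below by (auto simp: g_def)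
qed

end

text \<open>
  Approximate the highest derivative uniformly and integrate back from \<open>a\<close>.
\<close>

lemma weierstrass_derivatives:
  fixes F :: "nat \<Rightarrow> real \<Rightarrow> real"
  assumes "a < b"
    and "\<And>i x. i < n \<Longrightarrow> x \<in> {a..b} \<Longrightarrow> (F i has_real_derivative F (Suc i) x) (at x within {a..b})"
    and "continuous_on {a..b} (F n)" and "0 < e"
  shows "\<exists>h. \<forall>x\<in>{a..b}. \<bar>F 0 x - poly h x\<bar> \<le> e \<and> \<bar>F n x - poly ((pderiv ^^ n) h) x\<bar> \<le> e"
  using assms(2-4)
proof (induction n arbitrary: F e)
  case 0
  obtain g where g: "real_polynomial_function g" "\<And>x. x \<in> {a..b} \<Longrightarrow> \<bar>F 0 x - g x\<bar> < e"
    using Stone_Weierstrass_real_polynomial_function[OF compact_Icc 0(2,3)] by blast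
  obtain c N where "g = (\<lambda>x. \<Sum>i\<le>N. c i * x ^ i)"
    using g(1) real_polynomial_function_iff_sum by auto
  then have "g = poly (\<Sum>i\<le>N. monom (c i) i)"
    by (simp add: poly_sum poly_monom fun_eq_iff)
  then show ?case using g(2) by (intro exI[of _ "\<Sum>i\<le>N. monom (c i) i"]) (auto intro: less_imp_le)
next
  case (Suc n)
  define e' where "e' = e / (1 + (b - a))"
  have e': "0 < e'" "e' \<le> e" "e' * (b - a) \<le> e"
    using assms(1) Suc.prems(3) by (auto simp: e'_def field_simps)
  have "\<exists>h. \<forall>x\<in>{a..b}. \<bar>F (Suc 0) x - poly h x\<bar> \<le> e' \<and>
      \<bar>F (Suc n) x - poly ((pderiv ^^ n) h) x\<bar> \<le> e'"
    using Suc.prems e' by (intro Suc.IH[of "\<lambda>i. F (Suc i)"]) auto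
  then obtain h1 where h1: "\<And>x. x \<in> {a..b} \<Longrightarrow> \<bar>F (Suc 0) x - poly h1 x\<bar> \<le> e'"
    "\<And>x. x \<in> {a..b} \<Longrightarrow> \<bar>F (Suc n) x - poly ((pderiv ^^ n) h1) x\<bar> \<le> e'" by blast
  obtain Q where Q: "pderiv Q = h1" using pderiv_surjective_below[OF poly_below_Suc_degree] by blast
  define h where "h = Q + [:F 0 a - poly Q a:]"
  have h: "pderiv h = h1" "poly h a = F 0 a" by (simp_all add: h_def pderiv_add pderiv_pCons Q)
  have "\<bar>F 0 x - poly h x\<bar> \<le> e" if x: "x \<in> {a..b}" for x
  proof -
    have "norm ((F 0 x - poly h x) - (F 0 a - poly h a)) \<le> e' * norm (x - a)"
    proof (rule field_differentiable_bound[of "{a..b}" _ "\<lambda>x. F (Suc 0) x - poly h1 x"])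
      fix z assume z: "z \<in> {a..b}"
      show "((\<lambda>x. F 0 x - poly h x) has_real_derivative F (Suc 0) z - poly h1 z) (at z within {a..b})"
        using Suc.prems(1)[of 0 z] z h(1) DERIV_subset[OF poly_DERIV[of h z]]
        by (auto intro!: derivative_intros)
      show "norm (F (Suc 0) z - poly h1 z) \<le> e'" using h1(1)[OF z] by simp
    qed (use x assms(1) in auto)
    also have "\<dots> \<le> e' * (b - a)" using x e' by (intro mult_left_mono) auto
    finally show ?thesis using h(2) e' by simp
  qed
  moreover have "\<bar>F (Suc n) x - poly ((pderiv ^^ Suc n) h) x\<bar> \<le> e" if x: "x \<in> {a..b}" for x
    using h1(2)[OF x] e' h(1) by (simp only: funpow_Suc_right o_apply)
  ultimately show ?case by blast
qed

text \<open>
  The polynomial estimate carries over because \<open>F 0\<close> and \<open>F n\<close> are simultaneously close to a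
  polynomial and to its \<open>n\<close>-th derivative. The term \<open>e\<close> absorbs that error, which spares a
  passage to the limit in the approximating polynomials.
\<close>

lemma weighted_approx_real:
  fixes F :: "nat \<Rightarrow> real \<Rightarrow> real"
  assumes ab: "a < b" and d: "1 \<le> d" "n \<le> Suc d"
    and F: "\<And>i x. i < n \<Longrightarrow> x \<in> {a..b} \<Longrightarrow> (F i has_real_derivative F (Suc i) x) (at x within {a..b})"
    and cont0: "continuous_on {a..b} (F 0)" and cont: "continuous_on {a..b} (F n)" and e: "0 < e"
  shows "\<exists>p. degree p \<le> d \<and>
    real d ^ (2 * n) * integral {a..b} (\<lambda>x. (F 0 x - poly p x)\<^sup>2)
      \<le> 4 * real n ^ n * integral {a..b} (\<lambda>x. (F n x)\<^sup>2 * ((x - a) * (b - x)) ^ n) + e"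
proof -
  define L where "L = b - a"
  have L: "0 < L" using ab by (simp add: L_def)
  \<comment> \<open>A uniform error \<open>\<delta>\<close> enters the final estimate only through \<open>\<delta>\<^sup>2 * M\<close>.\<close>
  define M where "M = 2 * real d ^ (2 * n) * L + 4 * real n ^ n * L ^ (2 * n + 1)"
  have M: "0 \<le> M" using L by (simp add: M_def)
  define \<delta> where "\<delta> = min 1 (e / (M + 1))"
  have \<delta>: "0 < \<delta>" using e M by (simp add: \<delta>_def)
  have "\<delta> * \<delta> \<le> 1 * \<delta>" using \<delta> by (intro mult_right_mono) (auto simp: \<delta>_def)
  then have "\<delta>\<^sup>2 * M \<le> \<delta> * M" using M by (intro mult_right_mono) (auto simp: power2_eq_square)
  also have "\<dots> \<le> e / (M + 1) * M" using M by (intro mult_right_mono) (auto simp: \<delta>_def)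
  also have "\<dots> \<le> e" using M e by (auto simp: field_simps)
  finally have \<delta>M: "\<delta>\<^sup>2 * M \<le> e" .
  obtain h where h: "\<And>x. x \<in> {a..b} \<Longrightarrow> \<bar>F 0 x - poly h x\<bar> \<le> \<delta>"
    "\<And>x. x \<in> {a..b} \<Longrightarrow> \<bar>F n x - poly ((pderiv ^^ n) h) x\<bar> \<le> \<delta>"
    using weierstrass_derivatives[OF ab F cont \<delta>] by blast
  let ?h = "(pderiv ^^ n) h" and ?w = "\<lambda>x. ((x - a) * (b - x)) ^ n"
  obtain p where p: "degree p \<le> d" "real d ^ (2 * n) * poly_ip a b 0 (h - p) (h - p)
      \<le> real n ^ n * poly_ip a b n ?h ?h"
    using poly_approx[OF ab d] by blast
  have sq: "u\<^sup>2 \<le> 2 * v\<^sup>2 + 2 * \<delta>\<^sup>2" if "\<bar>u - v\<bar> \<le> \<delta>" for u v :: real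
  proof -
    have "(u - v)\<^sup>2 \<le> \<delta>\<^sup>2" using that \<delta> by (metis abs_le_square_iff abs_of_pos)
    moreover have "0 \<le> (u - 2 * v)\<^sup>2" by simp
    ultimately show ?thesis by (simp add: power2_eq_square algebra_simps)
  qed
  have ci: "continuous_on {a..b} g \<Longrightarrow> g integrable_on {a..b}" for g :: "real \<Rightarrow> real"
    by (rule integrable_continuous_interval)
  have "integral {a..b} (\<lambda>x. (F 0 x - poly p x)\<^sup>2)
      \<le> integral {a..b} (\<lambda>x. 2 * (poly (h - p) x)\<^sup>2 + 2 * \<delta>\<^sup>2)"
    using h(1) by (intro integral_le ci continuous_intros cont0 sq) (auto simp: algebra_simps)
  also have "\<dots> = 2 * poly_ip a b 0 (h - p) (h - p) + 2 * \<delta>\<^sup>2 * L"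
    using ab by (subst integral_add) (auto simp: poly_ip_def L_def power2_eq_square intro!: ci continuous_intros)
  finally have 1: "integral {a..b} (\<lambda>x. (F 0 x - poly p x)\<^sup>2)
      \<le> 2 * poly_ip a b 0 (h - p) (h - p) + 2 * \<delta>\<^sup>2 * L" .
  have w: "0 \<le> ?w x" "?w x \<le> L ^ (2 * n)" if "x \<in> {a..b}" for x
  proof -
    show "0 \<le> ?w x" using that by auto
    have "(x - a) * (b - x) \<le> L * L" using that by (intro mult_mono) (auto simp: L_def)
    then have "?w x \<le> (L * L) ^ n" using that by (intro power_mono) auto
    then show "?w x \<le> L ^ (2 * n)" by (simp add: power_mult power2_eq_square)
  qed
  have "poly_ip a b n ?h ?h = integral {a..b} (\<lambda>x. (poly ?h x)\<^sup>2 * ?w x)"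
    by (simp add: poly_ip_def power2_eq_square)
  also have "\<dots> \<le> integral {a..b} (\<lambda>x. 2 * ((F n x)\<^sup>2 * ?w x) + 2 * \<delta>\<^sup>2 * L ^ (2 * n))"
  proof (intro integral_le ci continuous_intros cont)
    fix x assume x: "x \<in> {a..b}"
    have "(poly ?h x)\<^sup>2 \<le> 2 * (F n x)\<^sup>2 + 2 * \<delta>\<^sup>2"
      using h(2)[OF x] by (intro sq) (simp add: abs_minus_commute)
    then have "(poly ?h x)\<^sup>2 * ?w x \<le> (2 * (F n x)\<^sup>2 + 2 * \<delta>\<^sup>2) * ?w x"
      using w[OF x] by (intro mult_right_mono)
    also have "\<dots> \<le> 2 * ((F n x)\<^sup>2 * ?w x) + 2 * \<delta>\<^sup>2 * L ^ (2 * n)"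
      using w[OF x] by (simp add: distrib_right mult_left_mono)
    finally show "(poly ?h x)\<^sup>2 * ?w x \<le> 2 * ((F n x)\<^sup>2 * ?w x) + 2 * \<delta>\<^sup>2 * L ^ (2 * n)" .
  qed
  also have "\<dots> = 2 * integral {a..b} (\<lambda>x. (F n x)\<^sup>2 * ?w x) + 2 * \<delta>\<^sup>2 * L ^ (2 * n) * L"
    using ab by (subst integral_add) (auto simp: L_def intro!: ci continuous_intros cont)
  finally have 2: "poly_ip a b n ?h ?h
      \<le> 2 * integral {a..b} (\<lambda>x. (F n x)\<^sup>2 * ?w x) + 2 * \<delta>\<^sup>2 * L ^ (2 * n) * L" .
  let ?I = "integral {a..b} (\<lambda>x. (F n x)\<^sup>2 * ?w x)"
  have "real d ^ (2 * n) * integral {a..b} (\<lambda>x. (F 0 x - poly p x)\<^sup>2)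
      \<le> real d ^ (2 * n) * (2 * poly_ip a b 0 (h - p) (h - p) + 2 * \<delta>\<^sup>2 * L)"
    using 1 by (intro mult_left_mono) auto
  also have "\<dots> \<le> 2 * (real n ^ n * poly_ip a b n ?h ?h) + real d ^ (2 * n) * (2 * \<delta>\<^sup>2 * L)"
    using p(2) by (simp add: algebra_simps)
  also have "\<dots> \<le> 2 * (real n ^ n * (2 * ?I + 2 * \<delta>\<^sup>2 * L ^ (2 * n) * L)) + real d ^ (2 * n) * (2 * \<delta>\<^sup>2 * L)"
    using 2 by (intro add_right_mono mult_left_mono) auto
  also have "\<dots> = 4 * real n ^ n * ?I + \<delta>\<^sup>2 * M"
    by (simp add: M_def algebra_simps)
  finally show ?thesis using \<delta>M p(1) by (intro exI[of _ p]) auto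
qed

lemma poly_map_poly_of_real:
  "poly (map_poly of_real p) (of_real x :: complex) = of_real (poly p x)"
  by (induction p) (auto simp: map_poly_pCons)

text \<open>Real and imaginary parts are approximated separately by real polynomials.\<close>

theorem weighted_approx:
  fixes F :: "nat \<Rightarrow> real \<Rightarrow> complex"
  assumes ab: "a < b" and d: "1 \<le> d" "n \<le> Suc d"
    and F: "\<And>i x. i < n \<Longrightarrow> x \<in> {a..b} \<Longrightarrow> (F i has_vector_derivative F (Suc i) x) (at x within {a..b})"
    and cont: "continuous_on {a..b} (F n)" and e: "0 < e"
  shows "\<exists>p. degree p \<le> d \<and>
    real d ^ (2 * n) * integral {a..b} (\<lambda>x. (norm (F 0 x - poly p (of_real x)))\<^sup>2)
      \<le> 4 * real n ^ n * integral {a..b} (\<lambda>x. (norm (F n x))\<^sup>2 * ((x - a) * (b - x)) ^ n) + e"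
proof -
  have cont0: "continuous_on {a..b} (F 0)"
    by (cases n) (use F[of 0] cont in \<open>auto intro!: continuous_on_vector_derivative[of _ _ "F (Suc 0)"]\<close>)
  let ?w = "\<lambda>x. ((x - a) * (b - x)) ^ n"
  have "\<exists>p. degree p \<le> d \<and>
      real d ^ (2 * n) * integral {a..b} (\<lambda>x. (g (F 0 x) - poly p x)\<^sup>2)
      \<le> 4 * real n ^ n * integral {a..b} (\<lambda>x. (g (F n x))\<^sup>2 * ?w x) + e / 2"
    if g: "bounded_linear g" for g :: "complex \<Rightarrow> real"
  proof (rule weighted_approx_real[OF ab d, of "\<lambda>i x. g (F i x)"])
    show "((\<lambda>x. g (F i x)) has_real_derivative g (F (Suc i) x)) (at x within {a..b})"
      if "i < n" "x \<in> {a..b}" for i x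
      using bounded_linear.has_vector_derivative[OF g F[OF that]]
      by (simp add: has_real_derivative_iff_has_vector_derivative)
  qed (use cont cont0 e in \<open>auto intro!: bounded_linear.continuous_on[OF g]\<close>)
  from this[OF bounded_linear_Re] this[OF bounded_linear_Im] obtain p q where
    p: "degree p \<le> d" "real d ^ (2 * n) * integral {a..b} (\<lambda>x. (Re (F 0 x) - poly p x)\<^sup>2)
      \<le> 4 * real n ^ n * integral {a..b} (\<lambda>x. (Re (F n x))\<^sup>2 * ?w x) + e / 2" and
    q: "degree q \<le> d" "real d ^ (2 * n) * integral {a..b} (\<lambda>x. (Im (F 0 x) - poly q x)\<^sup>2)
      \<le> 4 * real n ^ n * integral {a..b} (\<lambda>x. (Im (F n x))\<^sup>2 * ?w x) + e / 2"
    by blast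
  define r where "r = map_poly complex_of_real p + smult \<i> (map_poly complex_of_real q)"
  have r: "norm (F 0 x - poly r (of_real x)) ^ 2 = (Re (F 0 x) - poly p x)\<^sup>2 + (Im (F 0 x) - poly q x)\<^sup>2" for x
    by (simp add: r_def cmod_power2 poly_map_poly_of_real)
  have "degree r \<le> d"
    unfolding r_def using p(1) q(1)
    by (intro degree_add_le order.trans[OF degree_smult_le]) (auto intro!: degree_le simp: coeff_map_poly coeff_eq_0)
  moreover have "integral {a..b} (\<lambda>x. (norm (F 0 x - poly r (of_real x)))\<^sup>2) =
      integral {a..b} (\<lambda>x. (Re (F 0 x) - poly p x)\<^sup>2) + integral {a..b} (\<lambda>x. (Im (F 0 x) - poly q x)\<^sup>2)"
    unfolding r by (intro integral_add integrable_continuous_interval continuous_intros cont0)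
  moreover have "integral {a..b} (\<lambda>x. (norm (F n x))\<^sup>2 * ?w x) =
      integral {a..b} (\<lambda>x. (Re (F n x))\<^sup>2 * ?w x) + integral {a..b} (\<lambda>x. (Im (F n x))\<^sup>2 * ?w x)"
    unfolding cmod_power2 distrib_right
    by (intro integral_add integrable_continuous_interval continuous_intros cont)
  ultimately show ?thesis using p(2) q(2)
    by (intro exI[of _ r]) (auto simp: algebra_simps)
qed

section \<open>Iterated derivatives, profiles and periodic functions\<close>

lemma C_infinity_dir_deriv: "C_infinity_on S f \<Longrightarrow> C_infinity_on S (dir_deriv v f)"
  unfolding C_infinity_on_def by (metis C_on.simps(2))

lemma C_infinity_differentiable: "C_infinity_on S f \<Longrightarrow> x \<in> S \<Longrightarrow> f differentiable (at x)"
  unfolding C_infinity_on_def by (metis C_on.simps(2))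

lemma C_infinity_continuous_on: "C_infinity_on S f \<Longrightarrow> continuous_on S f"
  unfolding C_infinity_on_def by (metis C_on.simps(1))

lemma C_infinity_dir_deriv_iterate: "C_infinity_on S f \<Longrightarrow> C_infinity_on S ((dir_deriv v ^^ n) f)"
  by (induction n) (auto intro: C_infinity_dir_deriv)

lemma vector_derivative_eq_dir_deriv:
  assumes "C_infinity_on UNIV (f :: real \<Rightarrow> 'b::real_normed_vector)"
  shows "(\<lambda>x. vector_derivative f (at x)) = dir_deriv 1 f"
proof
  fix x
  have "f differentiable (at x)" using C_infinity_differentiable[OF assms] by simp
  then have "(f has_vector_derivative vector_derivative f (at x)) (at x)"
    by (simp add: vector_derivative_works)
  then have "(\<lambda>h. h *\<^sub>R vector_derivative f (at x)) = frechet_derivative f (at x)"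
    unfolding has_vector_derivative_def by (rule frechet_derivative_at)
  then show "vector_derivative f (at x) = dir_deriv 1 f x" by (metis scaleR_one)
qed

lemma C_infinity_has_vector_derivative:
  assumes "C_infinity_on UNIV (f :: real \<Rightarrow> 'b::real_normed_vector)"
  shows "(f has_vector_derivative vector_derivative f (at x)) (at x)"
    and "C_infinity_on UNIV (\<lambda>x. vector_derivative f (at x))"
  using C_infinity_differentiable[OF assms] C_infinity_dir_deriv[OF assms, of 1]
  by (auto simp: vector_derivative_works vector_derivative_eq_dir_deriv[OF assms])

lemma nth_vderiv_Suc: "nth_vderiv (Suc n) f = (\<lambda>t. vector_derivative (nth_vderiv n f) (at t))"
  by (simp add: nth_vderiv_def)

lemma C_infinity_nth_vderiv: "C_infinity_on UNIV f \<Longrightarrow> C_infinity_on UNIV (nth_vderiv n f)"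
  by (induction n) (simp_all add: nth_vderiv_Suc C_infinity_has_vector_derivative, simp add: nth_vderiv_def)

lemma has_vector_derivative_nth_vderiv:
  "C_infinity_on UNIV f \<Longrightarrow> (nth_vderiv n f has_vector_derivative nth_vderiv (Suc n) f t) (at t)"
  by (simp add: nth_vderiv_Suc C_infinity_has_vector_derivative C_infinity_nth_vderiv)

lemma bounded_of_bounded_at_ends:
  fixes g :: "real \<Rightarrow> real"
  assumes "continuous_on UNIV g" "\<forall>\<^sub>F x in at_top. g x \<le> c1" "\<forall>\<^sub>F x in at_bot. g x \<le> c2"
  shows "\<exists>C. \<forall>x. g x \<le> C"
proof -
  obtain x1 x2 where x1: "\<And>x. x \<ge> x1 \<Longrightarrow> g x \<le> c1" and x2: "\<And>x. x \<le> x2 \<Longrightarrow> g x \<le> c2"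
    using assms(2,3) by (auto simp: eventually_at_top_linorder eventually_at_bot_linorder)
  have "bounded (g ` {x2..x1})"
    by (intro compact_imp_bounded compact_continuous_image continuous_on_subset[OF assms(1)]) auto
  then obtain c3 where c3: "\<forall>x\<in>{x2..x1}. \<bar>g x\<bar> \<le> c3" by (auto simp: bounded_iff)
  have "g x \<le> max c1 (max c2 c3)" for x
  proof -
    consider "x \<ge> x1" | "x \<le> x2" | "x \<in> {x2..x1}" by fastforce
    then show ?thesis
    proof cases
      case 1 then show ?thesis using x1[of x] by simp
    next
      case 2 then show ?thesis using x2[of x] by simp
    next
      case 3 then show ?thesis using bspec[OF c3, of x] by simp
    qed
  qed
  then show ?thesis by blast
qed

text \<open>
  Three regimes: the leading order of the symbol expansion on the right, the rapid decay on
  the left, and continuity in between.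
\<close>

lemma profile_bound:
  assumes smooth: "C_infinity_on UNIV \<Psi>"
    and top: "symbol_expansion_at_top \<Psi> c e" "e 0 \<le> 0"
    and bot: "rapidly_decreasing_at_bot \<Psi>"
  shows "\<exists>C>0. \<forall>\<tau>. norm (nth_vderiv n \<Psi> \<tau>) \<le> C * (1 / (1 + \<bar>\<tau>\<bar>)) ^ n"
proof -
  let ?D = "nth_vderiv n \<Psi>"
  let ?g = "\<lambda>\<tau>. (1 + \<bar>\<tau>\<bar>) ^ n * norm (?D \<tau>)"
  have cont: "continuous_on UNIV ?g"
    by (intro continuous_intros C_infinity_continuous_on C_infinity_nth_vderiv smooth)
  have "(\<lambda>\<tau>. norm (nth_vderiv n (\<lambda>t. \<Psi> t - (\<Sum>j<0. c j * of_real (t powi e j))) \<tau>))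
      \<in> O[at_top](\<lambda>\<tau>. \<tau> powi (e 0 - int n))"
    using top(1) unfolding symbol_expansion_at_top_def by blast
  then obtain c1 where c1: "c1 > 0" "\<forall>\<^sub>F \<tau> in at_top. norm (?D \<tau>) \<le> c1 * \<bar>\<tau> powi (e 0 - int n)\<bar>"
    by (elim landau_o.bigE) auto
  have "\<forall>\<^sub>F \<tau> in at_top. ?g \<tau> \<le> c1 * 2 ^ n"
    using c1(2) eventually_ge_at_top[of 1]
  proof eventually_elim
    case (elim \<tau>)
    have "\<tau> powi (e 0 - int n) \<le> \<tau> powi (- int n)"
      using elim(2) top(2) by (intro power_int_increasing) auto
    then have "norm (?D \<tau>) \<le> c1 * (1 / \<tau> ^ n)"
      using elim c1(1) by (auto simp: power_int_minus divide_inverse intro: order.trans[OF _ mult_left_mono])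
    then have "?g \<tau> \<le> (2 * \<tau>) ^ n * (c1 * (1 / \<tau> ^ n))"
      using elim(2) by (intro mult_mono power_mono) auto
    also have "\<dots> = c1 * 2 ^ n" using elim(2) by (simp add: power_mult_distrib)
    finally show ?case .
  qed
  moreover have "\<forall>\<^sub>F \<tau> in at_bot. ?g \<tau> \<le> 2 ^ n"
  proof -
    have "((\<lambda>\<tau>. \<tau> ^ n *\<^sub>R ?D \<tau>) \<longlongrightarrow> 0) at_bot"
      using bot unfolding rapidly_decreasing_at_bot_def by blast
    then have "\<forall>\<^sub>F \<tau> in at_bot. norm (\<tau> ^ n *\<^sub>R ?D \<tau>) < 1"
      by (rule order_tendstoD(2)[OF tendsto_norm_zero]) simp
    then show ?thesis using eventually_le_at_bot[of "-1"]
    proof eventually_elim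
      case (elim \<tau>)
      have "?g \<tau> \<le> (2 * \<bar>\<tau>\<bar>) ^ n * norm (?D \<tau>)"
        using elim(2) by (intro mult_right_mono power_mono) auto
      also have "\<dots> = 2 ^ n * norm (\<tau> ^ n *\<^sub>R ?D \<tau>)" by (simp add: power_mult_distrib power_abs)
      also have "\<dots> \<le> 2 ^ n * 1" using elim(1) by (intro mult_left_mono) auto
      finally show ?case by simp
    qed
  qed
  ultimately obtain C where C: "\<And>\<tau>. ?g \<tau> \<le> C"
    using bounded_of_bounded_at_ends[OF cont] by blast
  have "norm (?D \<tau>) \<le> (\<bar>C\<bar> + 1) * (1 / (1 + \<bar>\<tau>\<bar>)) ^ n" for \<tau>
  proof -
    have "(1 + \<bar>\<tau>\<bar>) ^ n * norm (?D \<tau>) \<le> \<bar>C\<bar> + 1" using C[of \<tau>] by linarith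
    then show ?thesis by (simp add: power_divide field_simps)
  qed
  then show ?thesis by (intro exI[of _ "\<bar>C\<bar> + 1"]) auto
qed

lemma periodic_int:
  fixes f :: "real \<Rightarrow> 'b"
  assumes "\<And>s. f (s + T) = f s"
  shows "f (s + of_int l * T) = f s"
proof (induction l rule: int_induct[of _ 0])
  case (step1 i)
  then show ?case using assms[of "s + of_int i * T"] by (simp add: algebra_simps)
next
  case (step2 i)
  then show ?case using assms[of "s + of_int (i - 1) * T"] by (simp add: algebra_simps)
qed simp

lemma shift_into_period:
  fixes T :: real assumes "T > 0"
  shows "\<exists>l::int. s + of_int l * T \<in> {c..<c + T}"
proof -
  define q where "q = \<lfloor>(s - c) / T\<rfloor>"
  have "of_int q \<le> (s - c) / T" "(s - c) / T < of_int q + 1"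
    unfolding q_def by linarith+
  then have "of_int q * T \<le> s - c" "s - c < (of_int q + 1) * T"
    using assms by (simp_all add: pos_le_divide_eq pos_divide_less_eq)
  then show ?thesis by (intro exI[of _ "- q"]) (auto simp: distrib_right)
qed

lemma periodic_bound:
  fixes f :: "real \<Rightarrow> 'b"
  assumes "T > 0" "\<And>s. f (s + T) = f s" "\<And>s. s \<in> {0..T} \<Longrightarrow> Q (f s)"
  shows "Q (f s)"
proof -
  obtain l where "s + of_int l * T \<in> {0..<0 + T}" using shift_into_period[OF assms(1)] by blast
  then show ?thesis using assms(3)[of "s + of_int l * T"] periodic_int[of f T, OF assms(2)] by auto
qed

lemma periodic_vector_derivative:
  fixes f :: "real \<Rightarrow> 'b::real_normed_vector"
  assumes "\<And>s. (f has_vector_derivative f' s) (at s)" "\<And>s. f (s + T) = f s"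
  shows "f' (s + T) = f' s"
proof -
  have "((\<lambda>x. f (x + T)) has_vector_derivative f' (s + T)) (at s)"
    using vector_diff_chain_at[of "\<lambda>x. x + T" 1 s f "f' (s + T)"] assms(1)[of "s + T"]
    by (simp add: o_def has_vector_derivative_add_const)
  then show ?thesis using assms(1)[of s] unfolding assms(2)
    by (rule vector_derivative_unique_at)
qed

lemma periodic_smooth_derivative:
  assumes "periodic_smooth T f"
  shows "periodic_smooth T (\<lambda>x. vector_derivative f (at x))"
proof -
  have f: "C_infinity_on UNIV f" "\<And>s. f (s + T) = f s" using assms by (auto simp: periodic_smooth_def)
  show ?thesis
    unfolding periodic_smooth_def
    using C_infinity_has_vector_derivative[OF f(1)]
      periodic_vector_derivative[of f "\<lambda>x. vector_derivative f (at x)" T] f(2) by blast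
qed

lemma periodic_smooth_bounded:
  fixes Z :: "real \<Rightarrow> 'b::real_normed_vector"
  assumes "periodic_smooth T Z" "T > 0"
  shows "\<exists>c. \<forall>s. norm (Z s) \<le> c"
proof -
  have "continuous_on UNIV Z"
    using assms by (auto simp: periodic_smooth_def intro: C_infinity_continuous_on)
  then have "bounded (Z ` {0..T})"
    by (intro compact_imp_bounded compact_continuous_image) (auto intro: continuous_on_subset)
  then obtain c where c: "\<forall>s\<in>{0..T}. norm (Z s) \<le> c" by (auto simp: bounded_iff)
  have "norm (Z s) \<le> c" for s
    by (rule periodic_bound[of T Z "\<lambda>x. norm x \<le> c"])
      (use c assms in \<open>auto simp: periodic_smooth_def\<close>)
  then show ?thesis by blast
qed

section \<open>Symbols that concentrate at the shadow boundary\<close>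

context
  fixes k0 :: real and W :: "real \<Rightarrow> real \<Rightarrow> real"
  assumes W0: "\<And>k s. k \<ge> k0 \<Longrightarrow> 0 \<le> W k s"
begin

text \<open>
  A family \<open>A k\<close> of functions of \<open>s\<close> whose \<open>i\<close>-th derivatives, for \<open>i \<le> n\<close>, are at most a
  constant times \<open>B * W ^ i\<close>, uniformly in \<open>k \<ge> k0\<close>: differentiation costs one factor \<open>W\<close>.
  The recursive form makes the Leibniz rule an induction without binomial sums.
\<close>

primrec weighted_symbol :: "nat \<Rightarrow> (real \<Rightarrow> real \<Rightarrow> real) \<Rightarrow> (real \<Rightarrow> real \<Rightarrow> complex) \<Rightarrow> bool" where
  "weighted_symbol 0 B A \<longleftrightarrow> (\<forall>k\<ge>k0. continuous_on UNIV (A k)) \<and>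
     (\<exists>C>0. \<forall>k\<ge>k0. \<forall>s. norm (A k s) \<le> C * B k s)"
| "weighted_symbol (Suc n) B A \<longleftrightarrow> (\<exists>C>0. \<forall>k\<ge>k0. \<forall>s. norm (A k s) \<le> C * B k s) \<and>
     (\<exists>A'. (\<forall>k\<ge>k0. \<forall>s. (A k has_vector_derivative A' k s) (at s)) \<and>
       weighted_symbol n (\<lambda>k s. B k s * W k s) A')"

lemma weighted_symbol_bound: "weighted_symbol n B A \<Longrightarrow> \<exists>C>0. \<forall>k\<ge>k0. \<forall>s. norm (A k s) \<le> C * B k s"
  by (cases n) auto

lemma weighted_symbol_0I:
  assumes "\<exists>C>0. \<forall>k\<ge>k0. \<forall>s. norm (A k s) \<le> C * B k s"
    and "\<And>k. k \<ge> k0 \<Longrightarrow> continuous_on UNIV (A k)"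
  shows "weighted_symbol 0 B A"
  using assms by simp

lemma weighted_symbol_SucI:
  assumes "\<exists>C>0. \<forall>k\<ge>k0. \<forall>s. norm (A k s) \<le> C * B k s"
    and "\<And>k s. k \<ge> k0 \<Longrightarrow> (A k has_vector_derivative A' k s) (at s)"
    and "weighted_symbol n (\<lambda>k s. B k s * W k s) A'"
  shows "weighted_symbol (Suc n) B A"
  using assms by (subst weighted_symbol.simps(2)) blast

lemma weighted_symbol_Suc_imp: "weighted_symbol (Suc n) B A \<Longrightarrow> weighted_symbol n B A"
proof (induction n arbitrary: A B)
  case 0
  then show ?case
    by (auto intro!: continuous_on_vector_derivative intro: has_vector_derivative_at_within)
next
  case (Suc n)
  obtain A' where A': "\<forall>k\<ge>k0. \<forall>s. (A k has_vector_derivative A' k s) (at s)"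
    "weighted_symbol (Suc n) (\<lambda>k s. B k s * W k s) A'"
    using Suc.prems by (subst (asm) weighted_symbol.simps(2)) blast
  show ?case
    using A'(1) weighted_symbol_bound[OF Suc.prems] Suc.IH[OF A'(2)] by (intro weighted_symbol_SucI) auto
qed

lemma weighted_symbol_mono:
  assumes "weighted_symbol n B A" "0 < c" "\<And>k s. k \<ge> k0 \<Longrightarrow> B k s \<le> c * B' k s"
  shows "weighted_symbol n B' A"
  using assms(1,3)
proof (induction n arbitrary: A B B')
  have bound: "\<exists>C>0. \<forall>k\<ge>k0. \<forall>s. norm (A k s) \<le> C * B' k s"
    if A: "weighted_symbol n B A" and le: "\<And>k s. k \<ge> k0 \<Longrightarrow> B k s \<le> c * B' k s" for n A B B'
  proof -
    obtain C where C: "C > 0" "\<And>k s. k \<ge> k0 \<Longrightarrow> norm (A k s) \<le> C * B k s"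
      using weighted_symbol_bound[OF A] by blast
    have "norm (A k s) \<le> (C * c) * B' k s" if "k \<ge> k0" for k s
    proof -
      have "C * B k s \<le> C * (c * B' k s)" using le[OF that] C(1) by (intro mult_left_mono) auto
      with C(2)[OF that, of s] show ?thesis by simp
    qed
    then show ?thesis using C(1) \<open>0 < c\<close> by (intro exI[of _ "C * c"]) auto
  qed
  {
    case 0
    then show ?case using bound[OF 0] by simp
  next
    case (Suc n)
    obtain A' where A': "\<forall>k\<ge>k0. \<forall>s. (A k has_vector_derivative A' k s) (at s)"
      "weighted_symbol n (\<lambda>k s. B k s * W k s) A'" using Suc.prems(1) by auto
    have "weighted_symbol n (\<lambda>k s. B' k s * W k s) A'"
      using A'(2)
    proof (rule Suc.IH)
      show "B k s * W k s \<le> c * (B' k s * W k s)" if "k \<ge> k0" for k s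
        using mult_right_mono[OF Suc.prems(2)[OF that] W0[OF that], of s s] by (simp add: mult.assoc)
    qed
    then show ?case using bound[OF Suc.prems] A'(1) by (intro weighted_symbol_SucI) auto
  }
qed

lemma weighted_symbol_add:
  assumes "weighted_symbol n B A1" "weighted_symbol n B A2"
  shows "weighted_symbol n B (\<lambda>k s. A1 k s + A2 k s)"
  using assms
proof (induction n arbitrary: A1 A2 B)
  have bound: "\<exists>C>0. \<forall>k\<ge>k0. \<forall>s. norm (A1 k s + A2 k s) \<le> C * B k s"
    if A: "weighted_symbol n B A1" "weighted_symbol n B A2" for n A1 A2 B
  proof -
    obtain C1 C2 where "C1 > 0" "C2 > 0" "\<And>k s. k \<ge> k0 \<Longrightarrow> norm (A1 k s) \<le> C1 * B k s"
      "\<And>k s. k \<ge> k0 \<Longrightarrow> norm (A2 k s) \<le> C2 * B k s"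
      using A[THEN weighted_symbol_bound] by blast
    then show ?thesis
      by (intro exI[of _ "C1 + C2"]) (auto simp: distrib_right intro: order.trans[OF norm_triangle_ineq add_mono])
  qed
  {
    case 0
    then show ?case using bound[of 0 B A1 A2] by (auto intro!: continuous_intros)
  next
    case (Suc n)
    obtain A1' A2' where A': "\<forall>k\<ge>k0. \<forall>s. (A1 k has_vector_derivative A1' k s) (at s)"
      "weighted_symbol n (\<lambda>k s. B k s * W k s) A1'" "\<forall>k\<ge>k0. \<forall>s. (A2 k has_vector_derivative A2' k s) (at s)"
      "weighted_symbol n (\<lambda>k s. B k s * W k s) A2'"
      using Suc.prems by auto
    have "weighted_symbol n (\<lambda>k s. B k s * W k s) (\<lambda>k s. A1' k s + A2' k s)" using A' by (intro Suc.IH)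
    moreover have "((\<lambda>s. A1 k s + A2 k s) has_vector_derivative A1' k s + A2' k s) (at s)"
      if "k \<ge> k0" for k s
      using A' that by (auto intro!: derivative_intros)
    ultimately show ?case using bound[OF Suc.prems] by (intro weighted_symbol_SucI)
  }
qed

lemma weighted_symbol_mult:
  assumes "weighted_symbol n B1 A1" "weighted_symbol n B2 A2"
  shows "weighted_symbol n (\<lambda>k s. B1 k s * B2 k s) (\<lambda>k s. A1 k s * A2 k s)"
  using assms
proof (induction n arbitrary: A1 A2 B1 B2)
  have bound: "\<exists>C>0. \<forall>k\<ge>k0. \<forall>s. norm (A1 k s * A2 k s) \<le> C * (B1 k s * B2 k s)"
    if A: "weighted_symbol n B1 A1" "weighted_symbol n B2 A2" for n A1 A2 B1 B2
  proof -
    obtain C1 C2 where C: "C1 > 0" "C2 > 0" "\<And>k s. k \<ge> k0 \<Longrightarrow> norm (A1 k s) \<le> C1 * B1 k s"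
      "\<And>k s. k \<ge> k0 \<Longrightarrow> norm (A2 k s) \<le> C2 * B2 k s"
      using A[THEN weighted_symbol_bound] by blast
    have "norm (A1 k s * A2 k s) \<le> (C1 * C2) * (B1 k s * B2 k s)" if "k \<ge> k0" for k s
    proof -
      have "norm (A1 k s) * norm (A2 k s) \<le> (C1 * B1 k s) * (C2 * B2 k s)"
        using C(3,4)[OF that, of s] by (intro mult_mono) (auto intro: order.trans[OF norm_ge_zero])
      then show ?thesis by (simp add: norm_mult mult_ac)
    qed
    then show ?thesis using C(1,2) by (intro exI[of _ "C1 * C2"]) auto
  qed
  {
    case 0
    then show ?case using bound[of 0 B1 A1 B2 A2] by (auto intro!: continuous_intros)
  next
    case (Suc n)
    obtain A1' A2' where A': "\<forall>k\<ge>k0. \<forall>s. (A1 k has_vector_derivative A1' k s) (at s)"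
      "weighted_symbol n (\<lambda>k s. B1 k s * W k s) A1'" "\<forall>k\<ge>k0. \<forall>s. (A2 k has_vector_derivative A2' k s) (at s)"
      "weighted_symbol n (\<lambda>k s. B2 k s * W k s) A2'"
      using Suc.prems by auto
    note IH1 = Suc.IH[OF weighted_symbol_Suc_imp[OF Suc.prems(1)] A'(4)]
    note IH2 = Suc.IH[OF A'(2) weighted_symbol_Suc_imp[OF Suc.prems(2)]]
    have "weighted_symbol n (\<lambda>k s. B1 k s * B2 k s * W k s) (\<lambda>k s. A1 k s * A2' k s + A1' k s * A2 k s)"
      using IH1 IH2 by (intro weighted_symbol_add) (simp_all add: mult_ac)
    moreover have "((\<lambda>s. A1 k s * A2 k s) has_vector_derivative
        A1 k s * A2' k s + A1' k s * A2 k s) (at s)" if "k \<ge> k0" for k s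
      using A' that by (auto intro!: derivative_intros)
    ultimately show ?case using bound[OF Suc.prems] by (intro weighted_symbol_SucI)
  }
qed

lemma weighted_symbol_const:
  assumes "\<And>k. k \<ge> k0 \<Longrightarrow> norm (c k) \<le> B k"
  shows "weighted_symbol n (\<lambda>k s. B k) (\<lambda>k s. c k)"
proof -
  have zero: "weighted_symbol n B' (\<lambda>_ _. 0)" if "\<And>k s. k \<ge> k0 \<Longrightarrow> 0 \<le> B' k s" for n B'
    using that
  proof (induction n arbitrary: B')
    case 0
    then show ?case by (auto intro: exI[of _ 1])
  next
    case (Suc n)
    have "weighted_symbol n (\<lambda>k s. B' k s * W k s) (\<lambda>_ _. 0)" using Suc.prems W0 by (intro Suc.IH) auto
    then show ?case using Suc.prems
      by (auto intro!: exI[of _ 1] exI[of _ "\<lambda>_ _. 0"])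
  qed
  show ?thesis
  proof (cases n)
    case 0
    then show ?thesis using assms by (auto intro: exI[of _ 1])
  next
    case (Suc n')
    have "weighted_symbol n' (\<lambda>k s. B k * W k s) (\<lambda>_ _. 0)"
      using assms W0 by (intro zero) (meson mult_nonneg_nonneg norm_ge_zero order.trans)
    then show ?thesis using assms unfolding Suc
      by (auto intro!: exI[of _ 1] exI[of _ "\<lambda>_ _. 0"])
  qed
qed

lemma weighted_symbol_sum:
  assumes "finite I" "\<And>i. i \<in> I \<Longrightarrow> weighted_symbol n (\<lambda>k s. B k) (A i)" "\<And>k. k \<ge> k0 \<Longrightarrow> 0 \<le> B k"
  shows "weighted_symbol n (\<lambda>k s. B k) (\<lambda>k s. \<Sum>i\<in>I. A i k s)"
  using assms(1,2)
proof (induction I)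
  case empty
  then show ?case using weighted_symbol_const[of "\<lambda>_. 0" B n] assms(3) by simp
next
  case (insert i I)
  then show ?case using weighted_symbol_add[of n "\<lambda>k s. B k" "A i" "\<lambda>k s. \<Sum>i\<in>I. A i k s"] by simp
qed

text \<open>
  Unfolds the recursion into the sequence of derivatives that the approximation theorem
  expects.
\<close>

lemma weighted_symbol_derivatives:
  assumes "weighted_symbol n B A"
  shows "\<exists>F. F 0 = A \<and>
    (\<forall>i<n. \<forall>k\<ge>k0. \<forall>s. (F i k has_vector_derivative F (Suc i) k s) (at s)) \<and>
    (\<forall>k\<ge>k0. continuous_on UNIV (F n k)) \<and>
    (\<exists>C>0. \<forall>k\<ge>k0. \<forall>s. norm (F n k s) \<le> C * (B k s * W k s ^ n))"
  using assms
proof (induction n arbitrary: A B)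
  case 0
  then show ?case by (auto intro!: exI[of _ "\<lambda>_. A"])
next
  case (Suc n)
  obtain A' where A': "\<forall>k\<ge>k0. \<forall>s. (A k has_vector_derivative A' k s) (at s)"
    "weighted_symbol n (\<lambda>k s. B k s * W k s) A'" using Suc.prems by auto
  obtain F C where F: "F 0 = A'"
    "\<And>i k s. i<n \<Longrightarrow> k\<ge>k0 \<Longrightarrow> (F i k has_vector_derivative F (Suc i) k s) (at s)"
    "\<And>k. k\<ge>k0 \<Longrightarrow> continuous_on UNIV (F n k)"
    "C>0" "\<And>k s. k\<ge>k0 \<Longrightarrow> norm (F n k s) \<le> C * (B k s * W k s * W k s ^ n)"
    using Suc.IH[OF A'(2)] by metis
  define G where "G = case_nat A F"
  have "(G i k has_vector_derivative G (Suc i) k s) (at s)" if "i < Suc n" "k \<ge> k0" for i k s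
    using that A'(1) F(1,2) by (cases i) (auto simp: G_def)
  moreover have "G 0 = A" "\<And>k. k\<ge>k0 \<Longrightarrow> continuous_on UNIV (G (Suc n) k)"
    "\<And>k s. k\<ge>k0 \<Longrightarrow> norm (G (Suc n) k s) \<le> C * (B k s * W k s ^ Suc n)"
    using F(3,5) by (auto simp: G_def mult_ac)
  ultimately show ?case using F(4) by (intro exI[of _ G]) auto
qed

context
  fixes w0 :: real
  assumes w0: "0 < w0" and W_lower: "\<And>k s. k \<ge> k0 \<Longrightarrow> w0 \<le> W k s"
begin

lemma weighted_symbol_times_W:
  assumes "weighted_symbol n (\<lambda>k s. B k) A" "\<And>k. k \<ge> k0 \<Longrightarrow> 0 \<le> B k"
  shows "weighted_symbol n (\<lambda>k s. B k * W k s) A"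
proof (rule weighted_symbol_mono[OF assms(1), of "1 / w0"])
  fix k s assume k: "k \<ge> k0"
  have "B k * w0 \<le> B k * W k s" using W_lower k assms(2) by (intro mult_left_mono) auto
  then show "B k \<le> 1 / w0 * (B k * W k s)" using w0 by (simp add: field_simps)
qed (use w0 in auto)

text \<open>
  All derivatives of a fixed smooth periodic function are bounded. As the weight is bounded
  below, this is within the allowance of one factor \<open>W\<close> for each derivative.
\<close>

lemma weighted_symbol_periodic_smooth:
  assumes "periodic_smooth T f" "T > 0" "bounded_linear g"
  shows "weighted_symbol n (\<lambda>k s. 1) (\<lambda>k s. g (f s))"
  using assms(1)
proof (induction n arbitrary: f)
  have bound: "\<exists>C>0. \<forall>s. norm (g (f s)) \<le> C" if f: "periodic_smooth T f" for f
  proof -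
    obtain c where c: "\<And>s. norm (f s) \<le> c" using periodic_smooth_bounded[OF f assms(2)] by blast
    obtain K where K: "\<And>x. norm (g x) \<le> norm x * K" "K \<ge> 0"
      using bounded_linear.nonneg_bounded[OF assms(3)] by blast
    define C where "C = c * K"
    have "norm (g (f s)) \<le> C" for s
      unfolding C_def by (rule order.trans[OF K(1)]) (intro mult_right_mono c K(2))
    then have "norm (g (f s)) \<le> \<bar>C\<bar> + 1" for s by (smt (verit) abs_ge_self)
    then show ?thesis by (intro exI[of _ "\<bar>C\<bar> + 1"]) auto
  qed
  {
    case 0
    have "continuous_on UNIV f"
      using 0 by (intro C_infinity_continuous_on) (simp add: periodic_smooth_def)
    then show ?case using bound[OF 0] by (auto intro: bounded_linear.continuous_on[OF assms(3)])
  next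
    case (Suc n)
    have "weighted_symbol n (\<lambda>k s. 1 * W k s) (\<lambda>k s. g (vector_derivative f (at s)))"
      using Suc.prems by (intro weighted_symbol_times_W Suc.IH periodic_smooth_derivative) auto
    moreover have "((\<lambda>s. g (f s)) has_vector_derivative g (vector_derivative f (at s))) (at s)" for s
      using Suc.prems C_infinity_has_vector_derivative(1)[of f]
      by (intro bounded_linear.has_vector_derivative[OF assms(3)]) (auto simp: periodic_smooth_def)
    ultimately show ?case using bound[OF Suc.prems] by (intro weighted_symbol_SucI) auto
  }
qed

text \<open>
  A remainder of very negative order absorbs the powers \<open>k powr (1/3)\<close> that its derivatives
  cost. Partial derivatives in \<open>s\<close> along a line \<open>k = const\<close> are ordinary derivatives; they
  inherit the period, which extends the bound from one period to all \<open>s\<close>.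
\<close>

lemma weighted_symbol_hoermander:
  assumes e: "e \<in> hoermander_class P (- M) \<rho> (1/3)" and P: "P > 0" and k0: "k0 \<ge> 1"
    and M: "real n / 3 + \<mu> \<le> M"
  shows "weighted_symbol n (\<lambda>k s. k powr - \<mu>) (\<lambda>k s. e (s, k))"
proof -
  let ?A = "\<lambda>i k s. (dir_deriv (1, 0) ^^ i) e (s, k)"
  have smooth: "C_infinity_on (UNIV \<times> {0<..}) ((dir_deriv (1, 0) ^^ i) e)" for i
    using e by (auto simp: hoermander_class_def intro: C_infinity_dir_deriv_iterate)
  have deriv: "(?A i k has_vector_derivative ?A (Suc i) k s) (at s)" if "k \<ge> k0" for i k s
  proof -
    let ?f = "(dir_deriv (1, 0) ^^ i) e"
    have "?f differentiable (at (s, k))"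
      using that k0 by (intro C_infinity_differentiable[OF smooth]) auto
    then have "(?f has_derivative frechet_derivative ?f (at (s, k))) (at (s, k))"
      by (simp add: frechet_derivative_works)
    moreover have "((\<lambda>s. (s, k)) has_vector_derivative (1, 0)) (at s)"
      by (auto simp: has_vector_derivative_def intro!: derivative_eq_intros)
    ultimately have "((\<lambda>s. ?f (s, k)) has_vector_derivative frechet_derivative ?f (at (s, k)) (1, 0)) (at s)"
      using vector_derivative_diff_chain_within[of "\<lambda>s. (s, k)" "(1, 0)" s UNIV ?f]
      by (auto simp: o_def intro: has_derivative_at_withinI)
    then show ?thesis by simp
  qed
  have per: "?A i k (s + 2 * P) = ?A i k s" if k: "k \<ge> k0" for i k s
  proof (induction i arbitrary: s)
    case 0
    then show ?case using e k k0 by (auto simp: hoermander_class_def)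
  next
    case (Suc i)
    then show ?case using periodic_vector_derivative[of "?A i k" "?A (Suc i) k" "2 * P" s] deriv[OF k] by blast
  qed
  have bound: "\<exists>C>0. \<forall>k\<ge>k0. \<forall>s. norm (?A i k s) \<le> C * k powr - \<mu>" if i: "i \<le> n" for i
  proof -
    have "\<forall>n m. \<forall>\<kappa>>0. \<exists>C. \<forall>s\<in>{0..2 * P}. \<forall>k\<ge>\<kappa>.
            norm ((dir_deriv (1, 0) ^^ n) ((dir_deriv (0, 1) ^^ m) e) (s, k))
              \<le> C * k powr (- M + 1/3 * real n - \<rho> * real m)"
      using e by (simp add: hoermander_class_def)
    from this[rule_format, of k0 i 0] k0
    have "\<exists>C. \<forall>s\<in>{0..2 * P}. \<forall>k\<ge>k0. norm (?A i k s) \<le> C * k powr (- M + 1/3 * real i)"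
      by simp
    then obtain C where
      C: "\<And>s k. s \<in> {0..2 * P} \<Longrightarrow> k \<ge> k0 \<Longrightarrow> norm (?A i k s) \<le> C * k powr (- M + 1/3 * real i)"
      by blast
    have "norm (?A i k s) \<le> (\<bar>C\<bar> + 1) * k powr - \<mu>" if k: "k \<ge> k0" for k s
    proof (rule periodic_bound[of "2 * P" "?A i k" "\<lambda>x. norm x \<le> (\<bar>C\<bar> + 1) * k powr - \<mu>"])
      fix s assume "s \<in> {0..2 * P}"
      then have "norm (?A i k s) \<le> C * k powr (- M + 1/3 * real i)" using C k by blast
      also have "\<dots> \<le> (\<bar>C\<bar> + 1) * k powr - \<mu>"
        using M i k k0 by (intro mult_mono powr_mono) auto
      finally show "norm (?A i k s) \<le> (\<bar>C\<bar> + 1) * k powr - \<mu>" .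
    qed (use P per[OF k] in auto)
    then show ?thesis by (intro exI[of _ "\<bar>C\<bar> + 1"]) auto
  qed
  have "weighted_symbol j (\<lambda>k s. k powr - \<mu>) (?A i)" if "i + j \<le> n" for i j
    using that
  proof (induction j arbitrary: i)
    case 0
    have "continuous_on UNIV (?A i k)" if "k \<ge> k0" for k
      using deriv[OF that]
      by (intro continuous_on_vector_derivative) (blast intro: has_vector_derivative_at_within)
    then show ?case using bound[of i] 0 by auto
  next
    case (Suc j)
    have "weighted_symbol j (\<lambda>k s. k powr - \<mu> * W k s) (?A (Suc i))"
      using Suc by (intro weighted_symbol_times_W Suc.IH) auto
    with deriv bound[of i] Suc.prems show ?case by (intro weighted_symbol_SucI) auto
  qed
  from this[of 0 n] show ?thesis by simp
qed

end
end

lemma weighted_symbol_continuous: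
  assumes "weighted_symbol k0 W n B A" "\<And>k s. k \<ge> k0 \<Longrightarrow> 0 \<le> W k s" "k \<ge> k0"
  shows "continuous_on UNIV (A k)"
proof -
  have "weighted_symbol k0 W 0 B A"
    using assms(1)
  proof (induction n)
    case (Suc n)
    have "weighted_symbol k0 W n B A" by (rule weighted_symbol_Suc_imp[OF _ Suc.prems]) (rule assms(2))
    then show ?case by (rule Suc.IH)
  qed simp
  then show ?thesis using assms(3) by (simp add: weighted_symbol.simps(1)[OF assms(2)])
qed

text \<open>
  The price of one derivative in \<open>s\<close>: comparable to \<open>1 / (k powr (- 1/3) + \<bar>Z s\<bar>)\<close>.
\<close>

definition concentration :: "(real \<Rightarrow> real) \<Rightarrow> real \<Rightarrow> real \<Rightarrow> real" where
  "concentration Z k s = k powr (1/3) / (1 + k powr (1/3) * \<bar>Z s\<bar>)"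

lemma concentration_nonneg: "0 \<le> concentration Z k s"
  by (simp add: concentration_def)

lemma concentration_le: "concentration Z k s \<le> k powr (1/3)"
proof -
  let ?x = "k powr (1/3)"
  have "?x * 1 \<le> ?x * (1 + ?x * \<bar>Z s\<bar>)" by (intro mult_left_mono) auto
  then show ?thesis unfolding concentration_def
    by (subst pos_divide_le_eq) (auto simp: add_pos_nonneg)
qed

lemma concentration_le_inverse: "c > 0 \<Longrightarrow> c \<le> \<bar>Z s\<bar> \<Longrightarrow> concentration Z k s \<le> 1 / c"
proof -
  assume c: "c > 0" "c \<le> \<bar>Z s\<bar>"
  let ?x = "k powr (1/3)"
  have "?x * c \<le> ?x * \<bar>Z s\<bar>" using c by (intro mult_left_mono) auto
  then have "?x * c \<le> 1 * (1 + ?x * \<bar>Z s\<bar>)" by simp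
  then show ?thesis unfolding concentration_def
    using c by (simp add: pos_divide_le_eq pos_le_divide_eq add_pos_nonneg)
qed

lemma concentration_lower:
  assumes "k \<ge> 1" "\<bar>Z s\<bar> \<le> c"
  shows "1 / (1 + c) \<le> concentration Z k s"
proof -
  let ?x = "k powr (1/3)"
  have x: "1 \<le> ?x" using assms(1) by (simp add: ge_one_powr_ge_zero)
  have c: "0 \<le> c" using assms(2) by linarith
  have "?x * \<bar>Z s\<bar> \<le> ?x * c" using assms x by (intro mult_left_mono) auto
  then have "1 + ?x * \<bar>Z s\<bar> \<le> ?x * (1 + c)" using x by (simp add: distrib_left)
  then show ?thesis unfolding concentration_def
    using x c by (simp add: divide_simps add_pos_nonneg mult.commute)
qed

text \<open>
  One derivative produces the factor \<open>k powr (1/3) Z'\<close> and, by the decay of the profile, one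
  more factor \<open>1 / (1 + k powr (1/3) \<bar>Z\<bar>)\<close>; together these are the concentration weight up
  to a constant.
\<close>

lemma weighted_symbol_profile:
  assumes \<Psi>: "C_infinity_on UNIV \<Psi>" "symbol_expansion_at_top \<Psi> c e" "e 0 \<le> 0"
      "rapidly_decreasing_at_bot \<Psi>"
    and Z: "periodic_smooth T Z" "T > 0" and k0: "k0 \<ge> 1"
  shows "weighted_symbol k0 (concentration Z) n (\<lambda>k s. (1 / (1 + k powr (1/3) * \<bar>Z s\<bar>)) ^ j)
    (\<lambda>k s. nth_vderiv (p + j) \<Psi> (k powr (1/3) * Z s))"
proof (induction n arbitrary: j)
  let ?W = "concentration Z"
  let ?V = "\<lambda>k s. 1 / (1 + k powr (1/3) * \<bar>Z s\<bar>)"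
  let ?A = "\<lambda>j k s. nth_vderiv (p + j) \<Psi> (k powr (1/3) * Z s)"
  have bound: "\<exists>C>0. \<forall>k\<ge>k0. \<forall>s. norm (?A j k s) \<le> C * ?V k s ^ j" for j
  proof -
    obtain C where C: "C > 0" "\<And>\<tau>. norm (nth_vderiv (p + j) \<Psi> \<tau>) \<le> C * (1 / (1 + \<bar>\<tau>\<bar>)) ^ (p + j)"
      using profile_bound[OF \<Psi>] by blast
    have "norm (?A j k s) \<le> C * ?V k s ^ j" for k s
    proof -
      have "?V k s ^ (p + j) \<le> ?V k s ^ j"
        by (intro power_decreasing) (auto simp: divide_simps add_pos_nonneg)
      then have "C * ?V k s ^ (p + j) \<le> C * ?V k s ^ j" using C(1) by (intro mult_left_mono) auto
      then show ?thesis using C(2)[of "k powr (1/3) * Z s"] by (simp add: abs_mult)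
    qed
    then show ?thesis using C(1) by blast
  qed
  have Zc: "C_infinity_on UNIV Z" using Z by (simp add: periodic_smooth_def)
  {
    case 0
    have "continuous_on UNIV (?A j k)" for k
      by (rule continuous_on_compose2[OF C_infinity_continuous_on[OF C_infinity_nth_vderiv[OF \<Psi>(1)]]])
        (auto intro!: continuous_on_mult_left C_infinity_continuous_on[OF Zc])
    then show ?case using bound[of j] by (intro weighted_symbol_0I) (auto simp: concentration_nonneg)
  next
    case (Suc n)
    let ?Z' = "\<lambda>s. vector_derivative Z (at s)"
    obtain cz where cz: "\<And>s. \<bar>Z s\<bar> \<le> cz" using periodic_smooth_bounded[OF Z] by auto
    then have cz0: "0 \<le> cz" using abs_ge_zero order.trans by blast
    have "weighted_symbol k0 ?W n (\<lambda>k s. 1) (\<lambda>k s. complex_of_real (?Z' s))"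
      using periodic_smooth_derivative[OF Z(1)] Z(2) cz0 cz k0
      by (intro weighted_symbol_periodic_smooth[of _ _ "1 / (1 + cz)" T]) 
        (auto simp: concentration_nonneg bounded_linear_of_real intro!: concentration_lower)
    moreover have "weighted_symbol k0 ?W n (\<lambda>k s. k powr (1/3)) (\<lambda>k s. complex_of_real (k powr (1/3)))"
      by (intro weighted_symbol_const) (auto simp: concentration_nonneg)
    moreover note Suc.IH[of "Suc j"]
    ultimately have "weighted_symbol k0 ?W n (\<lambda>k s. 1 * (k powr (1/3) * ?V k s ^ Suc j))
        (\<lambda>k s. complex_of_real (?Z' s) * (complex_of_real (k powr (1/3)) * ?A (Suc j) k s))"
      by (intro weighted_symbol_mult) (auto simp: concentration_nonneg)
    then have "weighted_symbol k0 ?W n (\<lambda>k s. ?V k s ^ j * ?W k s)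
        (\<lambda>k s. complex_of_real (?Z' s) * (complex_of_real (k powr (1/3)) * ?A (Suc j) k s))"
      by (simp add: concentration_def mult_ac)
    moreover have "(?A j k has_vector_derivative
        complex_of_real (?Z' s) * (complex_of_real (k powr (1/3)) * ?A (Suc j) k s)) (at s)" for k s
    proof -
      have "((\<lambda>s. k powr (1/3) * Z s) has_vector_derivative k powr (1/3) * ?Z' s) (at s)"
        using C_infinity_has_vector_derivative(1)[OF Zc] by (auto intro!: derivative_eq_intros)
      from vector_diff_chain_at[OF this has_vector_derivative_nth_vderiv[OF \<Psi>(1)]]
      show ?thesis by (simp add: o_def scaleR_conv_of_real mult_ac)
    qed
    ultimately show ?case using bound[of j] by (intro weighted_symbol_SucI) (auto simp: concentration_nonneg)
  }
qed

text \<open>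
  Because \<open>l \<le> -1\<close>, the exponent in the case distinction is never positive.
\<close>

lemma \<theta>_eq_base_exponent: "i \<in> indices \<Longrightarrow> \<theta> i = base_exponent i"
  by (auto simp: indices_def \<theta>_def Let_def split: prod.splits)

text \<open>
  Compare with a finite partial sum that is so long that its remainder is negligible and
  that contains the leading indices. The terms in between have base exponent at most
  \<open>- \<beta> / 3\<close>.
\<close>

theorem weighted_symbol_remainder:
  assumes expansion: "asymptotic_expansion P t1 t2 a b Z \<Psi> c" and P: "P > 0" and k0: "k0 \<ge> 1"
  shows "weighted_symbol k0 (concentration Z) n (\<lambda>k s. k powr (- real \<beta> / 3))
    (\<lambda>k s. a (s, k) - (\<Sum>i\<in>leading_indices \<beta>. expansion_term b Z \<Psi> i (s, k)))"
proof -
  let ?W = "concentration Z" and ?B = "\<lambda>k. k powr (- real \<beta> / 3)"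
  have Z: "periodic_smooth (2 * P) Z" and
    b: "\<And>i. i \<in> indices \<Longrightarrow> periodic_smooth (2 * P) (b i)" and
    \<Psi>: "\<And>r l. l \<le> -1 \<Longrightarrow> C_infinity_on UNIV (\<Psi> r l)"
      "\<And>r l. l \<le> -1 \<Longrightarrow> symbol_expansion_at_top (\<Psi> r l) (c r l) (\<lambda>j. 1 + l - 2 * int r - 3 * int j)"
      "\<And>r l. l \<le> -1 \<Longrightarrow> rapidly_decreasing_at_bot (\<Psi> r l)"
    using expansion by (simp_all add: asymptotic_expansion_def)
  obtain cz where cz: "\<And>s. \<bar>Z s\<bar> \<le> cz" using periodic_smooth_bounded[OF Z] P by auto
  then have cz0: "0 \<le> cz" using abs_ge_zero order.trans by blast
  have lower: "1 / (1 + cz) \<le> concentration Z k s" if "k \<ge> k0" for k s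
    using that k0 cz by (intro concentration_lower) auto
  have term_bound: "weighted_symbol k0 ?W n (\<lambda>k s. ?B k) (\<lambda>k s. expansion_term b Z \<Psi> i (s, k))"
    if i: "i \<in> indices" "i \<notin> leading_indices \<beta>" for i
  proof -
    obtain p q r l where i_eq: "i = (p, q, r, l)" by (cases i) auto
    have l: "l \<le> -1" using i i_eq by (simp add: indices_def)
    have base: "base_exponent i \<le> - real \<beta> / 3"
      using i \<theta>_eq_base_exponent[of i] by (auto simp: leading_indices_def)
    have "weighted_symbol k0 ?W n (\<lambda>k s. k powr base_exponent i) (\<lambda>k s. complex_of_real (k powr base_exponent i))"
      by (intro weighted_symbol_const) (auto simp: concentration_nonneg)
    moreover have "weighted_symbol k0 ?W n (\<lambda>k s. 1) (\<lambda>k s. b i s)"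
      using b[OF i(1)] P cz0 cz k0
      by (intro weighted_symbol_periodic_smooth[of _ _ "1 / (1 + cz)" "2 * P"])
        (auto simp: concentration_nonneg intro!: concentration_lower)
    moreover have "weighted_symbol k0 ?W n (\<lambda>k s. 1) (\<lambda>k s. nth_vderiv p (\<Psi> r l) (k powr (1/3) * Z s))"
      using weighted_symbol_profile[OF \<Psi>(1,2)[OF l] _ \<Psi>(3)[OF l] Z _ k0, of r n 0 p] P l by simp
    ultimately have "weighted_symbol k0 ?W n (\<lambda>k s. k powr base_exponent i * 1 * 1)
      (\<lambda>k s. complex_of_real (k powr base_exponent i) * b i s * nth_vderiv p (\<Psi> r l) (k powr (1/3) * Z s))"
      by (intro weighted_symbol_mult) (auto simp: concentration_nonneg)
    then have "weighted_symbol k0 ?W n (\<lambda>k s. ?B k)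
      (\<lambda>k s. complex_of_real (k powr base_exponent i) * b i s * nth_vderiv p (\<Psi> r l) (k powr (1/3) * Z s))"
      using base k0 by (rule_tac weighted_symbol_mono[of k0 ?W, where c = 1])
        (auto simp: concentration_nonneg intro!: powr_mono)
    then show ?thesis by (simp add: expansion_term_def i_eq)
  qed
  \<comment> \<open>The order that pays for \<open>n\<close> derivatives at \<open>k powr (1/3)\<close> each and for the factor
    \<open>k powr (- \<beta> / 3)\<close>.\<close>
  define M where "M = real n / 3 + real \<beta> / 3 + 1"
  have "M > 0" by (auto simp: M_def intro!: add_nonneg_pos)
  have expansion_M: "\<forall>M>0. \<exists>F\<^sub>M. finite F\<^sub>M \<and> F\<^sub>M \<subseteq> indices \<and>
        (\<forall>F. finite F \<and> F\<^sub>M \<subseteq> F \<and> F \<subseteq> indices \<longrightarrow>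
           (\<lambda>x. a x - (\<Sum>i\<in>F. expansion_term b Z \<Psi> i x)) \<in> hoermander_class P (- M) (2/3) (1/3))"
    using expansion unfolding asymptotic_expansion_def by (elim conjE)
  from expansion_M[THEN spec, THEN mp, OF \<open>M > 0\<close>] obtain FM where FM_all:
    "finite FM \<and> FM \<subseteq> indices \<and> (\<forall>F. finite F \<and> FM \<subseteq> F \<and> F \<subseteq> indices \<longrightarrow>
      (\<lambda>x. a x - (\<Sum>i\<in>F. expansion_term b Z \<Psi> i x)) \<in> hoermander_class P (- M) (2/3) (1/3))"
    by (rule exE)
  then have FM: "finite FM" "FM \<subseteq> indices" by simp_all
  define F where "F = FM \<union> leading_indices \<beta>"
  have F: "finite F" "leading_indices \<beta> \<subseteq> F" "F \<subseteq> indices"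
    using FM finite_leading_indices by (auto simp: F_def leading_indices_def)
  have "(\<lambda>x. a x - (\<Sum>i\<in>F. expansion_term b Z \<Psi> i x)) \<in> hoermander_class P (- M) (2/3) (1/3)"
    using FM_all[THEN conjunct2, THEN conjunct2, THEN spec, of F] F by (simp add: F_def)
  from weighted_symbol_hoermander[OF _ _ _ this P k0, of ?W "1 / (1 + cz)" n "real \<beta> / 3"] cz0 lower
  have "weighted_symbol k0 ?W n (\<lambda>k s. ?B k) (\<lambda>k s. a (s, k) - (\<Sum>i\<in>F. expansion_term b Z \<Psi> i (s, k)))"
    by (simp add: concentration_nonneg M_def)
  moreover have "weighted_symbol k0 ?W n (\<lambda>k s. ?B k) (\<lambda>k s. \<Sum>i\<in>F - leading_indices \<beta>. expansion_term b Z \<Psi> i (s, k))"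
    using F by (intro weighted_symbol_sum term_bound) (auto simp: concentration_nonneg)
  ultimately have "weighted_symbol k0 ?W n (\<lambda>k s. ?B k) (\<lambda>k s. a (s, k) - (\<Sum>i\<in>F. expansion_term b Z \<Psi> i (s, k))
      + (\<Sum>i\<in>F - leading_indices \<beta>. expansion_term b Z \<Psi> i (s, k)))"
    by (intro weighted_symbol_add) (auto simp: concentration_nonneg)
  moreover have "(\<Sum>i\<in>F. g i) = (\<Sum>i\<in>F - leading_indices \<beta>. g i) + (\<Sum>i\<in>leading_indices \<beta>. g i)"
    for g :: "index \<Rightarrow> complex"
    using F by (intro sum.subset_diff) auto
  ultimately show ?thesis by simp
qed

lemma simple_zero_lower_bound:
  fixes Z :: "real \<Rightarrow> real"
  assumes "(Z has_real_derivative z) (at A)" "z \<noteq> 0" "Z A = 0"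
  shows "\<exists>\<delta>>0. \<forall>s. \<bar>s - A\<bar> < \<delta> \<longrightarrow> \<bar>z\<bar> / 2 * \<bar>s - A\<bar> \<le> \<bar>Z s\<bar>"
proof -
  have "((\<lambda>s. \<bar>(Z s - Z A) / (s - A)\<bar>) \<longlongrightarrow> \<bar>z\<bar>) (at A)"
    using assms(1) by (intro tendsto_rabs) (simp add: has_field_derivative_iff)
  then have "\<forall>\<^sub>F s in at A. \<bar>z\<bar> / 2 < \<bar>(Z s - Z A) / (s - A)\<bar>"
    using assms(2) by (intro order_tendstoD(1)) auto
  then obtain \<delta> where \<delta>: "\<delta> > 0" "\<And>s. s \<noteq> A \<Longrightarrow> \<bar>s - A\<bar> < \<delta> \<Longrightarrow> \<bar>z\<bar> / 2 < \<bar>Z s / (s - A)\<bar>"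
    using assms(3) by (auto simp: eventually_at dist_real_def)
  have "\<bar>z\<bar> / 2 * \<bar>s - A\<bar> \<le> \<bar>Z s\<bar>" if "\<bar>s - A\<bar> < \<delta>" for s
  proof (cases "s = A")
    case False
    then show ?thesis using \<delta>(2)[OF False that] by (simp add: abs_divide pos_less_divide_eq)
  qed (use assms in auto)
  then show ?thesis using \<delta>(1) by blast
qed

text \<open>Difference quotients near the two zeros, compactness in between.\<close>

lemma simple_zeros_lower_bound:
  fixes Z :: "real \<Rightarrow> real"
  assumes AB: "A < B" and cont: "continuous_on {A..B} Z"
    and nz: "\<And>s. A < s \<Longrightarrow> s < B \<Longrightarrow> Z s \<noteq> 0"
    and A: "(Z has_real_derivative zA) (at A)" "zA \<noteq> 0" "Z A = 0"
    and B: "(Z has_real_derivative zB) (at B)" "zB \<noteq> 0" "Z B = 0"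
  shows "\<exists>c>0. \<forall>s\<in>{A..B}. c * min (s - A) (B - s) \<le> \<bar>Z s\<bar>"
proof -
  obtain \<delta>A where \<delta>A: "\<delta>A > 0" "\<And>s. \<bar>s - A\<bar> < \<delta>A \<Longrightarrow> \<bar>zA\<bar> / 2 * \<bar>s - A\<bar> \<le> \<bar>Z s\<bar>"
    using simple_zero_lower_bound[OF A] by blast
  obtain \<delta>B where \<delta>B: "\<delta>B > 0" "\<And>s. \<bar>s - B\<bar> < \<delta>B \<Longrightarrow> \<bar>zB\<bar> / 2 * \<bar>s - B\<bar> \<le> \<bar>Z s\<bar>"
    using simple_zero_lower_bound[OF B] by blast
  let ?K = "{A + \<delta>A..B - \<delta>B}"
  have "\<exists>c>0. \<forall>s\<in>?K. c \<le> \<bar>Z s\<bar>"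
  proof (cases "?K = {}")
    case True
    then show ?thesis by (intro exI[of _ 1]) auto
  next
    case False
    have "continuous_on ?K (\<lambda>s. \<bar>Z s\<bar>)"
      using \<delta>A(1) \<delta>B(1) by (intro continuous_intros continuous_on_subset[OF cont]) auto
    then obtain x where "x \<in> ?K" "\<forall>s\<in>?K. \<bar>Z x\<bar> \<le> \<bar>Z s\<bar>"
      using continuous_attains_inf[OF compact_Icc False] by blast
    then show ?thesis using nz[of x] \<delta>A(1) \<delta>B(1) by (intro exI[of _ "\<bar>Z x\<bar>"]) auto
  qed
  then obtain c3 where c3: "c3 > 0" "\<And>s. s \<in> ?K \<Longrightarrow> c3 \<le> \<bar>Z s\<bar>" by blast
  define c where "c = min (min (\<bar>zA\<bar> / 2) (\<bar>zB\<bar> / 2)) (c3 / (B - A))"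
  have c: "c > 0" using A B c3 AB by (auto simp: c_def)
  have c_le: "c \<le> \<bar>zA\<bar> / 2" "c \<le> \<bar>zB\<bar> / 2" "c \<le> c3 / (B - A)"
    unfolding c_def by (meson min.cobounded1 min.cobounded2 order.trans)+
  have "c * min (s - A) (B - s) \<le> \<bar>Z s\<bar>" if s: "s \<in> {A..B}" for s
  proof -
    consider "\<bar>s - A\<bar> < \<delta>A" | "\<bar>s - B\<bar> < \<delta>B" | "s \<in> ?K" using s by fastforce
    then show ?thesis
    proof cases
      case 1
      have "c * min (s - A) (B - s) \<le> \<bar>zA\<bar> / 2 * \<bar>s - A\<bar>"
        using s c c_le by (intro mult_mono) auto
      then show ?thesis using \<delta>A(2)[OF 1] by linarith
    next
      case 2
      have "c * min (s - A) (B - s) \<le> \<bar>zB\<bar> / 2 * \<bar>s - B\<bar>"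
        using s c c_le by (intro mult_mono) auto
      then show ?thesis using \<delta>B(2)[OF 2] by linarith
    next
      case 3
      have "c * min (s - A) (B - s) \<le> c3 / (B - A) * (B - A)"
        using s c c3 AB c_le by (intro mult_mono) auto
      then show ?thesis using c3(2)[OF 3] AB by simp
    qed
  qed
  then show ?thesis using c by blast
qed

lemma concentration_le_arc:
  assumes "c > 0" "c * min (s - A) (B - s) \<le> \<bar>Z s\<bar>" "A < s" "s < B"
  shows "concentration Z k s \<le> 1 / c * (1 / (s - A) + 1 / (B - s))"
proof -
  have "concentration Z k s \<le> 1 / (c * min (s - A) (B - s))"
    using assms by (intro concentration_le_inverse) auto
  also have "\<dots> \<le> 1 / c * (1 / (s - A) + 1 / (B - s))"
    using assms by (auto simp: min_def divide_simps)
  finally show ?thesis .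
qed

section \<open>Inverse powers integrated against the edge weight\<close>

text \<open>
  The order at which the integral of \<open>(L / x) ^ n\<close> over \<open>[L / q, L]\<close>, divided by \<open>L\<close>, grows
  with \<open>q\<close>.
\<close>

definition growth :: "nat \<Rightarrow> real \<Rightarrow> real" where
  "growth n q = (if n = 0 then 1 else if n = 1 then ln q else q ^ (n - 1))"

lemma growth_nonneg: "q \<ge> 1 \<Longrightarrow> 0 \<le> growth n q"
  by (simp add: growth_def)

lemma integral_inverse_power:
  fixes A a b q :: real
  assumes A: "A < a" "a < b" and q: "b - A \<le> q * (a - A)"
  shows "(b - a) ^ n * integral {a..b} (\<lambda>s. (1 / (s - A)) ^ n) \<le> (b - A) * growth n q"
proof -
  have "1 * (a - A) \<le> q * (a - A)" using A by (intro order.trans[OF _ q]) simp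
  then have q1: "1 \<le> q" using A by (metis diff_gt_0_iff_gt mult_le_cancel_right_pos)
  consider "n = 0" | "n = 1" | j where "n = Suc (Suc j)"
    by (metis One_nat_def not0_implies_Suc)
  then show ?thesis
  proof cases
    case 1
    then show ?thesis using A by (simp add: growth_def)
  next
    case 2
    have "((\<lambda>s. 1 / (s - A)) has_integral (ln (b - A) - ln (a - A))) {a..b}"
      using A by (intro fundamental_theorem_of_calculus)
        (auto intro!: derivative_eq_intros simp flip: has_real_derivative_iff_has_vector_derivative)
    then have "integral {a..b} (\<lambda>s. 1 / (s - A)) = ln ((b - A) / (a - A))"
      using A by (simp add: integral_unique ln_div)
    also have "\<dots> \<le> ln q" using A q by (intro ln_mono) (auto simp: pos_divide_le_eq)
    finally show ?thesis using 2 A q1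
      by (simp add: growth_def) (intro mult_mono, auto intro!: integral_nonneg integrable_continuous_interval continuous_intros)
  next
    case 3
    have I2: "((\<lambda>s. (1 / (s - A))\<^sup>2) has_integral ((- 1 / (b - A)) - (- 1 / (a - A)))) {a..b}"
      using A by (intro fundamental_theorem_of_calculus)
        (auto intro!: derivative_eq_intros simp: power2_eq_square simp flip: has_real_derivative_iff_has_vector_derivative)
    \<comment> \<open>All but two of the factors are bounded by their value at \<open>a\<close>; the rest has an elementary
      primitive.\<close>
    have "integral {a..b} (\<lambda>s. (1 / (s - A)) ^ n) \<le> integral {a..b} (\<lambda>s. (1 / (a - A)) ^ j * (1 / (s - A))\<^sup>2)"
    proof (intro integral_le integrable_continuous_interval continuous_intros)
      fix s assume s: "s \<in> {a..b}"
      have "(1 / (s - A)) ^ j \<le> (1 / (a - A)) ^ j"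
        using s A by (intro power_mono) (auto simp: frac_le)
      then show "(1 / (s - A)) ^ n \<le> (1 / (a - A)) ^ j * (1 / (s - A))\<^sup>2"
        using 3 mult_right_mono[of _ _ "(1 / (s - A))\<^sup>2"] by (simp add: power2_eq_square mult_ac)
    qed (use A in auto)
    also have "\<dots> = (1 / (a - A)) ^ j * (1 / (a - A) - 1 / (b - A))"
      using integral_unique[OF I2] by simp
    also have "\<dots> \<le> (1 / (a - A)) ^ j * (1 / (a - A))"
      using A by (intro mult_left_mono) auto
    finally have I: "integral {a..b} (\<lambda>s. (1 / (s - A)) ^ n) \<le> (1 / (a - A)) ^ Suc j" by simp
    have "(b - a) ^ n * integral {a..b} (\<lambda>s. (1 / (s - A)) ^ n) \<le> (b - A) ^ n * (1 / (a - A)) ^ Suc j"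
      using A I by (intro mult_mono power_mono integral_nonneg integrable_continuous_interval continuous_intros) auto
    also have "\<dots> = (b - A) * ((b - A) / (a - A)) ^ Suc j"
      using 3 by (simp add: power_divide)
    also have "\<dots> \<le> (b - A) * q ^ Suc j"
      using A q by (intro mult_left_mono power_mono) (auto simp: pos_divide_le_eq)
    finally show ?thesis using 3 by (simp add: growth_def)
  qed
qed

lemma add_power_le:
  fixes x y :: real
  assumes "0 \<le> x" "0 \<le> y"
  shows "(x + y) ^ m \<le> 2 ^ m * (x ^ m + y ^ m)"
proof -
  have "(x + y) ^ m \<le> (2 * max x y) ^ m" using assms by (intro power_mono) auto
  also have "\<dots> = 2 ^ m * max x y ^ m" by (simp add: power_mult_distrib)
  also have "\<dots> \<le> 2 ^ m * (x ^ m + y ^ m)"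
    using assms by (intro mult_left_mono) (auto simp: max_def)
  finally show ?thesis .
qed

text \<open>
  The zeros at \<open>A\<close> and \<open>B\<close> are treated one at a time. For the zero at \<open>A\<close>, the factor
  \<open>s - a \<le> s - A\<close> of the weight cancels one of the two singular factors and \<open>b - s\<close> is
  bounded by the length; the zero at \<open>B\<close> is the mirror image.
\<close>

lemma integral_weighted_two_sided:
  fixes A B a b q L :: real
  assumes A: "A < a" "a < b" "b < B" and L: "B - A \<le> L"
    and q: "b - A \<le> q * (a - A)" "B - a \<le> q * (B - b)"
    and G: "continuous_on {a..b} G"
      "\<And>s. s \<in> {a..b} \<Longrightarrow> 0 \<le> G s \<and> G s \<le> M * (1 / (s - A) + 1 / (B - s)) ^ (2 * n)"
    and M: "0 \<le> M"
  shows "integral {a..b} (\<lambda>s. G s * ((s - a) * (b - s)) ^ n) \<le> 2 * 4 ^ n * M * L * growth n q"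
proof -
  have q1: "1 \<le> q"
  proof -
    have "1 * (a - A) \<le> q * (a - A)" using A by (intro order.trans[OF _ q(1)]) simp
    then show ?thesis using A by (metis diff_gt_0_iff_gt mult_le_cancel_right_pos)
  qed
  have pw: "z ^ (2 * n) * v ^ n = (z * v) ^ n * z ^ n" for z v :: real
    by (simp add: power_mult power2_eq_square power_mult_distrib mult_ac)
  let ?r = "\<lambda>s. (b - a) ^ n * (1 / (s - A)) ^ n + (b - a) ^ n * (1 / (B - s)) ^ n"
  have "integral {a..b} (\<lambda>s. G s * ((s - a) * (b - s)) ^ n) \<le> integral {a..b} (\<lambda>s. M * 4 ^ n * ?r s)"
  proof (intro integral_le integrable_continuous_interval continuous_intros G)
    fix s assume s: "s \<in> {a..b}"
    let ?x = "1 / (s - A)" and ?y = "1 / (B - s)" and ?w = "((s - a) * (b - s)) ^ n"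
    have w0: "0 \<le> ?w" using s by auto
    have wx: "?x ^ (2 * n) * ?w \<le> (b - a) ^ n * ?x ^ n"
    proof -
      have "?x * ((s - a) * (b - s)) \<le> ?x * ((s - A) * (b - a))"
        using s A by (intro mult_left_mono mult_mono) auto
      then have "?x * ((s - a) * (b - s)) \<le> b - a" using s A by simp
      then have "(?x * ((s - a) * (b - s))) ^ n * ?x ^ n \<le> (b - a) ^ n * ?x ^ n"
        using s A by (intro mult_right_mono power_mono) auto
      then show ?thesis by (simp only: pw)
    qed
    have wy: "?y ^ (2 * n) * ?w \<le> (b - a) ^ n * ?y ^ n"
    proof -
      have "?y * ((s - a) * (b - s)) \<le> ?y * ((b - a) * (B - s))"
        using s A by (intro mult_left_mono mult_mono) auto
      then have "?y * ((s - a) * (b - s)) \<le> b - a" using s A by simp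
      then have "(?y * ((s - a) * (b - s))) ^ n * ?y ^ n \<le> (b - a) ^ n * ?y ^ n"
        using s A by (intro mult_right_mono power_mono) auto
      then show ?thesis by (simp only: pw)
    qed
    have "G s * ?w \<le> M * (?x + ?y) ^ (2 * n) * ?w"
      using G(2)[OF s] w0 by (intro mult_right_mono) auto
    also have "\<dots> \<le> M * (2 ^ (2 * n) * (?x ^ (2 * n) + ?y ^ (2 * n))) * ?w"
      using s A M w0 by (intro mult_right_mono mult_left_mono add_power_le) auto
    also have "\<dots> = M * 4 ^ n * (?x ^ (2 * n) * ?w + ?y ^ (2 * n) * ?w)"
    proof -
      have "(2::real) ^ (2 * n) = 4 ^ n" by (simp add: power_mult)
      then show ?thesis by (simp only: distrib_left distrib_right mult.assoc)
    qed
    also have "\<dots> \<le> M * 4 ^ n * ?r s"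
      using wx wy M by (intro mult_left_mono add_mono) auto
    finally show "G s * ?w \<le> M * 4 ^ n * ?r s" .
  qed (use A in auto)
  also have "\<dots> = M * 4 ^ n * ((b - a) ^ n * integral {a..b} (\<lambda>s. (1 / (s - A)) ^ n)
      + (b - a) ^ n * integral {a..b} (\<lambda>s. (1 / (B - s)) ^ n))"
    unfolding integral_mult_right
    by (subst integral_add)
       (use A in \<open>auto intro!: integrable_continuous_interval continuous_intros\<close>)
  also have "\<dots> \<le> M * 4 ^ n * (L * growth n q + L * growth n q)"
  proof (intro mult_left_mono add_mono)
    have "(b - a) ^ n * integral {a..b} (\<lambda>s. (1 / (s - A)) ^ n) \<le> (b - A) * growth n q"
      using A q by (intro integral_inverse_power)
    also have "\<dots> \<le> L * growth n q" using A L growth_nonneg[OF q1] by (intro mult_right_mono) auto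
    finally show "(b - a) ^ n * integral {a..b} (\<lambda>s. (1 / (s - A)) ^ n) \<le> L * growth n q" .
    have "integral {-b..-a} (\<lambda>s. (1 / (B - (-s))) ^ n) = integral {a..b} (\<lambda>s. (1 / (B - s)) ^ n)"
      using Henstock_Kurzweil_Integration.integral_reflect_real[of b a "\<lambda>s. (1 / (B - s)) ^ n"] by simp
    then have "(b - a) ^ n * integral {a..b} (\<lambda>s. (1 / (B - s)) ^ n)
        = (- a - - b) ^ n * integral {-b..-a} (\<lambda>s. (1 / (s - - B)) ^ n)"
      by (simp add: add.commute)
    also have "\<dots> \<le> (- a - - B) * growth n q"
      using A q by (intro integral_inverse_power) auto
    also have "\<dots> \<le> L * growth n q" using A L growth_nonneg[OF q1] by (intro mult_right_mono) auto
    finally show "(b - a) ^ n * integral {a..b} (\<lambda>s. (1 / (B - s)) ^ n) \<le> L * growth n q" .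
  qed (use M in auto)
  finally show ?thesis by (simp add: algebra_simps)
qed

lemma integral_weighted_bounded:
  fixes a b :: real
  assumes ab: "a < b" and G: "continuous_on {a..b} G" "\<And>s. s \<in> {a..b} \<Longrightarrow> 0 \<le> G s \<and> G s \<le> M"
  shows "integral {a..b} (\<lambda>s. G s * ((s - a) * (b - s)) ^ n) \<le> M * (b - a) ^ (2 * n + 1)"
proof -
  have "integral {a..b} (\<lambda>s. G s * ((s - a) * (b - s)) ^ n) \<le> integral {a..b} (\<lambda>s. M * (b - a) ^ (2 * n))"
  proof (intro integral_le integrable_continuous_interval continuous_intros G)
    fix s assume s: "s \<in> {a..b}"
    have "((s - a) * (b - s)) ^ n \<le> ((b - a) * (b - a)) ^ n"
      using s by (intro power_mono mult_mono) auto
    then have "G s * ((s - a) * (b - s)) ^ n \<le> M * ((b - a) * (b - a)) ^ n"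
      using G(2)[OF s] s by (intro mult_mono) auto
    then show "G s * ((s - a) * (b - s)) ^ n \<le> M * (b - a) ^ (2 * n)"
      by (simp add: power_mult power2_eq_square)
  qed
  also have "\<dots> = M * (b - a) ^ (2 * n + 1)" using ab by simp
  finally show ?thesis .
qed

section \<open>Square integrable functions and the lemma of Cea\<close>

lemma L2_measurable: "\<phi> \<in> L2 P \<Longrightarrow> \<phi> \<in> borel_measurable (lebesgue_on {0..2 * P})"
  by (simp add: L2_def)

lemma L2_add:
  assumes "\<phi> \<in> L2 P" "\<psi> \<in> L2 P"
  shows "(\<lambda>s. \<phi> s + \<psi> s) \<in> L2 P"
proof -
  have "norm ((norm (\<phi> s + \<psi> s))\<^sup>2) \<le> norm (2 * (norm (\<phi> s))\<^sup>2 + 2 * (norm (\<psi> s))\<^sup>2)" for s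
  proof -
    have "(norm (\<phi> s + \<psi> s))\<^sup>2 \<le> (norm (\<phi> s) + norm (\<psi> s))\<^sup>2"
      by (intro power_mono norm_triangle_ineq) auto
    also have "\<dots> \<le> 2 * (norm (\<phi> s))\<^sup>2 + 2 * (norm (\<psi> s))\<^sup>2"
      using sum_squares_bound[of "norm (\<phi> s)" "norm (\<psi> s)"] by (simp add: power2_sum)
    finally show ?thesis by simp
  qed
  note le = this
  have I: "integrable (lebesgue_on {0..2 * P}) (\<lambda>s. 2 * (norm (\<phi> s))\<^sup>2 + 2 * (norm (\<psi> s))\<^sup>2)"
    using assms by (simp add: L2_def)
  have m: "(\<lambda>s. \<phi> s + \<psi> s) \<in> borel_measurable (lebesgue_on {0..2 * P})"
    by (intro borel_measurable_add L2_measurable assms)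
  have "integrable (lebesgue_on {0..2 * P}) (\<lambda>s. (norm (\<phi> s + \<psi> s))\<^sup>2)"
    by (rule Bochner_Integration.integrable_bound[OF I]) (use le m in simp_all)
  then show ?thesis using m by (simp add: L2_def)
qed

lemma L2_scale: "\<phi> \<in> L2 P \<Longrightarrow> (\<lambda>s. c * \<phi> s) \<in> L2 P"
  by (auto simp: L2_def norm_mult power_mult_distrib)

lemma L2_diff:
  assumes "\<phi> \<in> L2 P" "\<psi> \<in> L2 P"
  shows "(\<lambda>s. \<phi> s - \<psi> s) \<in> L2 P"
  using L2_add[OF assms(1) L2_scale[OF assms(2), of "-1"]] by simp

lemma L2_of_bounded:
  assumes "\<phi> \<in> borel_measurable (lebesgue_on {0..2 * P})" "\<And>s. s \<in> {0..2 * P} \<Longrightarrow> norm (\<phi> s) \<le> C"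
  shows "\<phi> \<in> L2 P"
proof -
  interpret finite_measure "lebesgue_on {0..2 * P}"
    by (rule finite_measure_lebesgue_on) simp
  have "(norm (\<phi> s))\<^sup>2 \<le> C\<^sup>2" if "s \<in> {0..2 * P}" for s
    using assms(2)[OF that] by (intro power_mono) auto
  then have "integrable (lebesgue_on {0..2 * P}) (\<lambda>s. (norm (\<phi> s))\<^sup>2)"
    using assms(1) by (intro integrable_const_bound[of _ "C\<^sup>2"] AE_I2 borel_measurable_power borel_measurable_norm)
      (simp_all add: space_restrict_space)
  then show ?thesis using assms(1) by (simp add: L2_def)
qed

lemma L2_of_continuous:
  assumes "continuous_on UNIV \<phi>"
  shows "\<phi> \<in> L2 P"
proof -
  have "bounded (\<phi> ` {0..2 * P})"
    by (intro compact_imp_bounded compact_continuous_image continuous_on_subset[OF assms]) auto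
  then obtain C where C: "\<forall>s\<in>{0..2 * P}. norm (\<phi> s) \<le> C" by (auto simp: bounded_iff)
  show ?thesis
  proof (rule L2_of_bounded)
    have "\<phi> \<in> borel_measurable borel" using assms by (rule borel_measurable_continuous_onI)
    then show "\<phi> \<in> borel_measurable (lebesgue_on {0..2 * P})"
      by (intro measurable_restrict_space1 measurable_completion) simp
  qed (use C in blast)
qed

lemma L2_integrable_mult:
  assumes "\<phi> \<in> L2 P" "\<psi> \<in> L2 P"
  shows "integrable (lebesgue_on {0..2 * P}) (\<lambda>s. \<phi> s * cnj (\<psi> s))"
proof (rule Bochner_Integration.integrable_bound[of _ "\<lambda>s. (norm (\<phi> s))\<^sup>2 + (norm (\<psi> s))\<^sup>2"])
  show "AE s in lebesgue_on {0..2 * P}. norm (\<phi> s * cnj (\<psi> s)) \<le> norm ((norm (\<phi> s))\<^sup>2 + (norm (\<psi> s))\<^sup>2)"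
  proof (rule AE_I2)
    fix s
    have "2 * (norm (\<phi> s) * norm (\<psi> s)) \<le> (norm (\<phi> s))\<^sup>2 + (norm (\<psi> s))\<^sup>2"
      using sum_squares_bound[of "norm (\<phi> s)" "norm (\<psi> s)"] by simp
    moreover have "0 \<le> norm (\<phi> s) * norm (\<psi> s)" by simp
    ultimately have "norm (\<phi> s) * norm (\<psi> s) \<le> (norm (\<phi> s))\<^sup>2 + (norm (\<psi> s))\<^sup>2"
      by linarith
    then show "norm (\<phi> s * cnj (\<psi> s)) \<le> norm ((norm (\<phi> s))\<^sup>2 + (norm (\<psi> s))\<^sup>2)"
      by (simp add: norm_mult)
  qed
  have "cnj \<in> borel_measurable borel" by (intro borel_measurable_continuous_onI continuous_intros)
  then show "(\<lambda>s. \<phi> s * cnj (\<psi> s)) \<in> borel_measurable (lebesgue_on {0..2 * P})"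
    using assms by (intro borel_measurable_times measurable_compose[of \<psi> _ borel cnj]) (auto simp: L2_def)
qed (use assms in \<open>auto simp: L2_def\<close>)

lemma L2_inner_diff_left:
  assumes "\<phi> \<in> L2 P" "\<psi> \<in> L2 P" "\<omega> \<in> L2 P"
  shows "L2_inner P (\<lambda>s. \<phi> s - \<psi> s) \<omega> = L2_inner P \<phi> \<omega> - L2_inner P \<psi> \<omega>"
  unfolding L2_inner_def using assms
  by (subst Bochner_Integration.integral_diff[symmetric]) (auto simp: L2_integrable_mult left_diff_distrib)

lemma L2_inner_diff_right:
  assumes "\<phi> \<in> L2 P" "\<psi> \<in> L2 P" "\<omega> \<in> L2 P"
  shows "L2_inner P \<omega> (\<lambda>s. \<phi> s - \<psi> s) = L2_inner P \<omega> \<phi> - L2_inner P \<omega> \<psi>"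
  unfolding L2_inner_def using assms
  by (subst Bochner_Integration.integral_diff[symmetric]) (auto simp: L2_integrable_mult right_diff_distrib)

lemma L2_inner_cong_AE:
  assumes "\<phi> \<in> L2 P" "\<psi> \<in> L2 P" "\<omega> \<in> L2 P" "AE s in lebesgue_on {0..2 * P}. \<phi> s = \<psi> s"
  shows "L2_inner P \<omega> \<phi> = L2_inner P \<omega> \<psi>"
  unfolding L2_inner_def
  using assms L2_integrable_mult[OF assms(3,1)] L2_integrable_mult[OF assms(3,2)]
  by (intro integral_cong_AE) auto

lemma L2_norm_nonneg: "0 \<le> L2_norm P \<phi>"
  by (simp add: L2_norm_def)

text \<open>
  Galerkin orthogonality lets \<open>v\<close> replace \<open>w\<close> in one of the two slots of the coercivity
  estimate. The operator is linear only almost everywhere, so the error equation is used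
  under the inner product.
\<close>

theorem cea_lemma:
  assumes A: "coercive_operator P A C c"
    and V: "V \<subseteq> L2 P" "\<And>v w. v \<in> V \<Longrightarrow> w \<in> V \<Longrightarrow> (\<lambda>s. v s - w s) \<in> V"
    and \<rho>: "\<rho> \<in> L2 P" and g: "g \<in> L2 P" "AE s in lebesgue_on {0..2 * P}. A \<rho> s = g s"
    and w: "galerkin_solution P V A g w" and v: "v \<in> V"
  shows "L2_norm P (\<lambda>s. \<rho> s - w s) \<le> C / c * L2_norm P (\<lambda>s. \<rho> s - v s)"
proof -
  have c: "c > 0" "C > 0" and AL2: "\<And>\<phi>. \<phi> \<in> L2 P \<Longrightarrow> A \<phi> \<in> L2 P"
    and lin: "\<And>\<phi> \<psi> x y. \<phi> \<in> L2 P \<Longrightarrow> \<psi> \<in> L2 P \<Longrightarrow>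
      AE s in lebesgue_on {0..2 * P}. A (\<lambda>t. x * \<phi> t + y * \<psi> t) s = x * A \<phi> s + y * A \<psi> s"
    and cont: "\<And>\<mu> \<phi>. \<mu> \<in> L2 P \<Longrightarrow> \<phi> \<in> L2 P \<Longrightarrow> norm (L2_inner P \<mu> (A \<phi>)) \<le> C * L2_norm P \<mu> * L2_norm P \<phi>"
    and coer: "\<And>\<mu>. \<mu> \<in> L2 P \<Longrightarrow> c * (L2_norm P \<mu>)\<^sup>2 \<le> norm (L2_inner P \<mu> (A \<mu>))"
    using A by (simp_all add: coercive_operator_def)
  have wV: "w \<in> V" and gal: "\<And>v. v \<in> V \<Longrightarrow> L2_inner P v (A w) = L2_inner P v g"
    using w by (auto simp: galerkin_solution_def)
  define e where "e = (\<lambda>s. \<rho> s - w s)"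
  have w2: "w \<in> L2 P" and v2: "v \<in> L2 P" using wV v V by auto
  have e: "e \<in> L2 P" unfolding e_def by (intro L2_diff \<rho> w2)
  have Ae: "AE s in lebesgue_on {0..2 * P}. A e s = g s - A w s"
    using lin[OF \<rho> w2, of 1 "-1"] g(2) by eventually_elim (simp add: e_def)
  have orth: "L2_inner P u (A e) = 0" if u: "u \<in> V" for u
  proof -
    have u2: "u \<in> L2 P" using u V by auto
    have "L2_inner P u (A e) = L2_inner P u (\<lambda>s. g s - A w s)"
      by (intro L2_inner_cong_AE AL2 e u2 Ae L2_diff g w2)
    also have "\<dots> = 0" using gal[OF u] by (simp add: L2_inner_diff_right AL2 w2 g u2)
    finally show ?thesis .
  qed
  have d2: "(\<lambda>s. \<rho> s - v s) \<in> L2 P" "(\<lambda>s. w s - v s) \<in> L2 P"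
    by (intro L2_diff \<rho> w2 v2)+
  have "e = (\<lambda>s. (\<rho> s - v s) - (w s - v s))" by (simp add: e_def fun_eq_iff)
  then have "L2_inner P e (A e) = L2_inner P (\<lambda>s. \<rho> s - v s) (A e)"
    using L2_inner_diff_left[OF d2 AL2[OF e]] orth[OF V(2)[OF wV v]] by simp
  then have "c * (L2_norm P e)\<^sup>2 \<le> C * L2_norm P (\<lambda>s. \<rho> s - v s) * L2_norm P e"
    using coer[OF e] cont[OF d2(1) e] by simp
  then have "L2_norm P e * (c * L2_norm P e) \<le> L2_norm P e * (C * L2_norm P (\<lambda>s. \<rho> s - v s))"
    by (simp add: power2_eq_square mult_ac)
  then have "c * L2_norm P e \<le> C * L2_norm P (\<lambda>s. \<rho> s - v s)"
    using L2_norm_nonneg[of P e] L2_norm_nonneg[of P "\<lambda>s. \<rho> s - v s"] c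
    by (cases "L2_norm P e = 0") (auto simp: mult_le_cancel_left)
  then show ?thesis using c by (simp add: e_def pos_le_divide_eq mult_ac)
qed

section \<open>The regions as a partition of one period\<close>

text \<open>
  The data of the regions that do not depend on \<open>k\<close>. The wavenumber enters the geometry only
  through a number \<open>r < 1\<close>, whose power \<open>r ^ j\<close> stands for \<open>k powr (- 1/3 + \<epsilon> j)\<close>.
\<close>

locale region_partition =
  fixes P t1 t2 \<xi>1 \<xi>2 \<zeta>1 \<zeta>2 :: real and m :: nat
  assumes m: "m \<ge> 1"
    and widths: "\<xi>1 > 0" "\<xi>2 > 0" "\<zeta>1 > 0" "\<zeta>2 > 0"
      "t1 + \<xi>1 < t2 - \<xi>2" "t2 + \<zeta>2 < 2 * P + t1 - \<zeta>1"
begin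

text \<open>
  The end points of the regions in increasing order, over the period that starts at the left
  end of the outermost transition zone of \<open>t1\<close>.
\<close>

definition breakpoint :: "real \<Rightarrow> nat \<Rightarrow> real" where
  "breakpoint r i =
     (if i < m then t1 - \<zeta>1 * r ^ (i + 1)
      else if i < 2 * m then t1 + \<xi>1 * r ^ (2 * m - i)
      else if i < 3 * m then t2 - \<xi>2 * r ^ (i + 1 - 2 * m)
      else if i < 4 * m then t2 + \<zeta>2 * r ^ (4 * m - i)
      else 2 * P + t1 - \<zeta>1 * r)"

text \<open>
  The number of the region between the breakpoints \<open>i\<close> and \<open>i + 1\<close>: the regions are not
  numbered in the order in which they lie on the curve.
\<close>

definition region_index :: "nat \<Rightarrow> nat" where
  "region_index i =
     (if i < m then 2 * m + i + 1
      else if i < 2 * m then (if i = 2 * m - 1 then m else 2 * m - 1 - i)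
      else if i < 3 * m then (if i = 3 * m - 1 then 4 * m else i + 1 - m)
      else (if i = 4 * m - 1 then 2 * m else 7 * m - 1 - i))"

lemma piece_cases:
  assumes "i < 4 * m"
  obtains (a) j where "i = j" "j < m - 1" | (b) "i = m - 1"
    | (c) j where "i = 2 * m - Suc j" "1 \<le> j" "j < m" | (d) "i = 2 * m - 1"
    | (e) j where "i = 2 * m + j" "j < m - 1" | (f) "i = 3 * m - 1"
    | (g) j where "i = 4 * m - Suc j" "1 \<le> j" "j < m" | (h) "i = 4 * m - 1"
proof -
  have "i < m - 1 \<or> i = m - 1 \<or> m \<le> i \<and> i < 2 * m - 1 \<or> i = 2 * m - 1 \<or>
      2 * m \<le> i \<and> i < 3 * m - 1 \<or> i = 3 * m - 1 \<or> 3 * m \<le> i \<and> i < 4 * m - 1 \<or> i = 4 * m - 1"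
    using assms m by linarith
  then show thesis
  proof (elim disjE)
    assume "m \<le> i \<and> i < 2 * m - 1"
    then show thesis using c[of "2 * m - 1 - i"] by linarith
  next
    assume "2 * m \<le> i \<and> i < 3 * m - 1"
    then show thesis using e[of "i - 2 * m"] by linarith
  next
    assume "3 * m \<le> i \<and> i < 4 * m - 1"
    then show thesis using g[of "4 * m - 1 - i"] by linarith
  qed (use a b d f h in auto)
qed

lemma region_index_bij: "bij_betw region_index {..<4 * m} {1..4 * m}"
proof -
  have inj: "inj_on region_index {..<4 * m}"
  proof (rule inj_onI)
    fix i j assume "i \<in> {..<4 * m}" "j \<in> {..<4 * m}" "region_index i = region_index j"
    then show "i = j"
      unfolding region_index_def by (simp split: if_splits)
  qed
  have "region_index ` {..<4 * m} \<subseteq> {1..4 * m}"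
    using m by (auto simp: region_index_def)
  then have "region_index ` {..<4 * m} = {1..4 * m}"
    using inj by (intro card_subset_eq) (auto simp: card_image)
  then show ?thesis using inj by (simp add: bij_betw_def)
qed

lemma breakpoint_simps:
  "j < m \<Longrightarrow> breakpoint r j = t1 - \<zeta>1 * r ^ Suc j"
  "1 \<le> j \<Longrightarrow> j \<le> m \<Longrightarrow> breakpoint r (2 * m - j) = t1 + \<xi>1 * r ^ j"
  "j < m \<Longrightarrow> breakpoint r (2 * m + j) = t2 - \<xi>2 * r ^ Suc j"
  "1 \<le> j \<Longrightarrow> j \<le> m \<Longrightarrow> breakpoint r (4 * m - j) = t2 + \<zeta>2 * r ^ j"
  "breakpoint r (4 * m) = 2 * P + t1 - \<zeta>1 * r"
  using m by (auto simp: breakpoint_def)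

lemma breakpoint_piece:
  assumes "i < 4 * m"
  obtains (a) j where "j < m - 1" "region_index i = 2 * m + Suc j"
      "breakpoint r i = t1 - \<zeta>1 * r ^ Suc j" "breakpoint r (Suc i) = t1 - \<zeta>1 * r ^ Suc (Suc j)"
    | (b) "region_index i = 3 * m"
      "breakpoint r i = t1 - \<zeta>1 * r ^ m" "breakpoint r (Suc i) = t1 + \<xi>1 * r ^ m"
    | (c) j where "1 \<le> j" "j < m" "region_index i = j"
      "breakpoint r i = t1 + \<xi>1 * r ^ Suc j" "breakpoint r (Suc i) = t1 + \<xi>1 * r ^ j"
    | (d) "region_index i = m"
      "breakpoint r i = t1 + \<xi>1 * r" "breakpoint r (Suc i) = t2 - \<xi>2 * r"
    | (e) j where "j < m - 1" "region_index i = m + Suc j"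
      "breakpoint r i = t2 - \<xi>2 * r ^ Suc j" "breakpoint r (Suc i) = t2 - \<xi>2 * r ^ Suc (Suc j)"
    | (f) "region_index i = 4 * m"
      "breakpoint r i = t2 - \<xi>2 * r ^ m" "breakpoint r (Suc i) = t2 + \<zeta>2 * r ^ m"
    | (g) j where "1 \<le> j" "j < m" "region_index i = 3 * m + j"
      "breakpoint r i = t2 + \<zeta>2 * r ^ Suc j" "breakpoint r (Suc i) = t2 + \<zeta>2 * r ^ j"
    | (h) "region_index i = 2 * m"
      "breakpoint r i = t2 + \<zeta>2 * r" "breakpoint r (Suc i) = 2 * P + t1 - \<zeta>1 * r"
  using assms
proof (cases rule: piece_cases)
  case (a j)
  have idx: "Suc i = Suc j" "region_index i = 2 * m + Suc j" using a by (auto simp: region_index_def)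
  have "breakpoint r i = t1 - \<zeta>1 * r ^ Suc j" unfolding a(1) by (rule breakpoint_simps(1)) (use a in simp)
  moreover have "breakpoint r (Suc i) = t1 - \<zeta>1 * r ^ Suc (Suc j)"
    unfolding idx by (rule breakpoint_simps(1)) (use a in simp)
  ultimately show ?thesis using that(1)[OF a(2) idx(2)] by blast
next
  case b
  have idx: "Suc i = 2 * m - m" "region_index i = 3 * m" "Suc i = m" "i < m"
    using b m by (auto simp: region_index_def)
  have "breakpoint r i = t1 - \<zeta>1 * r ^ m"
    using breakpoint_simps(1)[OF idx(4), of r] unfolding idx(3) .
  moreover have "breakpoint r (Suc i) = t1 + \<xi>1 * r ^ m"
    unfolding idx(1) by (rule breakpoint_simps(2)) (use m in simp_all)
  ultimately show ?thesis using that(2)[OF idx(2)] by blast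
next
  case (c j)
  have idx: "Suc i = 2 * m - j" "region_index i = j" using c m by (auto simp: region_index_def)
  have "breakpoint r i = t1 + \<xi>1 * r ^ Suc j" unfolding c(1) by (rule breakpoint_simps(2)) (use c in simp_all)
  moreover have "breakpoint r (Suc i) = t1 + \<xi>1 * r ^ j"
    unfolding idx by (rule breakpoint_simps(2)) (use c in simp_all)
  ultimately show ?thesis using that(3)[OF c(2,3) idx(2)] by blast
next
  case d
  have idx: "Suc i = 2 * m + 0" "region_index i = m" using d m by (auto simp: region_index_def)
  have "breakpoint r i = t1 + \<xi>1 * r ^ 1" unfolding d by (rule breakpoint_simps(2)) (use m in simp_all)
  moreover have "breakpoint r (Suc i) = t2 - \<xi>2 * r ^ Suc 0"
    unfolding idx by (rule breakpoint_simps(3)) (use m in simp)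
  ultimately show ?thesis using that(4)[OF idx(2)] by simp
next
  case (e j)
  have idx: "Suc i = 2 * m + Suc j" "region_index i = m + Suc j" using e m by (auto simp: region_index_def)
  have "breakpoint r i = t2 - \<xi>2 * r ^ Suc j" unfolding e(1) by (rule breakpoint_simps(3)) (use e in simp)
  moreover have "breakpoint r (Suc i) = t2 - \<xi>2 * r ^ Suc (Suc j)"
    unfolding idx by (rule breakpoint_simps(3)) (use e in simp)
  ultimately show ?thesis using that(5)[OF e(2) idx(2)] by blast
next
  case f
  have idx: "Suc i = 4 * m - m" "i = 2 * m + (m - 1)" "region_index i = 4 * m" "Suc (m - 1) = m"
    using f m by (auto simp: region_index_def)
  have "breakpoint r i = t2 - \<xi>2 * r ^ Suc (m - 1)"
    unfolding idx(2) by (rule breakpoint_simps(3)) (use m in simp)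
  then have "breakpoint r i = t2 - \<xi>2 * r ^ m" unfolding idx(4) .
  moreover have "breakpoint r (Suc i) = t2 + \<zeta>2 * r ^ m"
    unfolding idx(1) by (rule breakpoint_simps(4)) (use m in simp_all)
  ultimately show ?thesis using that(6)[OF idx(3)] by blast
next
  case (g j)
  have idx: "Suc i = 4 * m - j" "region_index i = 3 * m + j" using g m by (auto simp: region_index_def)
  have "breakpoint r i = t2 + \<zeta>2 * r ^ Suc j" unfolding g(1) by (rule breakpoint_simps(4)) (use g in simp_all)
  moreover have "breakpoint r (Suc i) = t2 + \<zeta>2 * r ^ j"
    unfolding idx by (rule breakpoint_simps(4)) (use g in simp_all)
  ultimately show ?thesis using that(7)[OF g(2,3) idx(2)] by blast
next
  case h
  have idx: "Suc i = 4 * m" "region_index i = 2 * m" using h m by (auto simp: region_index_def)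
  have "breakpoint r i = t2 + \<zeta>2 * r ^ 1" unfolding h by (rule breakpoint_simps(4)) (use m in simp_all)
  moreover have "breakpoint r (Suc i) = 2 * P + t1 - \<zeta>1 * r"
    unfolding idx by (rule breakpoint_simps(5))
  ultimately show ?thesis using that(8)[OF idx(2)] by simp
qed

lemma region_eq_piece:
  assumes i: "i < 4 * m" and h: "\<And>j. j \<in> {1..m} \<Longrightarrow> k powr (- 1/3 + \<epsilon> j) = r ^ j"
  shows "region P t1 t2 \<xi>1 \<xi>2 \<zeta>1 \<zeta>2 m \<epsilon> k (region_index i) = {breakpoint r i..breakpoint r (Suc i)}"
proof -
  have hj: "k powr (\<epsilon> j - 1/3) = r ^ j" if "1 \<le> j" "j \<le> m" for j using h[of j] that by simp
  then have h1: "k powr (\<epsilon> (Suc 0) - 1/3) = r" "k powr (\<epsilon> m - 1/3) = r ^ m"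
    using m by auto
  from i show ?thesis
  proof (cases rule: breakpoint_piece[of _ r])
    case (a j)
    show ?thesis using a(1) m hj[of "Suc j"] hj[of "Suc (Suc j)"]
      unfolding a(2-) by (simp add: region_def Let_def)
  next
    case b
    show ?thesis using m unfolding b by (simp add: region_def Let_def h1)
  next
    case (c j)
    show ?thesis using c(1,2) m hj[of "Suc j"] hj[of j]
      unfolding c(3-) by (simp add: region_def Let_def)
  next
    case d
    show ?thesis using m unfolding d by (simp add: region_def Let_def h1)
  next
    case (e j)
    show ?thesis using e(1) m hj[of "Suc j"] hj[of "Suc (Suc j)"]
      unfolding e(2-) by (simp add: region_def Let_def)
  next
    case f
    show ?thesis using m unfolding f by (simp add: region_def Let_def h1)
  next
    case (g j)
    show ?thesis using g(1,2) m hj[of "Suc j"] hj[of j]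
      unfolding g(3-) by (simp add: region_def Let_def)
  next
    case h
    show ?thesis using m unfolding h by (simp add: region_def Let_def h1)
  qed
qed

lemma power_r:
  assumes "0 < r" "r < (1::real)"
  shows "r ^ Suc j < r ^ j" "0 < r ^ j" "r ^ j \<le> 1"
  using assms by (auto intro: power_le_one)

lemma breakpoint_less:
  assumes "i < 4 * m" and r: "0 < r" "r < 1"
  shows "breakpoint r i < breakpoint r (Suc i)"
  using assms(1)
proof (cases rule: breakpoint_piece[of _ r])
  case d
  have "\<xi>1 * r \<le> \<xi>1 * 1" "\<xi>2 * r \<le> \<xi>2 * 1" using r widths by (intro mult_left_mono; simp)+
  then show ?thesis unfolding d using widths by linarith
next
  case h
  have "\<zeta>1 * r \<le> \<zeta>1 * 1" "\<zeta>2 * r \<le> \<zeta>2 * 1" using r widths by (intro mult_left_mono; simp)+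
  then show ?thesis unfolding h using widths by linarith
next
  case b
  have "0 < \<zeta>1 * r ^ m" "0 < \<xi>1 * r ^ m" using r widths by auto
  then show ?thesis unfolding b by linarith
next
  case f
  have "0 < \<zeta>2 * r ^ m" "0 < \<xi>2 * r ^ m" using r widths by auto
  then show ?thesis unfolding f by linarith
qed (use power_r[OF r] widths in \<open>simp_all del: power_Suc\<close>)

text \<open>
  A lower bound for the four width parameters and for the lengths that the widest transition
  zones leave free between the two zeros, on either side.
\<close>

definition min_gap :: real where
  "min_gap = Min {\<xi>1, \<xi>2, \<zeta>1, \<zeta>2, t2 - \<xi>2 - (t1 + \<xi>1), 2 * P + t1 - \<zeta>1 - (t2 + \<zeta>2)}"

lemma min_gap_bounds:
  "0 < min_gap" "min_gap \<le> \<xi>1" "min_gap \<le> \<xi>2" "min_gap \<le> \<zeta>1" "min_gap \<le> \<zeta>2"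
  "min_gap \<le> t2 - \<xi>2 - (t1 + \<xi>1)" "min_gap \<le> 2 * P + t1 - \<zeta>1 - (t2 + \<zeta>2)"
proof -
  show "0 < min_gap" unfolding min_gap_def using widths by (subst Min_gr_iff) simp_all
qed (unfold min_gap_def, (rule Min_le; simp)+)

text \<open>
  On an arc between consecutive zeros \<open>A\<close> and \<open>B\<close> there are three kinds of pieces: near \<open>A\<close>,
  in the middle, and near \<open>B\<close>. Adjacent powers of \<open>r\<close> have ratio \<open>1 / r\<close>; all other
  distances are comparable to the length of the arc, apart from the ends of the middle
  piece, which are at distance proportional to \<open>r\<close>.
\<close>

lemma arc_ratio:
  assumes r: "0 < r" "r < 1" and AB: "B - A \<le> 2 * P" and xy: "min_gap \<le> x" "min_gap \<le> y"
      "min_gap \<le> B - A - x - y"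
    and ab: "(\<exists>j. a = A + x * r ^ Suc (Suc j) \<and> b = A + x * r ^ Suc j) \<or> (a = A + x * r \<and> b = B - y * r)
      \<or> (\<exists>j. a = B - y * r ^ Suc j \<and> b = B - y * r ^ Suc (Suc j))"
  shows "A < a" "b < B" "b - A \<le> (1 + 2 * P / min_gap) / r * (a - A)"
    "B - a \<le> (1 + 2 * P / min_gap) / r * (B - b)"
proof -
  define g where "g = min_gap"
  define q where "q = 1 + 2 * P / g"
  have g: "0 < g" "g \<le> x" "g \<le> y" "g \<le> B - A - x - y" using xy min_gap_bounds(1) by (auto simp: g_def)
  have P: "2 * P > 0" using AB g by linarith
  have q: "1 \<le> q" "B - A \<le> q * g"
  proof -
    show "1 \<le> q" using P g by (simp add: q_def)
    have "q * g = g + 2 * P" using g by (simp add: q_def distrib_right)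
    then show "B - A \<le> q * g" using AB g by linarith
  qed
  have r1: "0 < r ^ j" "r ^ j \<le> 1" for j using power_r[OF r] by auto
  have far: "B - A \<le> q / r * c" if "g \<le> c" for c
  proof -
    have "q * g \<le> q / r * c"
      using that r q g by (intro mult_mono) (auto simp: pos_le_divide_eq mult_le_cancel_left1)
    then show ?thesis using q by linarith
  qed
  have near: "B - A \<le> q / r * (c * r)" if "g \<le> c" for c
  proof -
    have "q * g \<le> q * c" using that q by (intro mult_left_mono) auto
    moreover have "q / r * (c * r) = q * c" using r by simp
    ultimately show ?thesis using q(2) by linarith
  qed
  have self: "c * r ^ Suc j \<le> q / r * (c * r ^ Suc (Suc j))" if "0 < c" for c j
  proof -
    have "1 * (c * r ^ Suc j) \<le> q * (c * r ^ Suc j)" using q that r by (intro mult_right_mono) auto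
    then show ?thesis using r by (simp add: mult_ac)
  qed
  have s: "x * r ^ j \<le> x" "y * r ^ j \<le> y" "0 < x * r ^ j" "0 < y * r ^ j" for j
    using g r1[of j] by (auto simp: mult_left_le)
  have s1: "x * r \<le> x" "y * r \<le> y" "0 < x * r" "0 < y * r" using s[of 1] by auto
  from ab have "A < a \<and> b < B \<and> b - A \<le> q / r * (a - A) \<and> B - a \<le> q / r * (B - b)"
  proof (elim disjE exE conjE)
    fix j assume j: "a = A + x * r ^ Suc (Suc j)" "b = A + x * r ^ Suc j"
    have "g \<le> B - b" unfolding j using s(1)[of "Suc j"] g by linarith
    from far[OF this] show ?thesis
      using self[of x j] g s(1,3)[of "Suc j"] s(3)[of "Suc (Suc j)"] \<open>g \<le> B - b\<close> unfolding j
      by (auto simp del: power_Suc)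
  next
    fix j assume j: "a = B - y * r ^ Suc j" "b = B - y * r ^ Suc (Suc j)"
    have "g \<le> a - A" unfolding j using s(2)[of "Suc j"] g by linarith
    from far[OF this] show ?thesis
      using self[of y j] g s(2,4)[of "Suc j"] s(4)[of "Suc (Suc j)"] \<open>g \<le> a - A\<close> unfolding j
      by (auto simp del: power_Suc)
  next
    assume j: "a = A + x * r" "b = B - y * r"
    show ?thesis using near[OF g(2)] near[OF g(3)] s1 g unfolding j by simp
  qed
  then show "A < a" "b < B" "b - A \<le> (1 + 2 * P / min_gap) / r * (a - A)"
    "B - a \<le> (1 + 2 * P / min_gap) / r * (B - b)" by (auto simp: q_def g_def)
qed

text \<open>
  The arc from \<open>t2\<close> to \<open>t1\<close> occurs twice, shifted by one period, since the regions to the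
  left of \<open>t1\<close> are placed next to \<open>t1\<close> and the others next to \<open>t2\<close>. The first alternative
  covers the two pieces that contain a zero.
\<close>

lemma piece_position:
  assumes i: "i < 4 * m" and r: "0 < r" "r < 1" and t: "t1 < t2" "t2 < 2 * P + t1"
  shows "breakpoint r (Suc i) - breakpoint r i \<le> (\<xi>1 + \<xi>2 + \<zeta>1 + \<zeta>2) * r ^ m \<or>
    (\<exists>A B. (A, B) \<in> {(t2 - 2 * P, t1), (t1, t2), (t2, 2 * P + t1)} \<and> B - A \<le> 2 * P \<and>
      A < breakpoint r i \<and> breakpoint r (Suc i) < B \<and>
      breakpoint r (Suc i) - A \<le> (1 + 2 * P / min_gap) / r * (breakpoint r i - A) \<and>
      B - breakpoint r i \<le> (1 + 2 * P / min_gap) / r * (B - breakpoint r (Suc i)))"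
proof -
  let ?a = "breakpoint r i" and ?b = "breakpoint r (Suc i)"
  have arc: ?thesis if AB: "(A, B) \<in> {(t2 - 2 * P, t1), (t1, t2), (t2, 2 * P + t1)}"
      "B - A \<le> 2 * P" "min_gap \<le> x" "min_gap \<le> y" "min_gap \<le> B - A - x - y"
      "(\<exists>j. ?a = A + x * r ^ Suc (Suc j) \<and> ?b = A + x * r ^ Suc j) \<or> (?a = A + x * r \<and> ?b = B - y * r)
        \<or> (\<exists>j. ?a = B - y * r ^ Suc j \<and> ?b = B - y * r ^ Suc (Suc j))" for A B x y
    by (rule disjI2, intro exI[of _ A] exI[of _ B] conjI AB(1,2) arc_ratio[OF r AB(2-6)])
  have left: ?thesis if H: "min_gap \<le> x" "min_gap \<le> y" "min_gap \<le> B - A - x - y"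
      "?a = A + x * r ^ Suc j" "?b = A + x * r ^ j" "1 \<le> j"
      "(A, B) \<in> {(t1, t2), (t2, 2 * P + t1)}" for A B x y j
  proof -
    obtain j' where "j = Suc j'" using H(6) by (cases j) auto
    then have ex: "\<exists>j. ?a = A + x * r ^ Suc (Suc j) \<and> ?b = A + x * r ^ Suc j" using H(4,5) by blast
    have AB: "B - A \<le> 2 * P" "(A, B) \<in> {(t2 - 2 * P, t1), (t1, t2), (t2, 2 * P + t1)}"
      using H(7) t by auto
    show ?thesis by (rule arc[OF AB(2,1) H(1-3) disjI1[OF ex]])
  qed
  have right: ?thesis if H: "min_gap \<le> x" "min_gap \<le> y" "min_gap \<le> B - A - x - y"
      "?a = B - y * r ^ Suc j" "?b = B - y * r ^ Suc (Suc j)"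
      "(A, B) \<in> {(t2 - 2 * P, t1), (t1, t2)}" for A B x y j
  proof -
    have ex: "\<exists>j. ?a = B - y * r ^ Suc j \<and> ?b = B - y * r ^ Suc (Suc j)" using H(4,5) by blast
    have AB: "B - A \<le> 2 * P" "(A, B) \<in> {(t2 - 2 * P, t1), (t1, t2), (t2, 2 * P + t1)}"
      using H(6) t by auto
    show ?thesis by (rule arc[OF AB(2,1) H(1-3) disjI2[OF disjI2[OF ex]]])
  qed
  have middle: ?thesis if H: "min_gap \<le> x" "min_gap \<le> y" "min_gap \<le> B - A - x - y"
      "?a = A + x * r" "?b = B - y * r" "(A, B) \<in> {(t1, t2), (t2, 2 * P + t1)}" for A B x y
  proof -
    have AB: "B - A \<le> 2 * P" "(A, B) \<in> {(t2 - 2 * P, t1), (t1, t2), (t2, 2 * P + t1)}"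
      using H(6) t by auto
    show ?thesis by (rule arc[OF AB(2,1) H(1-3) disjI2[OF disjI1[OF conjI[OF H(4,5)]]]])
  qed
  from i show ?thesis
  proof (cases rule: breakpoint_piece[of _ r])
    case (a j)
    show ?thesis
      by (rule right[of \<zeta>2 \<zeta>1 t1 "t2 - 2 * P" j, OF min_gap_bounds(5,4) _ a(3,4)]) (use min_gap_bounds(7) in auto)
  next
    case b
    have "0 \<le> \<xi>2 * r ^ m" "0 \<le> \<zeta>2 * r ^ m" using widths r by auto
    then show ?thesis unfolding b by (simp add: algebra_simps)
  next
    case (c j)
    show ?thesis
      by (rule left[of \<xi>1 \<xi>2 t2 t1 j, OF min_gap_bounds(2,3) _ c(4,5,1)]) (use min_gap_bounds(6) in auto)
  next
    case d
    show ?thesis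
      by (rule middle[of \<xi>1 \<xi>2 t2 t1, OF min_gap_bounds(2,3) _ d(2,3)]) (use min_gap_bounds(6) in auto)
  next
    case (e j)
    show ?thesis
      by (rule right[of \<xi>1 \<xi>2 t2 t1 j, OF min_gap_bounds(2,3) _ e(3,4)]) (use min_gap_bounds(6) in auto)
  next
    case f
    have "0 \<le> \<xi>1 * r ^ m" "0 \<le> \<zeta>1 * r ^ m" using widths r by auto
    then show ?thesis unfolding f by (simp add: algebra_simps)
  next
    case (g j)
    show ?thesis
      by (rule left[of \<zeta>2 \<zeta>1 "2 * P + t1" t2 j, OF min_gap_bounds(5,4) _ g(4,5,1)]) (use min_gap_bounds(7) in auto)
  next
    case h
    show ?thesis
      by (rule middle[of \<zeta>2 \<zeta>1 "2 * P + t1" t2, OF min_gap_bounds(5,4) _ h(2,3)]) (use min_gap_bounds(7) in auto)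
  qed
qed

end

section \<open>Piecewise polynomials on the curve\<close>

lemma increasing_mono:
  fixes x :: "nat \<Rightarrow> real"
  assumes "\<And>i. i < N \<Longrightarrow> x i < x (Suc i)" "i \<le> j" "j \<le> N"
  shows "x i \<le> x j"
  using assms(2,3)
proof (induction j)
  case (Suc j)
  then show ?case using assms(1)[of j] by (cases "i = Suc j") auto
qed simp

lemma locate_in_partition:
  fixes x :: "nat \<Rightarrow> real"
  assumes "\<And>i. i < N \<Longrightarrow> x i < x (Suc i)" "x 0 < y" "y < x N" "y \<notin> x ` {..N}"
  shows "\<exists>i<N. y \<in> {x i..x (Suc i)} \<and> (\<forall>j<N. y \<in> {x j..x (Suc j)} \<longrightarrow> j = i)"
  using assms
proof (induction N)
  case (Suc N)
  show ?case
  proof (cases "y < x N")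
    case True
    have "\<exists>i<N. y \<in> {x i..x (Suc i)} \<and> (\<forall>j<N. y \<in> {x j..x (Suc j)} \<longrightarrow> j = i)"
      using Suc.prems True by (intro Suc.IH) auto
    then show ?thesis using True by (metis atLeastAtMost_iff less_Suc_eq not_le)
  next
    case False
    have less: "x N < y" using False Suc.prems(4) by (auto simp: not_less le_less)
    have "j = N" if "j < Suc N" "y \<in> {x j..x (Suc j)}" for j
    proof (rule ccontr)
      assume "j \<noteq> N"
      then have "x (Suc j) \<le> x N"
        using that Suc.prems(1) by (intro increasing_mono[of "Suc N"]) auto
      then show False using that less by auto
    qed
    then show ?thesis using less Suc.prems(3) by (intro exI[of _ N]) auto
  qed
qed simp

text \<open>
  Away from the breakpoints exactly one translate of \<open>s\<close> lies in exactly one piece, so the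
  periodized sum reduces to one summand.
\<close>

lemma periodize_partition:
  fixes x :: "nat \<Rightarrow> real"
  assumes T: "T > 0" and x: "\<And>i. i < N \<Longrightarrow> x i < x (Suc i)" "x N = x 0 + T"
    and \<sigma>: "bij_betw \<sigma> {..<N} {1..N}" and S: "\<And>i. i < N \<Longrightarrow> S (\<sigma> i) = {x i..x (Suc i)}"
    and s: "\<And>i l. i \<le> N \<Longrightarrow> s + of_int l * T \<noteq> x i"
  shows "\<exists>i<N. \<exists>l::int. s + of_int l * T \<in> {x i..x (Suc i)} \<and>
    (\<Sum>j=1..N. periodize T (S j) (g j) s) = g (\<sigma> i) (s + of_int l * T)"
proof -
  obtain l where l: "s + of_int l * T \<in> {x 0..<x 0 + T}" using shift_into_period[OF T] by blast
  define y where "y = s + of_int l * T"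
  have y: "x 0 < y" "y < x N" "y \<notin> x ` {..N}"
  proof -
    have "x 0 \<noteq> y" using s[of 0 l] by (simp add: y_def)
    then show "x 0 < y" "y < x N" using l x(2) by (auto simp: y_def)
    show "y \<notin> x ` {..N}" using s[of _ l] by (auto simp: y_def)
  qed
  obtain i where i: "i < N" "y \<in> {x i..x (Suc i)}" "\<And>j. j < N \<Longrightarrow> y \<in> {x j..x (Suc j)} \<Longrightarrow> j = i"
    using locate_in_partition[of N x y] x(1) y by blast
  have only: "l' = l \<and> j = i" if j: "j < N" "s + of_int l' * T \<in> {x j..x (Suc j)}" for j l'
  proof -
    have "x 0 \<le> x j" "x (Suc j) \<le> x N" using j x(1) by (auto intro: increasing_mono[of N])
    then have "x 0 \<le> s + of_int l' * T" "s + of_int l' * T \<le> x 0 + T" using j x(2) by auto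
    moreover have "s + of_int l' * T = y + of_int (l' - l) * T" by (simp add: y_def algebra_simps)
    ultimately have "of_int (l' - l) * T < 1 * T" "(-1) * T < of_int (l' - l) * T"
      using y(1,2) x(2) by linarith+
    then have "(of_int (l' - l) :: real) < 1" "-1 < (of_int (l' - l) :: real)"
      by (simp_all only: mult_less_cancel_right_pos[OF T])
    then have "l' = l" by linarith
    then show ?thesis using i(3) j by (auto simp: y_def)
  qed
  have "(\<Sum>j=1..N. periodize T (S j) (g j) s) = (\<Sum>j<N. periodize T (S (\<sigma> j)) (g (\<sigma> j)) s)"
    by (rule sum.reindex_bij_betw[OF \<sigma>, symmetric])
  also have "\<dots> = (\<Sum>j<N. if j = i then g (\<sigma> i) y else 0)"
  proof (intro sum.cong refl)
    fix j assume "j \<in> {..<N}"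
    then have j: "j < N" by simp
    show "periodize T (S (\<sigma> j)) (g (\<sigma> j)) s = (if j = i then g (\<sigma> i) y else 0)"
    proof (cases "j = i")
      case True
      have "s + of_int l' * T \<in> S (\<sigma> j) \<longleftrightarrow> l' = l" for l'
        using only[OF j, of l'] i(2) True unfolding S[OF j] y_def by blast
      then have "{l'::int. s + of_int l' * T \<in> S (\<sigma> j)} = {l}" by simp
      then show ?thesis using True by (simp add: periodize_def y_def)
    next
      case False
      have empty: "{l'::int. s + of_int l' * T \<in> S (\<sigma> j)} = {}"
        using only[OF j] False unfolding S[OF j] by blast
      show ?thesis unfolding periodize_def empty using False by simp
    qed
  qed
  also have "\<dots> = g (\<sigma> i) y" using i(1) by simp
  finally show ?thesis using i(1,2) by (auto simp: y_def)
qed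

lemma AE_not_breakpoint:
  fixes x :: "nat \<Rightarrow> real"
  shows "AE s in lebesgue_on {0..T}. \<forall>i\<le>N. \<forall>l::int. s + of_int l * T \<noteq> x i"
proof -
  let ?B = "\<Union>i\<in>{..N}. range (\<lambda>l::int. x i - of_int l * T)"
  have "countable ?B" by (intro countable_UN countable_image countable_finite[OF finite_atMost]) auto
  then have "?B \<in> null_sets lebesgue"
    by (intro null_sets_completionI countable_imp_null_set_lborel)
  then have "AE s in lebesgue. s \<notin> ?B" by (rule AE_not_in)
  then have "AE s in lebesgue. s \<in> {0..T} \<longrightarrow> (\<forall>i\<le>N. \<forall>l::int. s + of_int l * T \<noteq> x i)"
  proof eventually_elim
    case (elim s)
    have "s \<in> ?B" if "i \<le> N" "s + of_int l * T = x i" for i and l :: int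
      using that by (intro UN_I[of i] range_eqI[of _ _ l]) auto
    with elim show ?case by blast
  qed
  then show ?thesis by (subst AE_restrict_space_iff) auto
qed

text \<open>The pieces lie within three periods, so five translates suffice on one period.\<close>

lemma shift_range:
  fixes T :: real
  assumes "T > 0" "s \<in> {0..T}" "s + of_int l * T \<in> {- T..2 * T}"
  shows "l \<in> {-2..2::int}"
proof -
  have "(-2) * T \<le> of_int l * T" "of_int l * T \<le> 2 * T"
    using assms(2,3) unfolding atLeastAtMost_iff by linarith+
  then have "(-2::real) \<le> of_int l" "(of_int l::real) \<le> 2"
    using assms(1) by (simp_all only: mult_le_cancel_right_pos[OF assms(1)])
  then show ?thesis by simp
qed

lemma integral_shifted_piece:
  fixes g :: "real \<Rightarrow> real"
  assumes g: "continuous_on {a..b} g" "\<And>s. 0 \<le> g s"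
  shows "integrable (lebesgue_on {0..T}) (\<lambda>s. indicator {a..b} (s + c) * g (s + c))"
    and "(\<integral>s. indicator {a..b} (s + c) * g (s + c) \<partial>lebesgue_on {0..T}) \<le> integral {a..b} g"
proof -
  let ?G = "\<lambda>s. indicator {a..b} s * g s"
  have G: "integrable lborel ?G"
    using borel_integrable_atLeastAtMost'[OF g(1)] by (simp add: set_integrable_def)
  have G': "integrable lborel (\<lambda>s. ?G (c + 1 * s))" using G by (intro lborel_integrable_real_affine) auto
  have meas: "(\<lambda>s. ?G (s + c)) \<in> borel_measurable lborel"
    using borel_measurable_integrable[OF G'] by (simp add: add.commute)
  have G'': "integrable lebesgue (\<lambda>s. ?G (s + c))"
    using integrable_completion[OF meas] G' by (simp add: add.commute)
  show "integrable (lebesgue_on {0..T}) (\<lambda>s. indicator {a..b} (s + c) * g (s + c))"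
    using integrable_restrict_space[of "{0..T}" lebesgue "\<lambda>s. ?G (s + c)"]
      integrable_mult_indicator[OF _ G'', of "{0..T}"] by simp
  have "(\<integral>s. ?G (s + c) \<partial>lebesgue_on {0..T}) = (\<integral>s. indicator {0..T} s *\<^sub>R ?G (s + c) \<partial>lebesgue)"
    by (subst integral_restrict_space) auto
  also have "\<dots> \<le> (\<integral>s. ?G (s + c) \<partial>lebesgue)"
    using g(2) G'' by (intro integral_mono integrable_mult_indicator) (auto simp: indicator_def)
  also have "\<dots> = (\<integral>s. ?G (s + c) \<partial>lborel)"
    by (rule integral_completion[OF meas])
  also have "\<dots> = (\<integral>s. ?G s \<partial>lborel)"
    using lborel_integral_real_affine[of 1 ?G c] by (simp add: add.commute)
  also have "\<dots> = integral {a..b} g"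
    using set_borel_integral_eq_integral(2)[of "{a..b}" g] borel_integrable_atLeastAtMost'[OF g(1)]
    by (simp add: set_lebesgue_integral_def)
  finally show "(\<integral>s. indicator {a..b} (s + c) * g (s + c) \<partial>lebesgue_on {0..T}) \<le> integral {a..b} g" .
qed

text \<open>
  The regions may leave the interval \<open>[0, 2P]\<close>. Instead of cutting them at its ends, each of
  the five relevant translates of each region is integrated in full; this costs the factor
  five.
\<close>

lemma L2_norm_piecewise_le:
  fixes x :: "nat \<Rightarrow> real" and r :: "real \<Rightarrow> complex"
  assumes T: "P > 0" and x: "\<And>i. i < N \<Longrightarrow> x i < x (Suc i)" "x N = x 0 + 2 * P" "x 0 \<in> {- (2 * P)..2 * P}"
    and \<sigma>: "bij_betw \<sigma> {..<N} {1..N}" and S: "\<And>i. i < N \<Longrightarrow> S (\<sigma> i) = {x i..x (Suc i)}"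
    and r: "continuous_on UNIV r" "\<And>s. r (s + 2 * P) = r s"
    and g: "\<And>j. continuous_on UNIV (g j)"
    and e: "\<And>i. i < N \<Longrightarrow> integral {x i..x (Suc i)} (\<lambda>s. (norm (r s - g (\<sigma> i) s))\<^sup>2) \<le> e" 
    and int: "integrable (lebesgue_on {0..2 * P})
      (\<lambda>s. (norm (r s - (\<Sum>j=1..N. periodize (2 * P) (S j) (g j) s)))\<^sup>2)"
  shows "(L2_norm P (\<lambda>s. r s - (\<Sum>j=1..N. periodize (2 * P) (S j) (g j) s)))\<^sup>2 \<le> 5 * real N * e"
proof -
  let ?M = "lebesgue_on {0..2 * P}" and ?T = "2 * P"
  let ?v = "\<lambda>s. r s - (\<Sum>j=1..N. periodize (2 * P) (S j) (g j) s)"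
  let ?q = "\<lambda>i s. (norm (r s - g (\<sigma> i) s))\<^sup>2"
  let ?h = "\<lambda>i l s. indicator {x i..x (Suc i)} (s + of_int l * ?T) * ?q i (s + of_int l * ?T)"
  have cont: "continuous_on A (?q i)" for i A
    by (intro continuous_intros continuous_on_subset[OF r(1)] continuous_on_subset[OF g]) auto
  note piece = integral_shifted_piece[OF cont]
  have "AE s in ?M. (norm (?v s))\<^sup>2 \<le> (\<Sum>i<N. \<Sum>l\<in>{-2..2::int}. ?h i l s)"
    using AE_not_breakpoint[where T = ?T and N = N and x = x] AE_space
  proof eventually_elim
    case (elim s)
    then have s: "s \<in> {0..?T}" by (simp add: space_restrict_space)
    obtain i l where il: "i < N" "s + of_int l * ?T \<in> {x i..x (Suc i)}"
      "(\<Sum>j=1..N. periodize ?T (S j) (g j) s) = g (\<sigma> i) (s + of_int l * ?T)"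
      using periodize_partition[where T = ?T and g = g, OF _ x(1,2) \<sigma> S elim(1)[rule_format]] T by auto
    have "x 0 \<le> x i" "x (Suc i) \<le> x N" using il x(1) by (auto intro: increasing_mono[of N])
    then have l: "l \<in> {-2..2}" using il(2) x(2,3) s T by (intro shift_range[of ?T s]) auto
    have "(norm (?v s))\<^sup>2 = ?h i l s"
      using il periodic_int[of r ?T, OF r(2), of s l] by simp
    also have "\<dots> \<le> (\<Sum>l\<in>{-2..2::int}. ?h i l s)"
      using l by (intro member_le_sum) auto
    also have "\<dots> \<le> (\<Sum>i<N. \<Sum>l\<in>{-2..2::int}. ?h i l s)"
      using il(1) by (intro member_le_sum) (auto intro!: sum_nonneg)
    finally show ?case .
  qed
  then have "(\<integral>s. (norm (?v s))\<^sup>2 \<partial>?M) \<le> (\<integral>s. (\<Sum>i<N. \<Sum>l\<in>{-2..2::int}. ?h i l s) \<partial>?M)"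
    using int by (intro integral_mono_AE Bochner_Integration.integrable_sum piece(1)) auto
  also have "\<dots> = (\<Sum>i<N. \<Sum>l\<in>{-2..2::int}. \<integral>s. ?h i l s \<partial>?M)"
  proof -
    have "(\<integral>s. (\<Sum>i<N. \<Sum>l\<in>{-2..2::int}. ?h i l s) \<partial>?M)
        = (\<Sum>i<N. \<integral>s. (\<Sum>l\<in>{-2..2::int}. ?h i l s) \<partial>?M)"
      by (intro Bochner_Integration.integral_sum Bochner_Integration.integrable_sum piece(1)) auto
    also have "\<dots> = (\<Sum>i<N. \<Sum>l\<in>{-2..2::int}. \<integral>s. ?h i l s \<partial>?M)"
      by (intro sum.cong refl Bochner_Integration.integral_sum piece(1)) auto
    finally show ?thesis .
  qed
  also have "\<dots> \<le> (\<Sum>i<N. \<Sum>l\<in>{-2..2::int}. e)"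
    using e by (intro sum_mono) (auto intro: order.trans[OF piece(2)])
  also have "\<dots> = 5 * real N * e" by simp
  finally show ?thesis by (simp add: L2_norm_def integral_nonneg_AE)
qed

lemma L2_cong: "\<phi> \<in> L2 P \<Longrightarrow> (\<And>s. s \<in> {0..2 * P} \<Longrightarrow> \<phi> s = \<psi> s) \<Longrightarrow> \<psi> \<in> L2 P"
  unfolding L2_def
  by (auto simp: space_restrict_space cong: measurable_cong Bochner_Integration.integrable_cong
      intro!: measurable_cong[THEN iffD1, of "lebesgue_on {0..2 * P}" \<phi> \<psi>]
        Bochner_Integration.integrable_cong[THEN iffD1, of "lebesgue_on {0..2 * P}" _ "\<lambda>s. (norm (\<phi> s))\<^sup>2" "\<lambda>s. (norm (\<psi> s))\<^sup>2"])

lemma L2_sum: "finite I \<Longrightarrow> (\<And>i. i \<in> I \<Longrightarrow> \<phi> i \<in> L2 P) \<Longrightarrow> (\<lambda>s. \<Sum>i\<in>I. \<phi> i s) \<in> L2 P"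
  by (induction I rule: finite_induct) (auto intro: L2_add L2_of_continuous)

lemma L2_shifted_piece:
  assumes "continuous_on UNIV c" "continuous_on UNIV g"
  shows "(\<lambda>s. if s + d \<in> {a..b::real} then c s * g (s + d) else 0) \<in> L2 P"
proof -
  let ?f = "\<lambda>s. c s * g (s + d)"
  have cont: "continuous_on UNIV ?f"
    by (intro continuous_intros assms continuous_on_compose2[OF assms(2)]) auto
  have "bounded (?f ` {0..2 * P})"
    by (intro compact_imp_bounded compact_continuous_image continuous_on_subset[OF cont]) auto
  then obtain C where C: "\<forall>s\<in>{0..2 * P}. norm (?f s) \<le> C" by (auto simp: bounded_iff)
  show ?thesis
  proof (rule L2_of_bounded)
    have "(\<lambda>s. indicator {a - d..b - d} s *\<^sub>R ?f s) \<in> borel_measurable borel"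
      using borel_measurable_continuous_onI[OF cont]
      by (intro borel_measurable_scaleR borel_measurable_indicator) auto
    also have "(\<lambda>s. indicator {a - d..b - d} s *\<^sub>R ?f s) = (\<lambda>s. if s + d \<in> {a..b} then ?f s else 0)"
      by (auto simp: fun_eq_iff indicator_def)
    finally show "(\<lambda>s. if s + d \<in> {a..b} then ?f s else 0) \<in> borel_measurable (lebesgue_on {0..2 * P})"
      by (intro measurable_restrict_space1 measurable_completion) simp
    show "norm (if s + d \<in> {a..b} then ?f s else 0) \<le> \<bar>C\<bar>" if "s \<in> {0..2 * P}" for s
      using C that by (auto intro: order.trans[OF _ abs_ge_self])
  qed
qed

lemma periodize_eq_finite_sum:
  assumes "P > 0" "s \<in> {0..2 * P}" "S \<subseteq> {- (2 * P)..2 * (2 * P)}"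
  shows "periodize (2 * P) S g s =
    (\<Sum>l\<in>{-2..2::int}. if s + of_int l * (2 * P) \<in> S then g (s + of_int l * (2 * P)) else 0)"
proof -
  have "{l::int. s + of_int l * (2 * P) \<in> S} = {l\<in>{-2..2}. s + of_int l * (2 * P) \<in> S}"
    using shift_range[of "2 * P" s] assms by auto
  then have "periodize (2 * P) S g s = (\<Sum>l\<in>{l\<in>{-2..2}. s + of_int l * (2 * P) \<in> S}. g (s + of_int l * (2 * P)))"
    unfolding periodize_def by (simp only:)
  also have "\<dots> = (\<Sum>l\<in>{-2..2::int}. if s + of_int l * (2 * P) \<in> S then g (s + of_int l * (2 * P)) else 0)"
    by (rule sum.inter_filter) simp
  finally show ?thesis .
qed

lemma galerkin_space_L2:
  assumes P: "P > 0" and c: "continuous_on UNIV (\<lambda>s. plane_wave \<alpha> k (\<gamma> s))"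
    and S: "\<And>j. j \<in> {1..N} \<Longrightarrow> \<exists>a b. S j = {a..b} \<and> S j \<subseteq> {- (2 * P)..2 * (2 * P)}"
  shows "galerkin_space P \<gamma> \<alpha> k N S d \<subseteq> L2 P"
proof
  fix v assume "v \<in> galerkin_space P \<gamma> \<alpha> k N S d"
  then obtain p :: "nat \<Rightarrow> complex poly" where v: "v = (\<lambda>s. plane_wave \<alpha> k (\<gamma> s) *
            (\<Sum>j=1..N. periodize (2 * P) (S j) (\<lambda>t. poly (p j) (of_real t)) s))"
    by (auto simp: galerkin_space_def)
  let ?w = "\<lambda>j l s. if s + of_int l * (2 * P) \<in> S j
    then plane_wave \<alpha> k (\<gamma> s) * poly (p j) (of_real (s + of_int l * (2 * P))) else 0"
  have "?w j l \<in> L2 P" if j: "j \<in> {1..N}" for j l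
  proof -
    obtain a b where ab: "S j = {a..b}" using S[OF j] by blast
    show ?thesis unfolding ab
      by (rule L2_shifted_piece[of _ "\<lambda>t. poly (p j) (of_real t)"]) (intro c continuous_intros)+
  qed
  then have "(\<lambda>s. \<Sum>j=1..N. \<Sum>l\<in>{-2..2::int}. ?w j l s) \<in> L2 P"
    by (intro L2_sum) auto
  then show "v \<in> L2 P"
  proof (rule L2_cong)
    fix s assume s: "s \<in> {0..2 * P}"
    show "(\<Sum>j=1..N. \<Sum>l\<in>{-2..2::int}. ?w j l s) = v s"
      unfolding v sum_distrib_left
    proof (rule sum.cong[OF refl])
      fix j assume "j \<in> {1..N}"
      then have "periodize (2 * P) (S j) (\<lambda>t. poly (p j) (of_real t)) s = (\<Sum>l\<in>{-2..2::int}.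
        if s + of_int l * (2 * P) \<in> S j then poly (p j) (of_real (s + of_int l * (2 * P))) else 0)"
        using S P s by (intro periodize_eq_finite_sum) auto
      then show "(\<Sum>l\<in>{-2..2::int}. ?w j l s) =
          plane_wave \<alpha> k (\<gamma> s) * periodize (2 * P) (S j) (\<lambda>t. poly (p j) (of_real t)) s"
        by (simp only: sum_distrib_left) (intro sum.cong refl, auto)
    qed
  qed
qed

lemma galerkin_space_diff:
  assumes "v \<in> galerkin_space P \<gamma> \<alpha> k N S d" "w \<in> galerkin_space P \<gamma> \<alpha> k N S d"
  shows "(\<lambda>s. v s - w s) \<in> galerkin_space P \<gamma> \<alpha> k N S d"
proof -
  obtain p q :: "nat \<Rightarrow> complex poly" where
    v: "v = (\<lambda>s. plane_wave \<alpha> k (\<gamma> s) * (\<Sum>j=1..N. periodize (2 * P) (S j) (\<lambda>t. poly (p j) (of_real t)) s))"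
    and p: "\<forall>j\<in>{1..N}. degree (p j) \<le> d j" and
    w: "w = (\<lambda>s. plane_wave \<alpha> k (\<gamma> s) * (\<Sum>j=1..N. periodize (2 * P) (S j) (\<lambda>t. poly (q j) (of_real t)) s))"
    and q: "\<forall>j\<in>{1..N}. degree (q j) \<le> d j"
    using assms by (auto simp: galerkin_space_def)
  have "(\<lambda>s. v s - w s) = (\<lambda>s. plane_wave \<alpha> k (\<gamma> s) *
      (\<Sum>j=1..N. periodize (2 * P) (S j) (\<lambda>t. poly (p j - q j) (of_real t)) s))"
    unfolding v w by (simp add: periodize_def sum_subtractf right_diff_distrib)
  moreover have "\<forall>j\<in>{1..N}. degree (p j - q j) \<le> d j" using p q by (auto intro: degree_diff_le)
  ultimately show ?thesis
    unfolding galerkin_space_def by (intro CollectI exI[of _ "\<lambda>j. p j - q j"] conjI)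
qed

section \<open>The error estimate\<close>

text \<open>A constant factor in the ratio of distances only costs a constant.\<close>

lemma growth_scale:
  assumes "1 \<le> c" "1 \<le> q"
  shows "growth n (c * q) \<le> c ^ n * (1 + growth n q)"
proof -
  consider "n = 0" | "n = 1" | "n \<ge> 2" by linarith
  then show ?thesis
  proof cases
    case 2
    have "ln c \<le> c * 1" using assms ln_le_minus_one[of c] by simp
    moreover have "1 * ln q \<le> c * ln q" using assms by (intro mult_right_mono) auto
    ultimately show ?thesis using 2 assms by (simp add: growth_def ln_mult distrib_left)
  next
    case 3
    have "(c * q) ^ (n - 1) \<le> c ^ n * q ^ (n - 1)"
      unfolding power_mult_distrib using assms by (intro mult_right_mono power_increasing) auto
    also have "\<dots> \<le> c ^ n * (1 + q ^ (n - 1))" using assms by (intro mult_left_mono) auto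
    finally show ?thesis using 3 by (simp add: growth_def)
  qed (simp add: growth_def)
qed

text \<open>
  With \<open>w\<^sup>2 = \<kappa> ^ (2 * m + 1)\<close> and length \<open>1 / \<kappa> ^ m\<close>, the unweighted bound \<open>w ^ (2 * n)\<close>
  times the length to the power \<open>2n + 1\<close> is \<open>\<kappa> ^ n / \<kappa> ^ m\<close>, which is at most \<open>\<kappa> ^ n / \<kappa>\<close>
  because \<open>m \<ge> 1\<close>.
\<close>

lemma transition_growth:
  fixes \<kappa> :: real
  assumes \<kappa>: "1 < \<kappa>" and m: "1 \<le> m"
  shows "\<kappa> ^ ((2 * m + 1) * n) * ((1 / \<kappa>) ^ m) ^ (2 * n + 1) \<le> 1 + growth n \<kappa>"
proof -
  have e: "(2 * m + 1) * n = n + m * (2 * n)" "m * (2 * n + 1) = m * (2 * n) + m"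
    by (simp_all add: algebra_simps)
  have "\<kappa> ^ ((2 * m + 1) * n) * ((1 / \<kappa>) ^ m) ^ (2 * n + 1)
      = \<kappa> ^ n * (1 / \<kappa>) ^ m * (\<kappa> ^ (m * (2 * n)) * (1 / \<kappa>) ^ (m * (2 * n)))"
    unfolding power_mult[symmetric] e power_add by (simp only: mult_ac mult_1_left)
  also have "\<kappa> ^ (m * (2 * n)) * (1 / \<kappa>) ^ (m * (2 * n)) = 1"
    using \<kappa> by (simp flip: power_mult_distrib)
  also have "\<kappa> ^ n * (1 / \<kappa>) ^ m * 1 \<le> \<kappa> ^ n * (1 / \<kappa>) ^ 1"
    unfolding mult_1_right using \<kappa> m by (intro mult_left_mono power_decreasing) auto
  also have "\<dots> \<le> 1 + growth n \<kappa>"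
  proof (cases n)
    case 0
    then show ?thesis using \<kappa> by (simp add: growth_def pos_divide_le_eq)
  next
    case (Suc j)
    have "\<kappa> ^ n * (1 / \<kappa>) ^ 1 = \<kappa> ^ j" using \<kappa> Suc by simp
    then show ?thesis using Suc \<kappa> growth_nonneg[of \<kappa> n] by (cases j) (auto simp: growth_def)
  qed
  finally show ?thesis .
qed

context region_partition
begin

text \<open>
  The first summand comes from the pieces between the zeros, the second from the pieces that
  contain a zero.
\<close>

definition weight_constant :: "real \<Rightarrow> nat \<Rightarrow> real" where
  "weight_constant c n = 2 * 4 ^ n * (1 / c) ^ (2 * n) * (2 * P) * (1 + 2 * P / min_gap) ^ n
     + (\<xi>1 + \<xi>2 + \<zeta>1 + \<zeta>2) ^ (2 * n + 1)"

text \<open>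
  Pieces between two zeros use the bound of \<open>W\<close> by inverse distances, pieces that contain a
  zero use \<open>W \<le> w\<close>; the choice of \<open>\<kappa>\<close> balances the two.
\<close>

lemma integral_over_piece:
  assumes i: "i < 4 * m" and t: "t1 < t2" "t2 < 2 * P + t1" and P: "P > 0" and \<kappa>: "1 < \<kappa>" and c: "c > 0"
    and W: "\<And>A B s. (A, B) \<in> {(t2 - 2 * P, t1), (t1, t2), (t2, 2 * P + t1)} \<Longrightarrow> A < s \<Longrightarrow> s < B \<Longrightarrow>
        W s \<le> 1 / c * (1 / (s - A) + 1 / (B - s))"
      "\<And>s. 0 \<le> W s" "\<And>s. W s \<le> w" "w\<^sup>2 = \<kappa> ^ (2 * m + 1)"
    and G: "continuous_on UNIV G" "\<And>s. 0 \<le> G s" "\<And>s. G s \<le> M * W s ^ (2 * n)" and M: "0 \<le> M"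
    and ab: "a = breakpoint (1 / \<kappa>) i" "b = breakpoint (1 / \<kappa>) (Suc i)"
  shows "integral {a..b} (\<lambda>s. G s * ((s - a) * (b - s)) ^ n) \<le> M * weight_constant c n * (1 + growth n \<kappa>)"
proof -
  let ?r = "1 / \<kappa>" and ?q = "1 + 2 * P / min_gap"
  let ?arc = "2 * 4 ^ n * (1 / c) ^ (2 * n) * (2 * P) * ?q ^ n"
    and ?tr = "(\<xi>1 + \<xi>2 + \<zeta>1 + \<zeta>2) ^ (2 * n + 1)"
  have r: "0 < ?r" "?r < 1" using \<kappa> by auto
  have q: "1 \<le> ?q" using P min_gap_bounds(1) by simp
  have g0: "0 \<le> growth n \<kappa>" using \<kappa> by (intro growth_nonneg) simp
  have less: "a < b" using breakpoint_less[OF i r] ab by simp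
  have arc0: "0 \<le> ?arc" using P q c by (intro mult_nonneg_nonneg) auto
  have tr0: "0 \<le> ?tr" using widths by (intro zero_le_power) auto
  have Gab: "continuous_on {a..b} G" using G(1) continuous_on_subset by blast
  from piece_position[OF i r t]
  consider "b - a \<le> (\<xi>1 + \<xi>2 + \<zeta>1 + \<zeta>2) * ?r ^ m"
    | A B where "(A, B) \<in> {(t2 - 2 * P, t1), (t1, t2), (t2, 2 * P + t1)}" "B - A \<le> 2 * P"
      "A < a" "b < B" "b - A \<le> ?q / ?r * (a - A)" "B - a \<le> ?q / ?r * (B - b)"
    unfolding ab by blast
  then show ?thesis
  proof cases
    case 1
    have "integral {a..b} (\<lambda>s. G s * ((s - a) * (b - s)) ^ n) \<le> M * w ^ (2 * n) * (b - a) ^ (2 * n + 1)"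
    proof (rule integral_weighted_bounded[OF less Gab])
      fix s
      have "W s ^ (2 * n) \<le> w ^ (2 * n)" using W(2,3) by (intro power_mono)
      then have "M * W s ^ (2 * n) \<le> M * w ^ (2 * n)" using M by (intro mult_left_mono)
      then show "0 \<le> G s \<and> G s \<le> M * w ^ (2 * n)" using G(2,3)[of s] by linarith
    qed
    also have "\<dots> \<le> M * w ^ (2 * n) * ((\<xi>1 + \<xi>2 + \<zeta>1 + \<zeta>2) * ?r ^ m) ^ (2 * n + 1)"
      using 1 less M by (intro mult_left_mono power_mono mult_nonneg_nonneg) auto
    also have "\<dots> = M * (?tr * (\<kappa> ^ ((2 * m + 1) * n) * (?r ^ m) ^ (2 * n + 1)))"
      using W(4) unfolding power_mult[of w 2 n] power_mult[of \<kappa> "2 * m + 1" n] power_mult_distrib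
      by (simp only: mult_ac)
    also have "\<dots> \<le> M * (?tr * (1 + growth n \<kappa>))"
      using transition_growth[OF \<kappa> m] tr0 M by (intro mult_left_mono)
    also have "\<dots> \<le> M * weight_constant c n * (1 + growth n \<kappa>)"
      unfolding weight_constant_def mult.assoc[of M]
      using arc0 M g0 by (intro mult_left_mono mult_right_mono) auto
    finally show ?thesis .
  next
    case (2 A B)
    have "integral {a..b} (\<lambda>s. G s * ((s - a) * (b - s)) ^ n)
        \<le> 2 * 4 ^ n * (M * (1 / c) ^ (2 * n)) * (2 * P) * growth n (?q * \<kappa>)"
    proof (rule integral_weighted_two_sided[OF 2(3) less 2(4,2) _ _ Gab])
      show "b - A \<le> ?q * \<kappa> * (a - A)" "B - a \<le> ?q * \<kappa> * (B - b)" using 2(5,6) by simp_all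
      show "0 \<le> M * (1 / c) ^ (2 * n)" using M c by auto
      fix s assume s: "s \<in> {a..b}"
      have "W s ^ (2 * n) \<le> (1 / c * (1 / (s - A) + 1 / (B - s))) ^ (2 * n)"
        using s 2 W by (intro power_mono) auto
      then have "M * W s ^ (2 * n) \<le> M * (1 / c * (1 / (s - A) + 1 / (B - s))) ^ (2 * n)"
        using M by (intro mult_left_mono)
      also have "\<dots> = M * (1 / c) ^ (2 * n) * (1 / (s - A) + 1 / (B - s)) ^ (2 * n)"
        unfolding power_mult_distrib by simp
      finally show "0 \<le> G s \<and> G s \<le> M * (1 / c) ^ (2 * n) * (1 / (s - A) + 1 / (B - s)) ^ (2 * n)"
        using G(2,3)[of s] by linarith
    qed
    also have "\<dots> \<le> 2 * 4 ^ n * (M * (1 / c) ^ (2 * n)) * (2 * P) * (?q ^ n * (1 + growth n \<kappa>))"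
      using growth_scale[of ?q \<kappa> n] q \<kappa> M P c by (intro mult_left_mono mult_nonneg_nonneg) auto
    also have "\<dots> = M * ?arc * (1 + growth n \<kappa>)" by (simp only: mult_ac)
    also have "\<dots> \<le> M * weight_constant c n * (1 + growth n \<kappa>)"
      unfolding weight_constant_def
      using tr0 M g0 by (intro mult_left_mono mult_right_mono) auto
    finally show ?thesis .
  qed
qed

lemma weight_constant_nonneg: "P > 0 \<Longrightarrow> c > 0 \<Longrightarrow> 0 \<le> weight_constant c n"
  unfolding weight_constant_def using widths min_gap_bounds(1)
  by (intro add_nonneg_nonneg mult_nonneg_nonneg zero_le_power) auto

end

text \<open>
  The purpose of the choice of \<open>\<epsilon>\<close>: the widths become a geometric sequence.
\<close>

lemma region_width_exponent:
  assumes "m \<ge> 1" "k > 0" "j \<in> {1..m}"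
    and "\<epsilon> j = 1/3 * ((2 * real m - 2 * real j + 1) / (2 * real m + 1))"
  shows "k powr (- 1/3 + \<epsilon> j) = (1 / k powr (2 / (6 * real m + 3))) ^ j"
proof -
  have "2 * real m + 1 \<noteq> 0" by (simp add: add_nonneg_pos)
  then have "- 1/3 + \<epsilon> j = - (2 / (3 * (2 * real m + 1))) * real j"
    unfolding assms(4) by (simp add: divide_simps)
  also have "3 * (2 * real m + 1) = 6 * real m + 3" by simp
  finally have "k powr (- 1/3 + \<epsilon> j) = (k powr (- (2 / (6 * real m + 3)))) ^ j"
    using assms(2) by (simp add: powr_powr flip: powr_realpow)
  then show ?thesis by (simp add: powr_minus_divide)
qed

text \<open>
  Only the arcs from \<open>t1\<close> to \<open>t2\<close> and from \<open>t2\<close> to \<open>2 * P + t1\<close> need the bounds for simple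
  zeros; the remaining one is a translate of the latter by a period of \<open>Z\<close>.
\<close>

lemma concentration_arcs:
  assumes shadow: "0 < t1" "t1 < t2" "t2 < 2 * P"
    and expansion: "asymptotic_expansion P t1 t2 a b Z \<Psi> c'"
  shows "\<exists>c>0. \<forall>k A B s. (A, B) \<in> {(t2 - 2 * P, t1), (t1, t2), (t2, 2 * P + t1)} \<longrightarrow> A < s \<longrightarrow> s < B \<longrightarrow>
        concentration Z k s \<le> 1 / c * (1 / (s - A) + 1 / (B - s))"
proof -
  have Z: "periodic_smooth (2 * P) Z" "\<And>s. s \<in> {t1<..<t2} \<Longrightarrow> Z s > 0"
    "\<And>s. s \<in> {0..<t1} \<union> {t2<..2 * P} \<Longrightarrow> Z s < 0" "\<And>s. s \<in> {t1, t2} \<Longrightarrow> Z s = 0"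
    "\<And>s. s \<in> {t1, t2} \<Longrightarrow> vector_derivative Z (at s) \<noteq> 0"
    using expansion unfolding asymptotic_expansion_def by auto
  have smooth: "C_infinity_on UNIV Z" and per: "\<And>s. Z (s + 2 * P) = Z s"
    using Z(1) by (auto simp: periodic_smooth_def)
  have cont: "continuous_on A Z" for A
    using C_infinity_continuous_on[OF smooth] continuous_on_subset by blast
  have vd: "(Z has_vector_derivative vector_derivative Z (at s)) (at s)" for s
    by (rule C_infinity_has_vector_derivative(1)[OF smooth])
  then have D: "(Z has_real_derivative vector_derivative Z (at s)) (at s)" for s
    by (simp add: has_real_derivative_iff_has_vector_derivative)
  have D': "vector_derivative Z (at (2 * P + t1)) \<noteq> 0"
    using periodic_vector_derivative[of Z "\<lambda>s. vector_derivative Z (at s)" "2 * P" t1, OF vd per] Z(5)[of t1]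
    by (simp add: add.commute)
  have nz: "Z s \<noteq> 0" if "t2 < s" "s < 2 * P + t1" for s
    using Z(3)[of s] Z(3)[of "s - 2 * P"] per[of "s - 2 * P"] that shadow by (cases "s \<le> 2 * P") auto
  obtain c1 where c1: "c1 > 0" "\<And>s. s \<in> {t1..t2} \<Longrightarrow> c1 * min (s - t1) (t2 - s) \<le> \<bar>Z s\<bar>"
    using simple_zeros_lower_bound[OF shadow(2) cont _ D _ _ D] Z(2,4,5) by (metis greaterThanLessThan_iff insertI1 insertI2 less_irrefl)
  have "\<exists>c>0. \<forall>s\<in>{t2..2 * P + t1}. c * min (s - t2) (2 * P + t1 - s) \<le> \<bar>Z s\<bar>"
    using Z(4)[of t1] Z(4)[of t2] Z(5)[of t2] D' per[of t1] shadow
    by (intro simple_zeros_lower_bound[OF _ cont nz D _ _ D]) (auto simp: add.commute)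
  then obtain c2 where c2: "c2 > 0" "\<And>s. s \<in> {t2..2 * P + t1} \<Longrightarrow> c2 * min (s - t2) (2 * P + t1 - s) \<le> \<bar>Z s\<bar>"
    by blast
  define c where "c = min c1 c2"
  have c: "c > 0" "c \<le> c1" "c \<le> c2" using c1 c2 by (auto simp: c_def)
  have lower: "c * min (s - A) (B - s) \<le> \<bar>Z s\<bar>"
    if AB: "(A, B) \<in> {(t1, t2), (t2, 2 * P + t1)}" and s: "A < s" "s < B" for A B s
  proof -
    have "c * min (s - A) (B - s) \<le> c1 * min (s - A) (B - s)" "c * min (s - A) (B - s) \<le> c2 * min (s - A) (B - s)"
      using c s by (intro mult_right_mono; simp)+
    then show ?thesis using order.trans[OF _ c1(2)[of s]] order.trans[OF _ c2(2)[of s]] AB s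
      by (cases "A = t1") auto
  qed
  have "concentration Z k s \<le> 1 / c * (1 / (s - A) + 1 / (B - s))"
    if AB: "(A, B) \<in> {(t2 - 2 * P, t1), (t1, t2), (t2, 2 * P + t1)}" and s: "A < s" "s < B" for k A B s
  proof (cases "(A, B) \<in> {(t1, t2), (t2, 2 * P + t1)}")
    case True
    then show ?thesis using lower[OF True s] c s by (intro concentration_le_arc)
  next
    case False
    then have eq: "A = t2 - 2 * P" "B = t1" using AB by auto
    have "concentration Z k (s + 2 * P) \<le> 1 / c * (1 / (s + 2 * P - t2) + 1 / (2 * P + t1 - (s + 2 * P)))"
      using lower[of t2 "2 * P + t1" "s + 2 * P"] c s eq by (intro concentration_le_arc) auto
    moreover have "concentration Z k (s + 2 * P) = concentration Z k s"
      by (simp add: concentration_def per)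
    moreover have "s + 2 * P - t2 = s - A" "2 * P + t1 - (s + 2 * P) = B - s" using eq by simp_all
    ultimately show ?thesis by simp
  qed
  then show ?thesis using c(1) by blast
qed

text \<open>
  The weighted estimates bound squared norms; this extracts the root in the form stated in
  the theorem.
\<close>

lemma growth_le_square:
  assumes k: "k > 1" and Q: "Q = 1 + of_bool (n = 1) * sqrt (ln k)
        + of_bool (n \<ge> 2) * (k powr (1 / (6 * real m + 3))) ^ (n - 1)"
  shows "1 + growth n (k powr (2 / (6 * real m + 3))) \<le> 2 * Q\<^sup>2" "1 \<le> Q"
proof -
  let ?x = "k powr (1 / (6 * real m + 3))"
  show Q1: "1 \<le> Q" using k by (auto simp: Q)
  have "growth n (k powr (2 / (6 * real m + 3))) \<le> Q\<^sup>2"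
  proof -
    consider "n = 0" | "n = 1" | "n \<ge> 2" by linarith
    then show ?thesis
    proof cases
      case 1
      then show ?thesis by (simp add: growth_def Q)
    next
      case 2
      have "ln (k powr (2 / (6 * real m + 3))) = 2 / (6 * real m + 3) * ln k" using k by (simp add: ln_powr)
      also have "\<dots> \<le> 1 * ln k" using k by (intro mult_right_mono) auto
      also have "\<dots> = (sqrt (ln k))\<^sup>2" using k by simp
      also have "\<dots> \<le> Q\<^sup>2" using 2 k by (intro power_mono) (auto simp: Q)
      finally show ?thesis using 2 by (simp add: growth_def)
    next
      case 3
      have "k powr (2 / (6 * real m + 3)) = ?x\<^sup>2"
        using k by (simp add: powr_powr flip: powr_realpow)
      then have "(k powr (2 / (6 * real m + 3))) ^ (n - 1) = (?x ^ (n - 1))\<^sup>2"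
        by (simp flip: power_mult add: mult.commute)
      also have "\<dots> \<le> Q\<^sup>2" using 3 k by (intro power_mono) (auto simp: Q)
      finally show ?thesis using 3 by (simp add: growth_def)
    qed
  qed
  moreover have "1 \<le> Q\<^sup>2" using Q1 by simp
  ultimately show "1 + growth n (k powr (2 / (6 * real m + 3))) \<le> 2 * Q\<^sup>2" by linarith
qed

context region_partition
begin

text \<open>
  The weighted approximation theorem with the derivative bound \<open>M * W ^ n\<close> inserted; the
  additive slack of that theorem is chosen to be of the size of the main term.
\<close>

lemma approximation_in_pieces:
  fixes F :: "nat \<Rightarrow> real \<Rightarrow> complex"
  assumes t: "t1 < t2" "t2 < 2 * P + t1" and P: "P > 0" and \<kappa>: "1 < \<kappa>" and c: "c > 0"
    and W: "\<And>A B s. (A, B) \<in> {(t2 - 2 * P, t1), (t1, t2), (t2, 2 * P + t1)} \<Longrightarrow> A < s \<Longrightarrow> s < B \<Longrightarrow>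
        W s \<le> 1 / c * (1 / (s - A) + 1 / (B - s))"
      "\<And>s. 0 \<le> W s" "\<And>s. W s \<le> w" "w\<^sup>2 = \<kappa> ^ (2 * m + 1)"
    and F: "\<And>i s. i < n \<Longrightarrow> (F i has_vector_derivative F (Suc i) s) (at s)"
      "continuous_on UNIV (F n)" "\<And>s. norm (F n s) \<le> M * W s ^ n" and M: "0 < M"
    and d: "1 \<le> d" "n \<le> Suc d" and i: "i < 4 * m"
  shows "\<exists>p. degree p \<le> d \<and>
    integral {breakpoint (1 / \<kappa>) i..breakpoint (1 / \<kappa>) (Suc i)} (\<lambda>s. (norm (F 0 s - poly p (of_real s)))\<^sup>2)
      \<le> (4 * real n ^ n * weight_constant c n + 1) * M\<^sup>2 * (1 + growth n \<kappa>) / (real d ^ n)\<^sup>2"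
proof -
  let ?a = "breakpoint (1 / \<kappa>) i" and ?b = "breakpoint (1 / \<kappa>) (Suc i)"
  have less: "?a < ?b" using \<kappa> by (intro breakpoint_less[OF i]) auto
  have g0: "0 \<le> growth n \<kappa>" using \<kappa> by (intro growth_nonneg) simp
  have e: "0 < M\<^sup>2 * (1 + growth n \<kappa>)" using M g0 by (intro mult_pos_pos) auto
  have "\<exists>p. degree p \<le> d \<and>
    real d ^ (2 * n) * integral {?a..?b} (\<lambda>x. (norm (F 0 x - poly p (of_real x)))\<^sup>2)
      \<le> 4 * real n ^ n * integral {?a..?b} (\<lambda>x. (norm (F n x))\<^sup>2 * ((x - ?a) * (?b - x)) ^ n)
        + M\<^sup>2 * (1 + growth n \<kappa>)"
    using F(1,2) by (intro weighted_approx[OF less d _ _ e])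
      (auto intro: has_vector_derivative_at_within continuous_on_subset)
  then obtain p where p: "degree p \<le> d"
    "real d ^ (2 * n) * integral {?a..?b} (\<lambda>x. (norm (F 0 x - poly p (of_real x)))\<^sup>2)
      \<le> 4 * real n ^ n * integral {?a..?b} (\<lambda>x. (norm (F n x))\<^sup>2 * ((x - ?a) * (?b - x)) ^ n)
        + M\<^sup>2 * (1 + growth n \<kappa>)"
    by blast
  have "integral {?a..?b} (\<lambda>x. (norm (F n x))\<^sup>2 * ((x - ?a) * (?b - x)) ^ n)
      \<le> M\<^sup>2 * weight_constant c n * (1 + growth n \<kappa>)"
  proof (rule integral_over_piece[where W = W and w = w, OF i t P \<kappa> c W])
    show "continuous_on UNIV (\<lambda>x. (norm (F n x))\<^sup>2)" by (intro continuous_intros F(2))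
    fix s
    have "(norm (F n s))\<^sup>2 \<le> (M * W s ^ n)\<^sup>2" using F(3) by (intro power_mono) auto
    then show "(norm (F n s))\<^sup>2 \<le> M\<^sup>2 * W s ^ (2 * n)"
      by (simp add: power_mult_distrib power_mult[symmetric] mult.commute)
  qed auto
  then have "4 * real n ^ n * integral {?a..?b} (\<lambda>x. (norm (F n x))\<^sup>2 * ((x - ?a) * (?b - x)) ^ n)
      \<le> 4 * real n ^ n * (M\<^sup>2 * weight_constant c n * (1 + growth n \<kappa>))"
    by (intro mult_left_mono) auto
  with p(2) have "real d ^ (2 * n) * integral {?a..?b} (\<lambda>x. (norm (F 0 x - poly p (of_real x)))\<^sup>2)
      \<le> (4 * real n ^ n * weight_constant c n + 1) * M\<^sup>2 * (1 + growth n \<kappa>)"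
    by (simp add: algebra_simps)
  moreover have "real d ^ (2 * n) = (real d ^ n)\<^sup>2" by (simp add: power_mult[symmetric] mult.commute)
  moreover have "0 < (real d ^ n)\<^sup>2" using d by simp
  ultimately show ?thesis using p(1)
    by (intro exI[of _ p] conjI) (simp_all only: pos_le_divide_eq mult.commute)
qed

end

theorem corollary13:
  fixes K :: "(real^2) set" and P t1 t2 :: real and \<gamma> :: "real \<Rightarrow> real^2" and \<alpha> :: "real^2"
    and u :: "real \<Rightarrow> real^2 \<Rightarrow> complex"
    and b :: "index \<Rightarrow> real \<Rightarrow> complex" and Z :: "real \<Rightarrow> real"
    and \<Psi> :: "nat \<Rightarrow> int \<Rightarrow> real \<Rightarrow> complex" and a :: "nat \<Rightarrow> int \<Rightarrow> nat \<Rightarrow> complex"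
    and R :: "real \<Rightarrow> (real \<Rightarrow> complex) \<Rightarrow> real \<Rightarrow> complex" and f :: "real \<Rightarrow> real \<Rightarrow> complex"
    and Ck ck :: "real \<Rightarrow> real" and k0 :: real
    and \<xi>1 \<xi>2 \<zeta>1 \<zeta>2 :: real and \<epsilon> :: "nat \<Rightarrow> real"
    and n m \<beta> :: nat
  assumes obstacle: "convex_obstacle K P \<gamma>"
    and incidence: "norm \<alpha> = 1" "shadow_boundary P \<gamma> \<alpha> t1 t2"
    and field: "\<And>k. k > 0 \<Longrightarrow> scattered_field K \<gamma> \<alpha> k (u k)"
    and expansion: "asymptotic_expansion P t1 t2 (slow_field \<gamma> \<alpha> u) b Z \<Psi> a"
    and k0: "k0 > 1"
    and operator: "\<And>k. k \<ge> k0 \<Longrightarrow> coercive_operator P (R k) (Ck k) (ck k)"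
    and equation: "\<And>k. k \<ge> k0 \<Longrightarrow> f k \<in> L2 P"
      "\<And>k. k \<ge> k0 \<Longrightarrow> AE s in lebesgue_on {0..2 * P}. R k (total_field \<gamma> \<alpha> u k) s = f k s"
    and widths: "\<xi>1 > 0" "\<xi>2 > 0" "\<zeta>1 > 0" "\<zeta>2 > 0"
      "t1 + \<xi>1 < t2 - \<xi>2" "t2 + \<zeta>2 < 2 * P + t1 - \<zeta>1"
    and m: "m \<ge> 1"
    and \<epsilon>: "\<And>j. j \<in> {1..m} \<Longrightarrow>
      \<epsilon> j = 1/3 * ((2 * real m - 2 * real j + 1) / (2 * real m + 1))"
  shows "\<exists>C>0. \<forall>k\<ge>k0. \<forall>d::nat. d \<ge> 1 \<and> int d \<ge> int n - 1 \<longrightarrow>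
    (\<forall>\<eta>'. galerkin_approximation P
        (galerkin_space P \<gamma> \<alpha> k (4 * m) (region P t1 t2 \<xi>1 \<xi>2 \<zeta>1 \<zeta>2 m \<epsilon> k) (\<lambda>_. d))
        (R k) (f k) (asymptotic_part \<gamma> \<alpha> b Z \<Psi> \<beta> k) \<eta>' \<longrightarrow>
      L2_norm P (\<lambda>s. total_field \<gamma> \<alpha> u k s - \<eta>' s)
        \<le> C * (Ck k / ck k) * k powr (- real \<beta> / 3) * real m *
          ((1 + of_bool (n = 1) * sqrt (ln k)
              + of_bool (n \<ge> 2) * (k powr (1 / (6 * real m + 3))) ^ (n - 1))
            / real d ^ n))"
proof -
  have P: "P > 0" and \<gamma>: "periodic_smooth (2 * P) \<gamma>" using obstacle by (auto simp: convex_obstacle_def)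
  have t: "0 < t1" "t1 < t2" "t2 < 2 * P" using incidence(2) by (auto simp: shadow_boundary_def)
  interpret region_partition P t1 t2 \<xi>1 \<xi>2 \<zeta>1 \<zeta>2 m
    using m widths by unfold_locales
  define W where "W = concentration Z"
  have W0: "0 \<le> W k s" for k s by (simp add: W_def concentration_nonneg)
  obtain c where c: "c > 0" "\<And>k A B s. (A, B) \<in> {(t2 - 2 * P, t1), (t1, t2), (t2, 2 * P + t1)} \<Longrightarrow>
      A < s \<Longrightarrow> s < B \<Longrightarrow> W k s \<le> 1 / c * (1 / (s - A) + 1 / (B - s))"
    using concentration_arcs[OF t expansion] unfolding W_def by blast
  define rem where "rem = (\<lambda>k s. slow_field \<gamma> \<alpha> u (s, k)
      - (\<Sum>i\<in>leading_indices \<beta>. expansion_term b Z \<Psi> i (s, k)))"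
  have sym: "weighted_symbol k0 W n (\<lambda>k s. k powr (- real \<beta> / 3)) rem"
    unfolding rem_def W_def using k0 by (intro weighted_symbol_remainder[OF expansion P]) auto
  have rem_cont: "continuous_on UNIV (rem k)" if "k \<ge> k0" for k
    using weighted_symbol_continuous[OF sym] W0 that by blast
  obtain F C0 where F: "F 0 = rem"
    "\<And>i k s. i < n \<Longrightarrow> k \<ge> k0 \<Longrightarrow> (F i k has_vector_derivative F (Suc i) k s) (at s)"
    "\<And>k. k \<ge> k0 \<Longrightarrow> continuous_on UNIV (F n k)" and C0: "C0 > 0"
    "\<And>k s. k \<ge> k0 \<Longrightarrow> norm (F n k s) \<le> C0 * (k powr (- real \<beta> / 3) * W k s ^ n)"
    using weighted_symbol_derivatives[OF _ sym] W0 by metis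
  define H where "H = 4 * real n ^ n * weight_constant c n + 1"
  have H: "H > 0" unfolding H_def using weight_constant_nonneg[OF P c(1), of n] by (intro add_nonneg_pos) auto
  \<comment> \<open>The root of the factor 5 for the translates, 4 for the number \<open>4 * m\<close> of regions, and 2
    for the growth bound.\<close>
  define C where "C = sqrt (40 * H) * C0"
  have C: "C > 0" using H C0(1) by (simp add: C_def)
  have \<gamma>_cont: "continuous_on UNIV \<gamma>"
    using \<gamma> by (intro C_infinity_continuous_on) (simp add: periodic_smooth_def)
  have slow: "slow_field \<gamma> \<alpha> u \<in> hoermander_class P 0 (2/3) (1/3)"
    and Z: "periodic_smooth (2 * P) Z" and b: "\<And>i. i \<in> indices \<Longrightarrow> periodic_smooth (2 * P) (b i)"
    using expansion by (simp_all add: asymptotic_expansion_def)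
  have main: "L2_norm P (\<lambda>s. total_field \<gamma> \<alpha> u k s - \<eta>' s)
        \<le> C * (Ck k / ck k) * k powr (- real \<beta> / 3) * real m *
          ((1 + of_bool (n = 1) * sqrt (ln k)
              + of_bool (n \<ge> 2) * (k powr (1 / (6 * real m + 3))) ^ (n - 1))
            / real d ^ n)"
    if k: "k \<ge> k0" and d: "d \<ge> 1" "int d \<ge> int n - 1" and
      approx: "galerkin_approximation P
        (galerkin_space P \<gamma> \<alpha> k (4 * m) (region P t1 t2 \<xi>1 \<xi>2 \<zeta>1 \<zeta>2 m \<epsilon> k) (\<lambda>_. d))
        (R k) (f k) (asymptotic_part \<gamma> \<alpha> b Z \<Psi> \<beta> k) \<eta>'" for k d \<eta>'
  proof -
    have k1: "k > 1" using k k0 by simp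
    define S where "S = region P t1 t2 \<xi>1 \<xi>2 \<zeta>1 \<zeta>2 m \<epsilon> k"
    define V where "V = galerkin_space P \<gamma> \<alpha> k (4 * m) S (\<lambda>_. d)"
    define pw where "pw = (\<lambda>s. plane_wave \<alpha> k (\<gamma> s))"
    define \<eta> where "\<eta> = total_field \<gamma> \<alpha> u k"
    define \<sigma> where "\<sigma> = asymptotic_part \<gamma> \<alpha> b Z \<Psi> \<beta> k"
    define \<kappa> where "\<kappa> = k powr (2 / (6 * real m + 3))"
    have \<kappa>: "1 < \<kappa>" unfolding \<kappa>_def using k1 by (intro gr_one_powr) (auto simp: add_nonneg_pos)
    let ?x = "breakpoint (1 / \<kappa>)"
    have pw_cont: "continuous_on UNIV pw"
      unfolding pw_def plane_wave_def by (intro continuous_intros \<gamma>_cont)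
    have pw_norm: "norm (pw s) = 1" for s by (simp add: pw_def plane_wave_def)
    have \<eta>_slow: "\<eta> s = pw s * slow_field \<gamma> \<alpha> u (s, k)" for s
      by (simp add: \<eta>_def pw_def plane_wave_def slow_field_def mult.assoc[symmetric] flip: exp_add)
    have \<sigma>_slow: "\<sigma> s = pw s * (\<Sum>i\<in>leading_indices \<beta>. expansion_term b Z \<Psi> i (s, k))" for s
      by (simp add: \<sigma>_def pw_def asymptotic_part_def)
    have diff: "\<eta> s - \<sigma> s = pw s * rem k s" for s
      by (simp add: \<eta>_slow \<sigma>_slow rem_def right_diff_distrib)
    have slow_cont: "continuous_on (UNIV \<times> {0<..}) (slow_field \<gamma> \<alpha> u)"
      using slow by (intro C_infinity_continuous_on) (simp add: hoermander_class_def)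
    have "continuous_on UNIV (\<lambda>s. slow_field \<gamma> \<alpha> u (s, k))"
      by (rule continuous_on_compose2[OF slow_cont, of UNIV "\<lambda>s. (s, k)"])
        (use k1 in \<open>auto intro!: continuous_intros\<close>)
    then have \<eta>_cont: "continuous_on UNIV \<eta>"
      unfolding \<eta>_slow[abs_def] by (intro continuous_intros pw_cont)
    have \<sigma>_eq: "\<sigma> = (\<lambda>s. \<eta> s - pw s * rem k s)" by (simp add: diff[symmetric] fun_eq_iff)
    have \<sigma>_cont: "continuous_on UNIV \<sigma>"
      unfolding \<sigma>_eq by (intro continuous_intros \<eta>_cont pw_cont rem_cont k)
    have \<eta>2: "\<eta> \<in> L2 P" and \<sigma>2: "\<sigma> \<in> L2 P" by (intro L2_of_continuous \<eta>_cont \<sigma>_cont)+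
    have op: "coercive_operator P (R k) (Ck k) (ck k)" by (rule operator[OF k])
    have R2: "\<And>\<phi>. \<phi> \<in> L2 P \<Longrightarrow> R k \<phi> \<in> L2 P"
      and lin: "\<And>\<phi> \<psi> x y. \<phi> \<in> L2 P \<Longrightarrow> \<psi> \<in> L2 P \<Longrightarrow>
        AE s in lebesgue_on {0..2 * P}. R k (\<lambda>t. x * \<phi> t + y * \<psi> t) s = x * R k \<phi> s + y * R k \<psi> s"
      and CC: "Ck k > 0" "ck k > 0"
      using op by (simp_all add: coercive_operator_def)
    have "AE s in lebesgue_on {0..2 * P}. R k (\<lambda>s. \<eta> s - \<sigma> s) s = f k s - R k \<sigma> s"
      using lin[OF \<eta>2 \<sigma>2, of 1 "-1"] equation(2)[OF k] by eventually_elim (simp add: \<eta>_def)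
    note rem_eq = this
    obtain \<rho>' where \<rho>': "galerkin_solution P V (R k) (\<lambda>s. f k s - R k \<sigma> s) \<rho>'"
      "\<eta>' = (\<lambda>s. \<sigma> s + \<rho>' s)"
      using approx unfolding galerkin_approximation_def V_def S_def \<sigma>_def by blast
    have h: "k powr (- 1/3 + \<epsilon> j) = (1 / \<kappa>) ^ j" if "j \<in> {1..m}" for j
      unfolding \<kappa>_def
      by (rule region_width_exponent[OF m _ that, where \<epsilon> = \<epsilon>]) (use k1 \<epsilon>[OF that] in simp_all)
    have S_piece: "S (region_index i) = {?x i..?x (Suc i)}" if "i < 4 * m" for i
      unfolding S_def using that h by (rule region_eq_piece)
    have x_less: "?x i < ?x (Suc i)" if "i < 4 * m" for i
      using \<kappa> by (intro breakpoint_less[OF that]) auto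
    have x_ends: "?x 0 = t1 - \<zeta>1 / \<kappa>" "?x (4 * m) = ?x 0 + 2 * P"
      using m by (simp_all add: breakpoint_simps(1)[of 0] breakpoint_simps(5))
    have "\<zeta>1 / \<kappa> \<le> \<zeta>1" using \<kappa> widths by (simp add: divide_le_eq mult_le_cancel_left1)
    then have x0: "?x 0 \<in> {- (2 * P)..2 * P}"
      using x_ends(1) t widths P \<kappa> by (auto intro: order.trans[of _ "t1"])
    have index_of: "\<exists>i<4 * m. j = region_index i" if "j \<in> {1..4 * m}" for j
      using region_index_bij that unfolding bij_betw_def by (metis imageE lessThan_iff)
    have S_sub: "\<exists>a b. S j = {a..b} \<and> S j \<subseteq> {- (2 * P)..2 * (2 * P)}" if j: "j \<in> {1..4 * m}" for j
    proof -
      obtain i where i: "i < 4 * m" "j = region_index i" using index_of[OF j] by blast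
      have "?x 0 \<le> ?x i" "?x (Suc i) \<le> ?x (4 * m)"
        using i x_less by (auto intro: increasing_mono[of "4 * m"])
      then have "S j \<subseteq> {- (2 * P)..2 * (2 * P)}" using S_piece[OF i(1)] i(2) x0 x_ends(2) by auto
      then show ?thesis using S_piece[OF i(1)] i(2) by blast
    qed
    have V2: "V \<subseteq> L2 P"
      unfolding V_def using S_sub by (intro galerkin_space_L2[OF P]) (use pw_cont in \<open>simp_all add: pw_def\<close>)
    define M where "M = C0 * k powr (- real \<beta> / 3)"
    have M: "0 < M" using C0 k1 by (simp add: M_def)
    define E where "E = H * M\<^sup>2 * (1 + growth n \<kappa>) / (real d ^ n)\<^sup>2"
    \<comment> \<open>The bound of \<open>W\<close> on the pieces around the zeros as a power of \<open>\<kappa>\<close>.\<close>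
    have w2: "(k powr (1/3))\<^sup>2 = \<kappa> ^ (2 * m + 1)"
    proof -
      have "(k powr (1/3))\<^sup>2 = k powr (2/3)"
        using k1 by (simp add: powr_powr flip: powr_realpow)
      also have "(2/3::real) = 2 / (6 * real m + 3) * real (2 * m + 1)"
        by (simp add: divide_simps add_nonneg_pos)
      also have "2 / (6 * real m + 3) * real (2 * m + 1) = real (2 * m + 1) * (2 / (6 * real m + 3))"
        by (rule mult.commute)
      also have "k powr \<dots> = \<kappa> ^ (2 * m + 1)"
        unfolding \<kappa>_def by (rule powr_power[symmetric]) (use k1 in simp)
      finally show ?thesis .
    qed
    have "\<exists>p. degree p \<le> d \<and> integral {?x i..?x (Suc i)} (\<lambda>s. (norm (rem k s - poly p (of_real s)))\<^sup>2) \<le> E"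
      if i: "i < 4 * m" for i
    proof -
      have "\<exists>p. degree p \<le> d \<and> integral {?x i..?x (Suc i)} (\<lambda>s. (norm (F 0 k s - poly p (of_real s)))\<^sup>2)
          \<le> (4 * real n ^ n * weight_constant c n + 1) * M\<^sup>2 * (1 + growth n \<kappa>) / (real d ^ n)\<^sup>2"
      proof (rule approximation_in_pieces[where W = "W k" and w = "k powr (1/3)" and F = "\<lambda>i. F i k"])
        show "t2 < 2 * P + t1" using t by simp
        show "W k s \<le> k powr (1/3)" for s by (simp add: W_def concentration_le)
        show "norm (F n k s) \<le> M * W k s ^ n" for s using C0(2)[OF k, of s] by (simp add: M_def mult_ac)
        show "n \<le> Suc d" using d by simp
      qed (use t P \<kappa> c W0 w2 F k M d i in auto)
      then show ?thesis by (simp add: F(1) E_def H_def)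
    qed
    then obtain p where p: "\<And>i. i < 4 * m \<Longrightarrow> degree (p i) \<le> d"
      "\<And>i. i < 4 * m \<Longrightarrow> integral {?x i..?x (Suc i)} (\<lambda>s. (norm (rem k s - poly (p i) (of_real s)))\<^sup>2) \<le> E"
      by metis
    define q where "q = (\<lambda>j. p (inv_into {..<4 * m} region_index j))"
    have q_idx: "q (region_index i) = p i" if "i < 4 * m" for i
      using region_index_bij that by (simp add: q_def bij_betw_def)
    have q_deg: "degree (q j) \<le> d" if j: "j \<in> {1..4 * m}" for j
    proof -
      obtain i where "i < 4 * m" "j = region_index i" using index_of[OF j] by blast
      then show ?thesis using q_idx p(1) by simp
    qed
    let ?v = "\<lambda>s. \<Sum>j=1..4 * m. periodize (2 * P) (S j) (\<lambda>t. poly (q j) (of_real t)) s"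
    \<comment> \<open>The competitor in the lemma of Cea.\<close>
    have vV: "(\<lambda>s. pw s * ?v s) \<in> V"
      unfolding V_def galerkin_space_def pw_def by (intro CollectI exI[of _ q] conjI ballI refl q_deg)
    have norm_eq: "norm (\<eta> s - \<sigma> s - pw s * ?v s) = norm (rem k s - ?v s)" for s
      unfolding diff by (simp add: norm_mult pw_norm flip: right_diff_distrib)
    have diff2: "(\<lambda>s. \<eta> s - \<sigma> s - pw s * ?v s) \<in> L2 P"
      using V2 vV by (intro L2_diff \<eta>2 \<sigma>2) auto
    have rem_per: "rem k (s + 2 * P) = rem k s" for s
    proof -
      have "slow_field \<gamma> \<alpha> u (s + 2 * P, k) = slow_field \<gamma> \<alpha> u (s, k)"
        using slow k1 by (simp add: hoermander_class_def)
      moreover have "expansion_term b Z \<Psi> i (s + 2 * P, k) = expansion_term b Z \<Psi> i (s, k)"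
        if "i \<in> leading_indices \<beta>" for i
        using b[of i] Z that by (auto simp: expansion_term_def periodic_smooth_def leading_indices_def split: prod.splits)
      ultimately show ?thesis by (simp add: rem_def)
    qed
    have "(L2_norm P (\<lambda>s. rem k s - ?v s))\<^sup>2 \<le> 5 * real (4 * m) * E"
    proof (rule L2_norm_piecewise_le[where x = ?x and \<sigma> = region_index])
      show "integrable (lebesgue_on {0..2 * P}) (\<lambda>s. (norm (rem k s - ?v s))\<^sup>2)"
        using diff2 unfolding L2_def mem_Collect_eq norm_eq by (rule conjunct2)
      show "integral {?x i..?x (Suc i)} (\<lambda>s. (norm (rem k s - poly (q (region_index i)) (of_real s)))\<^sup>2) \<le> E"
        if "i < 4 * m" for i using p(2)[OF that] by (simp add: q_idx that)
      show "continuous_on UNIV (\<lambda>t. poly (q j) (complex_of_real t))" for j by (intro continuous_intros)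
    qed (use P x_less x_ends x0 region_index_bij S_piece rem_cont k rem_per in auto)
    moreover have "L2_norm P (\<lambda>s. \<eta> s - \<sigma> s - pw s * ?v s) = L2_norm P (\<lambda>s. rem k s - ?v s)"
      unfolding L2_norm_def norm_eq ..
    ultimately have sq: "(L2_norm P (\<lambda>s. \<eta> s - \<sigma> s - pw s * ?v s))\<^sup>2 \<le> 20 * real m * E" by simp
    define Q where "Q = 1 + of_bool (n = 1) * sqrt (ln k)
        + of_bool (n \<ge> 2) * (k powr (1 / (6 * real m + 3))) ^ (n - 1)"
    have Q: "1 + growth n \<kappa> \<le> 2 * Q\<^sup>2" "1 \<le> Q"
      unfolding \<kappa>_def using growth_le_square[OF k1 Q_def] by auto
    let ?bound = "C * k powr (- real \<beta> / 3) * real m * (Q / real d ^ n)"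
    have "20 * real m * E \<le> ?bound\<^sup>2"
    proof -
      have "20 * real m * E = 20 * real m * (H * M\<^sup>2 * (1 + growth n \<kappa>)) / (real d ^ n)\<^sup>2"
        by (simp add: E_def)
      also have "\<dots> \<le> 20 * (real m)\<^sup>2 * (H * M\<^sup>2 * (2 * Q\<^sup>2)) / (real d ^ n)\<^sup>2"
        using Q H M m growth_nonneg[of \<kappa> n] \<kappa>
        by (intro divide_right_mono mult_mono mult_left_mono) (auto simp: power2_eq_square)
      also have "\<dots> = ?bound\<^sup>2"
        using H by (simp add: C_def M_def power_mult_distrib power_divide)
      finally show ?thesis .
    qed
    with sq have "(L2_norm P (\<lambda>s. \<eta> s - \<sigma> s - pw s * ?v s))\<^sup>2 \<le> ?bound\<^sup>2" by linarith
    then have best: "L2_norm P (\<lambda>s. \<eta> s - \<sigma> s - pw s * ?v s) \<le> ?bound"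
      using C Q by (rule_tac power2_le_imp_le) auto
    have "L2_norm P (\<lambda>s. (\<eta> s - \<sigma> s) - \<rho>' s) \<le> Ck k / ck k * L2_norm P (\<lambda>s. (\<eta> s - \<sigma> s) - pw s * ?v s)"
      by (rule cea_lemma[OF op V2 _ L2_diff[OF \<eta>2 \<sigma>2] L2_diff[OF equation(1)[OF k] R2[OF \<sigma>2]] rem_eq \<rho>'(1) vV])
        (unfold V_def, rule galerkin_space_diff)
    also have "\<dots> \<le> Ck k / ck k * ?bound"
      using best CC by (intro mult_left_mono) auto
    finally have "L2_norm P (\<lambda>s. \<eta> s - \<eta>' s) \<le> Ck k / ck k * ?bound"
      unfolding \<rho>'(2) by (simp add: diff_diff_eq)
    then show ?thesis by (simp add: \<eta>_def Q_def mult_ac)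
  qed
  show ?thesis using C main by blast
qed

end
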